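(* Let $\mu$ be a positive Radon measure on $\mathbb{R}^n$, let $\Omega\subset\mathbb{R}^n$ be an open set with $\mu(\Omega)<\infty$, and let $f\colon\Omega\to\mathbb{R}^n$ be a Borel map such that $f(x)\in V(\mu,x)^\perp$ for $\mu$-a.e. $x\in\Omega$. Then for every $\varepsilon>0$ there exist a compact set $K\subset\Omega$ and a function $g\colon\Omega\to\mathbb{R}$ of class $C^1$ such that \begin{gather*} \mu(\Omega\setminus K)<\varepsilon,\qquad Dg(x)=f(x)\ \text{ for all } x\in K,\\ \|Dg\|_{L^p(\mu)}\le (1+\varepsilon)\|f\|_{L^p(\mu)}\quad\text{for every } p\in[1,\infty]. \end{gather*}
   Context: All $L^p(\mu)$ norms are taken over $\Omega$ with respect to $\mu$. The decomposability bundle of a positive Radon measure $\mu$ on $\mathbb{R}^n$ is a Borel map $x\mapsto V(\mu,x)$ with values in the set of linear subspaces of $\mathbb{R}^n$ (of any dimension) with the property that, for $\mu$-a.e. $x$, a vector $v\in\mathbb{R}^n$ belongs to $V(\mu,x)$ if and only if there exists an $\mathbb{R}^n$-valued (finite) measure $T$ with $\operatorname{div}T=0$ in the sense of distributions such that $\lim_{r\to0}\frac{\mathbb{M}((T-v\mu)\llcorner B(x,r))}{\mu(B(x,r))}=0$, where $\mathbb{M}(\nu)=|\nu|(\mathbb{R}^n)$ is the total variation mass and $\nu\llcorner E$ is the restriction of $\nu$ to $E$. (Such a map exists and is unique up to $\mu$-null sets.) *)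

theory Defs
  imports "HOL-Analysis.Analysis" "HOL-Probability.Essential_Supremum"
begin

coinductive smooth_fun :: "('a::euclidean_space \<Rightarrow> real) \<Rightarrow> bool" where
  "(\<forall>x. \<phi> differentiable (at x)) \<Longrightarrow>
   (\<forall>i\<in>Basis. smooth_fun (\<lambda>x. frechet_derivative \<phi> (at x) i)) \<Longrightarrow> smooth_fun \<phi>"

definition test_function :: "('a::euclidean_space \<Rightarrow> real) \<Rightarrow> bool" where
  "test_function \<phi> \<longleftrightarrow> smooth_fun \<phi> \<and> compact (closure {x. \<phi> x \<noteq> 0})"

definition grad :: "('a::euclidean_space \<Rightarrow> real) \<Rightarrow> 'a \<Rightarrow> 'a" where
  "grad \<phi> y = (\<Sum>i\<in>Basis. frechet_derivative \<phi> (at y) i *\<^sub>R i)"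

text \<open>The R^n-valued finite measure T = tau * lam (lam a finite positive Borel measure,
  tau lam-integrable) has distributional divergence zero.\<close>
definition div_free :: "'a::euclidean_space measure \<Rightarrow> ('a \<Rightarrow> 'a) \<Rightarrow> bool" where
  "div_free lam \<tau> \<longleftrightarrow> (\<forall>\<phi>. test_function \<phi> \<longrightarrow>
      integral\<^sup>L lam (\<lambda>y. inner (grad \<phi> y) (\<tau> y)) = 0)"

definition tv :: "('a::euclidean_space set \<Rightarrow> 'a) \<Rightarrow> 'a set \<Rightarrow> ereal" where
  "tv \<nu> B = Sup {ereal (\<Sum>A\<in>P. norm (\<nu> A)) | P. finite P \<and> disjoint P \<and>
                  (\<forall>A\<in>P. A \<in> sets borel \<and> A \<subseteq> B)}"

text \<open>Pointwise characterisation of the decomposability bundle V(mu,x).\<close>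
definition decomp_set :: "'a::euclidean_space measure \<Rightarrow> 'a \<Rightarrow> 'a set" where
  "decomp_set \<mu> x = {v. \<exists>(lam::'a measure) (\<tau>::'a \<Rightarrow> 'a).
      sets lam = sets borel \<and> finite_measure lam \<and> integrable lam \<tau> \<and> div_free lam \<tau> \<and>
      ((\<lambda>r. tv (\<lambda>E. set_lebesgue_integral lam E \<tau> - measure \<mu> E *\<^sub>R v) (ball x r)
              / ereal (measure \<mu> (ball x r))) \<longlongrightarrow> 0) (at_right 0)}"

definition Lp_norm :: "'a measure \<Rightarrow> ('a \<Rightarrow> real) \<Rightarrow> ereal \<Rightarrow> ereal" where
  "Lp_norm M h p = (if p = \<infinity> then esssup M (\<lambda>x. ereal (h x))
     else (let I = (\<integral>\<^sup>+x. ennreal (h x powr real_of_ereal p) \<partial>M) in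
           if I = \<infinity> then \<infinity> else ereal (enn2real I powr (1 / real_of_ereal p))))"

end

theory Submission
  imports Defs "HOL-Probability.Probability" "HOL-Probability.Discrete_Topology"
begin

text \<open>
  The proof has two ingredients.

  Duality. Let \<open>f\<close> be continuous on a compact set \<open>K\<close> and \<open>|f| < w\<close> there. If \<open>f\<close> were not an
  \<open>L\<^sup>1(\<mu>\<llcorner>K)\<close>-limit of gradients of test functions bounded by \<open>w\<close> everywhere, Hahn-Banach and
  Riesz would give a density \<open>h\<close> on \<open>K\<close> and a vector measure \<open>T'\<close> with \<open>\<integral> w d|T'| \<le> 1\<close>,
  \<open>\<integral>\<^sub>K f \<cdot> h d\<mu> = 1\<close>, and \<open>h \<mu>\<llcorner>K - T'\<close> divergence free. By Lebesgue differentiation (valid for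
  every finite measure by Besicovitch covering) the density of \<open>h \<mu>\<llcorner>K - T'\<close> with respect to \<open>\<mu>\<close> lies in
  the decomposability bundle almost everywhere, hence is orthogonal to \<open>f\<close>; so \<open>1 = \<integral> f \<cdot> dT'\<close>,
  taken over a set where \<open>|f| < w\<close>, which is less than 1.

  Correction. The remainder \<open>f - D\<phi>\<close> is no longer orthogonal to the bundle, but it is uniformly
  small on most of \<open>K\<close>. Alberti's construction, with functions \<open>u\<^sub>i(x) s(\<lambda> x\<^sub>i - a\<^sub>i) / \<lambda>\<close> for a
  periodic \<open>s\<close> with \<open>s' = 1\<close> outside a small set, turns any uniformly small field into an exact
  gradient off a set of small measure, at the cost of a multiplicative constant in the uniform norm.
\<close>

text \<open>The factor \<open>1 + \<epsilon>\<close> must serve all \<open>p\<close> at once, so the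
  gradient is dominated pointwise instead of estimating errors norm by norm. The field is cut off at
  a level \<open>M0\<close> that is almost a quantile: |f| > \<open>M0\<close> on a set of measure
  below \<open>\<eta>\<close>, but |f| > \<open>M0 / \<rho>\<close> on a set of measure at least
  \<open>\<eta>\<close>. The second fact bounds every L^p norm of the field from below; hence a
  gradient of size at most \<open>\<rho> * M0\<close> on a very small set, or a tiny gradient
  everywhere, costs only a factor close to 1, uniformly in \<open>p\<close>. This is why the duality
  argument carries a weight \<open>w\<close> on the whole space: \<open>w\<close> is close to |f| on
  the compact set, at most slightly above \<open>M0\<close> near it, and tiny elsewhere.

  The order of the choices matters. The constant lost in the correction depends on the size of the
  exceptional set but not on the field. So the admissible size of the remainder is fixed first, and
  the approximation by gradients is then asked for that accuracy.\<close>

section \<open>Hahn-Banach and Riesz representation\<close>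

text \<open>Functionals are given by graphs: that a graph below \<open>p\<close> is single-valued follows from \<open>p 0 = 0\<close>.\<close>

lemma Hahn_Banach_graph:
  fixes p :: "'v::real_vector \<Rightarrow> real" and G :: "('v \<times> real) set"
  assumes sub: "\<And>u v. p (u + v) \<le> p u + p v"
    and hom: "\<And>c v. 0 \<le> c \<Longrightarrow> p (c *\<^sub>R v) = c * p v"
    and G: "subspace G" and Gp: "\<And>v a. (v, a) \<in> G \<Longrightarrow> a \<le> p v"
  obtains l where "linear l" "\<And>v. l v \<le> p v" "\<And>v a. (v, a) \<in> G \<Longrightarrow> l v = a"
proof -
  define A where "A = {H. subspace H \<and> G \<subseteq> H \<and> (\<forall>(v, a) \<in> H. a \<le> p v)}"
  have p0: "p 0 = 0" using hom[of 0 0] by simp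
  have "\<exists>M\<in>A. \<forall>X\<in>A. M \<subseteq> X \<longrightarrow> X = M"
  proof (rule subset_Zorn_nonempty)
    show "A \<noteq> {}" using G Gp unfolding A_def by auto
    fix C assume C: "C \<noteq> {}" "subset.chain A C"
    have CA: "H \<in> A" if "H \<in> C" for H
      using C(2) that by (auto simp: subset.chain_def)
    have comp: "H \<subseteq> H' \<or> H' \<subseteq> H" if "H \<in> C" "H' \<in> C" for H H'
      using C(2) that by (auto simp: subset.chain_def)
    have "subspace (\<Union>C)"
    proof (rule subspaceI)
      show "0 \<in> \<Union>C" using C(1) CA unfolding A_def by (blast intro: subspace_0)
    next
      fix x y assume "x \<in> \<Union>C" "y \<in> \<Union>C"
      then obtain H H' where H: "H \<in> C" "x \<in> H" "H' \<in> C" "y \<in> H'" by auto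
      from comp[OF H(1,3)] obtain K where "K \<in> C" "x \<in> K" "y \<in> K" using H by auto
      then show "x + y \<in> \<Union>C" using CA unfolding A_def by (auto intro: subspace_add)
    next
      fix c and x assume "x \<in> \<Union>C"
      then show "c *\<^sub>R x \<in> \<Union>C" using CA unfolding A_def by (auto intro!: subspace_scale)
    qed
    moreover have "G \<subseteq> \<Union>C" using C(1) CA unfolding A_def by auto
    ultimately show "\<Union>C \<in> A" using CA unfolding A_def by auto
  qed
  then obtain H where HA: "H \<in> A" and Hmax: "\<And>X. X \<in> A \<Longrightarrow> H \<subseteq> X \<Longrightarrow> X = H" by blast
  have H: "subspace H" "G \<subseteq> H" and Hp: "\<And>v a. (v, a) \<in> H \<Longrightarrow> a \<le> p v"
    using HA unfolding A_def by auto
  have zero: "a = 0" if "(0, a) \<in> H" for a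
  proof -
    have "(0, -a) \<in> H" using subspace_neg[OF H(1) that] by simp
    then show ?thesis using Hp[OF that] Hp[of 0 "-a"] p0 by simp
  qed
  have uniq: "a = b" if "(v, a) \<in> H" "(v, b) \<in> H" for v a b
    using zero[of "a - b"] subspace_diff[OF H(1) that] by simp
  have total: "\<exists>a. (v0, a) \<in> H" for v0
  proof -
    \<comment> \<open>The value \<open>t\<close> at \<open>v0\<close> has to satisfy
      \<open>a - p (v - v0) \<le> t \<le> p (w + v0) - b\<close> for all \<open>(v, a)\<close> and
      \<open>(w, b)\<close> in \<open>H\<close>. Subadditivity separates the two families, and
      \<open>t\<close> is taken as the supremum of the lower one.\<close>
    define L where "L = {a - p (v - v0) | v a. (v, a) \<in> H}"
    have 00: "(0, 0) \<in> H" using subspace_0[OF H(1)] by (simp add: zero_prod_def)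
    have LU: "a - p (v - v0) \<le> p (w + v0) - b" if "(v, a) \<in> H" "(w, b) \<in> H" for v a w b
    proof -
      have "a + b \<le> p (v + w)" using Hp subspace_add[OF H(1) that] by simp
      also have "\<dots> = p ((v - v0) + (w + v0))" by (simp add: algebra_simps)
      also have "\<dots> \<le> p (v - v0) + p (w + v0)" by (rule sub)
      finally show ?thesis by simp
    qed
    have Lne: "L \<noteq> {}" using 00 unfolding L_def by blast
    have Lbd: "bdd_above L" using LU[OF _ 00] unfolding L_def bdd_above_def by blast
    define t where "t = Sup L"
    have t1: "a - p (v - v0) \<le> t" if "(v, a) \<in> H" for v a
      unfolding t_def by (rule cSup_upper[OF _ Lbd]) (use that in \<open>auto simp: L_def\<close>)
    have t2: "t \<le> p (w + v0) - b" if "(w, b) \<in> H" for w b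
      unfolding t_def by (rule cSup_least[OF Lne]) (use LU that in \<open>auto simp: L_def\<close>)
    define H' where "H' = span (insert (v0, t) H)"
    \<comment> \<open>An element of \<open>H'\<close> is a multiple \<open>s\<close> of
      \<open>(v0, t)\<close> plus an element of \<open>H\<close>. Dividing by the absolute value of
      \<open>s\<close> reduces the claim to \<open>t2\<close> or \<open>t1\<close>, according to the
      sign of \<open>s\<close>.\<close>
    have "a \<le> p v" if va: "(v, a) \<in> H'" for v a
    proof -
      obtain s where "(v, a) - s *\<^sub>R (v0, t) \<in> span H"
        using va unfolding H'_def span_insert by auto
      then have s: "(v - s *\<^sub>R v0, a - s * t) \<in> H" using H(1) by (simp add: span_eq_iff[THEN iffD2])
      consider "s = 0" | "s > 0" | "s < 0" by linarith
      then show ?thesis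
      proof cases
        case 1 then show ?thesis using s Hp by simp
      next
        case 2
        have "((1/s) *\<^sub>R (v - s *\<^sub>R v0), (1/s) * (a - s * t)) \<in> H"
          using subspace_scale[OF H(1) s, of "1/s"] by simp
        from t2[OF this] have "t \<le> p ((1/s) *\<^sub>R v) - (1/s) * (a - s * t)"
          using 2 by (simp add: scaleR_diff_right)
        then have "(1/s) * a \<le> (1/s) * p v" using 2 hom[of "1/s" v] by (simp add: algebra_simps)
        then show ?thesis using 2 by (simp add: field_simps)
      next
        case 3
        have "((1/(-s)) *\<^sub>R (v - s *\<^sub>R v0), (1/(-s)) * (a - s * t)) \<in> H"
          using subspace_scale[OF H(1) s, of "1/(-s)"] by simp
        from t1[OF this] have "(1/(-s)) * (a - s * t) - p ((1/(-s)) *\<^sub>R v) \<le> t"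
          using 3 by (simp add: scaleR_diff_right)
        then have "(1/(-s)) * a \<le> (1/(-s)) * p v" using 3 hom[of "1/(-s)" v] by (simp add: field_simps)
        then show ?thesis using 3 by (simp add: field_simps)
      qed
    qed
    moreover have "H \<subseteq> H'" unfolding H'_def using span_superset by blast
    moreover have "subspace H'" unfolding H'_def by simp
    ultimately have "H' = H" using Hmax[of H'] H(2) unfolding A_def by auto
    moreover have "(v0, t) \<in> H'" unfolding H'_def by (simp add: span_base)
    ultimately show ?thesis by auto
  qed
  define l where "l v = (THE a. (v, a) \<in> H)" for v
  have l: "(v, l v) \<in> H" for v
    unfolding l_def using total[of v] uniq by (metis theI)
  have leq: "l v = a" if "(v, a) \<in> H" for v a using uniq[OF l that] .
  show thesis
  proof
    show "linear l"
    proof (rule linearI)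
      show "l (u + v) = l u + l v" for u v
        using leq subspace_add[OF H(1) l[of u] l[of v]] by simp
      show "l (c *\<^sub>R v) = c *\<^sub>R l v" for c v
        using leq subspace_scale[OF H(1) l[of v], of c] by simp
    qed
    show "l v \<le> p v" for v using Hp l by blast
    show "l v = a" if "(v, a) \<in> G" for v a using leq that H(2) by blast
  qed
qed

text \<open>Points are coded by their membership in the sets of a countable basis, read as base-4 digits.\<close>

lemma compact_coded_by_reals:
  fixes Z :: "'b::euclidean_space set"
  assumes Z: "compact Z"
  obtains c :: "'b \<Rightarrow> real" and d :: "real \<Rightarrow> 'b"
  where "\<And>z. 0 \<le> c z" "\<And>z. c z \<le> 1" "continuous_on UNIV d" "\<And>z. z \<in> Z \<Longrightarrow> d (c z) = z"
proof -
  obtain B :: "'b set set" where B: "countable B" "topological_basis B"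
    using ex_countable_basis by blast
  have Bne: "B \<noteq> {}" using B(2) topological_basisE[of B UNIV undefined] by auto
  define A where "A = from_nat_into B"
  have rA: "range A = B" unfolding A_def using Bne B(1) by (rule range_from_nat_into)
  define b where "b z i = (if z \<in> A i then 1 else 0 :: real)" for z i
  define e where "e z i = b z i * (1/4)^(i+1)" for z i
  have be: "0 \<le> b z i" "b z i \<le> 1" for z i unfolding b_def by auto
  have sg: "summable (\<lambda>i. (1/4::real)^(i+1))"
    using summable_geometric[of "1/4::real"] by (simp add: summable_mult)
  have se: "summable (e z)" for z
    by (rule summable_comparison_test[OF _ sg]) (auto simp: e_def b_def)
  define c where "c z = (\<Sum>i. e z i)" for z
  have geo: "(\<Sum>i. (1/4::real)^(i+m)) = (4/3) * (1/4)^m" for m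
  proof -
    have "(\<lambda>i. (1/4::real)^m * (1/4)^i) sums ((1/4)^m * (1 / (1 - 1/4)))"
      by (intro sums_mult geometric_sums) simp
    then show ?thesis by (simp add: sums_iff power_add mult.commute)
  qed
  have c0: "0 \<le> c z" for z unfolding c_def using se by (intro suminf_nonneg) (auto simp: e_def b_def)
  have c1: "c z \<le> 1" for z
  proof -
    have "c z \<le> (\<Sum>i. (1/4::real)^(i+1))" unfolding c_def
      by (rule suminf_le[OF _ se sg]) (auto simp: e_def b_def)
    then show ?thesis using geo[of 1] by simp
  qed
  \<comment> \<open>Later digits add up to at most a third of the weight of digit \<open>k\<close>,
    so a first difference leaves a definite gap between the codes. In base 2 the tail could fill
    this gap, and close codes might have different digits.\<close>
  have sep: "c y \<le> c z - (1/4)^(k+1) / 2"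
    if bits: "\<And>i. i < k \<Longrightarrow> b y i = b z i" and bk: "b y k = 0" "b z k = 1" for y z k
  proof -
    have "c z = (\<Sum>i. e z (i + Suc k)) + (\<Sum>i<Suc k. e z i)"
      unfolding c_def by (rule suminf_split_initial_segment[OF se])
    moreover have "(\<Sum>i. e z (i + Suc k)) \<ge> 0"
      by (rule suminf_nonneg[OF summable_ignore_initial_segment[OF se]]) (simp add: e_def be)
    moreover have "c y = (\<Sum>i. e y (i + Suc k)) + (\<Sum>i<Suc k. e y i)"
      unfolding c_def by (rule suminf_split_initial_segment[OF se])
    moreover have "(\<Sum>i. e y (i + Suc k)) \<le> (\<Sum>i. (1/4::real)^(i + (k+2)))"
    proof (rule suminf_le[OF _ summable_ignore_initial_segment[OF se]])
      show "summable (\<lambda>i. (1/4::real)^(i + (k+2)))"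
        by (rule summable_ignore_initial_segment) (simp add: summable_geometric)
      show "e y (i + Suc k) \<le> (1/4)^(i + (k+2))" for i by (simp add: e_def b_def)
    qed
    moreover have "(\<Sum>i<Suc k. e z i) - (\<Sum>i<Suc k. e y i) = (1/4)^(k+1)"
      using bits bk by (simp add: e_def)
    moreover have "(\<Sum>i. (1/4::real)^(i + (k+2))) = (1/4)^(k+1) / 3"
      unfolding geo by simp
    moreover have "(1/4::real)^(k+1) > 0" by simp
    ultimately show ?thesis by linarith
  qed
  have agree: "b y i = b z i" if cl: "\<bar>c y - c z\<bar> < (1/4)^k / 2" and "i < k" for y z i k
  proof (rule ccontr)
    assume ne: "b y i \<noteq> b z i"
    define j where "j = (LEAST j. b y j \<noteq> b z j)"
    have j: "b y j \<noteq> b z j" unfolding j_def using ne by (rule LeastI)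
    have lj: "b y m = b z m" if "m < j" for m using not_less_Least that unfolding j_def by blast
    have "j \<le> i" unfolding j_def using ne by (rule Least_le)
    then have "(1/4::real)^k \<le> (1/4)^(j+1)" using \<open>i < k\<close> by (intro power_decreasing) auto
    moreover have "\<bar>c y - c z\<bar> \<ge> (1/4)^(j+1) / 2"
    proof (cases "z \<in> A j")
      case True
      then have "c y \<le> c z - (1/4)^(j+1) / 2" using j lj by (intro sep) (auto simp: b_def)
      then show ?thesis by linarith
    next
      case False
      then have "c z \<le> c y - (1/4)^(j+1) / 2" using j lj by (intro sep) (auto simp: b_def split: if_splits)
      then show ?thesis by linarith
    qed
    ultimately show False using cl by linarith
  qed
  \<comment> \<open>Finitely many basis sets, each inside a ball of radius \<open>r/2\<close>, cover
    \<open>Z\<close>; so a long enough initial block of digits determines a point up to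
    \<open>r\<close>.\<close>
  have fine: "\<exists>k. \<forall>y\<in>Z. \<forall>z\<in>Z. (\<forall>i<k. b y i = b z i) \<longrightarrow> dist y z < r" if "r > 0" for r
  proof -
    define I where "I = {i. \<exists>x. A i \<subseteq> ball x (r/2)}"
    have cov: "Z \<subseteq> (\<Union>i\<in>I. A i)"
    proof
      fix z assume "z \<in> Z"
      obtain V where "V \<in> B" "z \<in> V" "V \<subseteq> ball z (r/2)"
        using topological_basisE[OF B(2) open_ball, of z z "r/2"] \<open>r > 0\<close> by auto
      moreover then obtain i where "V = A i" using rA by auto
      ultimately show "z \<in> (\<Union>i\<in>I. A i)" unfolding I_def by auto
    qed
    have op: "open (A i)" for i by (rule topological_basis_open[OF B(2)]) (use rA in auto)
    obtain J where J: "J \<subseteq> I" "finite J" "Z \<subseteq> (\<Union>i\<in>J. A i)"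
      by (rule compactE_image[OF Z op cov])
    have "dist y z < r" if yz: "y \<in> Z" "z \<in> Z" "\<forall>i<Suc (Max J). b y i = b z i" for y z
    proof -
      obtain i where i: "i \<in> J" "y \<in> A i" using J yz by blast
      then have "i < Suc (Max J)" using J(2) by (simp add: le_imp_less_Suc)
      then have "z \<in> A i" using i yz(3) unfolding b_def by (auto split: if_splits)
      moreover obtain x where "A i \<subseteq> ball x (r/2)" using i J unfolding I_def by blast
      ultimately have "dist x y < r/2" "dist x z < r/2" using i by auto
      then show ?thesis by (metis dist_commute dist_triangle_half_r)
    qed
    then show ?thesis by blast
  qed
  have unif: "\<exists>\<delta>>0. \<forall>y\<in>Z. \<forall>z\<in>Z. \<bar>c y - c z\<bar> < \<delta> \<longrightarrow> dist y z < r" if rpos: "r > 0" for r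
  proof -
    obtain k where k: "\<forall>y\<in>Z. \<forall>z\<in>Z. (\<forall>i<k. b y i = b z i) \<longrightarrow> dist y z < r"
      using fine[OF rpos] by blast
    have "dist y z < r" if "y \<in> Z" "z \<in> Z" "\<bar>c y - c z\<bar> < (1/4)^k / 2" for y z
      using k that agree[OF that(3)] by blast
    moreover have "(1/4::real)^k / 2 > 0" by simp
    ultimately show ?thesis by blast
  qed
  have inj: "inj_on c Z"
  proof (rule inj_onI, rule ccontr)
    fix y z assume "y \<in> Z" "z \<in> Z" "c y = c z" "y \<noteq> z"
    note yz = this
    then obtain \<delta> where "\<delta> > 0" "\<forall>y'\<in>Z. \<forall>z'\<in>Z. \<bar>c y' - c z'\<bar> < \<delta> \<longrightarrow> dist y' z' < dist y z"
      using unif[of "dist y z"] by auto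
    from this(2)[rule_format, OF yz(1,2)] this(1) yz(3) show False by simp
  qed
  \<comment> \<open>The code itself need not be continuous. Its inverse is uniformly continuous on
    the set of codes, hence extends to the closure and from there, by Tietze, to the whole
    line.\<close>
  define d0 where "d0 = inv_into Z c"
  have d0: "d0 (c z) = z" if "z \<in> Z" for z unfolding d0_def using inj that by simp
  have "uniformly_continuous_on (c ` Z) d0"
    unfolding uniformly_continuous_on_def
  proof (intro allI impI)
    fix r :: real assume "r > 0"
    then obtain \<delta> where "\<delta> > 0" and \<delta>: "\<And>y z. y \<in> Z \<Longrightarrow> z \<in> Z \<Longrightarrow> \<bar>c y - c z\<bar> < \<delta> \<Longrightarrow> dist y z < r"
      using unif by blast
    then show "\<exists>\<delta>>0. \<forall>x\<in>c ` Z. \<forall>x'\<in>c ` Z. dist x' x < \<delta> \<longrightarrow> dist (d0 x') (d0 x) < r"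
      by (intro exI[of _ \<delta>]) (auto simp: dist_real_def d0)
  qed
  then obtain g where g: "uniformly_continuous_on (closure (c ` Z)) g" "\<And>x. x \<in> c ` Z \<Longrightarrow> d0 x = g x"
    using uniformly_continuous_on_extension_on_closure by metis
  have gc: "continuous_on (closure (c ` Z)) g" using g(1) by (rule uniformly_continuous_imp_continuous)
  have "c ` Z \<subseteq> {0..1}" using c0 c1 by auto
  then have "bounded (c ` Z)" using bounded_closed_interval bounded_subset by blast
  then have "compact (closure (c ` Z))" by (simp add: compact_closure)
  then have "bounded (g ` closure (c ` Z))" using gc compact_continuous_image compact_imp_bounded by blast
  then obtain R where R: "R > 0" "\<And>x. x \<in> closure (c ` Z) \<Longrightarrow> norm (g x) \<le> R"
    by (auto simp: bounded_pos)
  obtain d where d: "continuous_on UNIV d" "\<And>x. x \<in> closure (c ` Z) \<Longrightarrow> d x = g x"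
    by (rule Tietze[OF gc, of UNIV R]) (use R in auto)
  have "d (c z) = z" if "z \<in> Z" for z
  proof -
    have "c z \<in> c ` Z" using that by simp
    then show ?thesis using d(2) g(2) d0[OF that] closure_subset[of "c ` Z"] by auto
  qed
  with c0 c1 d(1) that show thesis by blast
qed

text \<open>Extend the functional to all bounded functions by Hahn-Banach, transport it to the line by the
  coding, and take a weak limit of discrete distributions.\<close>

lemma Riesz_compact:
  fixes Z :: "'b::euclidean_space set" and l :: "('b \<Rightarrow>\<^sub>C real) \<Rightarrow> real"
  assumes Z: "compact Z" "Z \<noteq> {}" and l: "linear l"
    and pos: "\<And>h. (\<And>z. z \<in> Z \<Longrightarrow> 0 \<le> apply_bcontfun h z) \<Longrightarrow> 0 \<le> l h"
    and one: "l (const_bcontfun 1) = 1"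
  obtains \<pi> where "prob_space \<pi>" "sets \<pi> = sets borel" "AE z in \<pi>. z \<in> Z"
    "\<And>h. integral\<^sup>L \<pi> (apply_bcontfun h) = l h"
proof -
  obtain c :: "'b \<Rightarrow> real" and d :: "real \<Rightarrow> 'b"
    where c0: "\<And>z. 0 \<le> c z" and c1: "\<And>z. c z \<le> 1" and dcont: "continuous_on UNIV d"
      and dc: "\<And>z. z \<in> Z \<Longrightarrow> d (c z) = z"
    using compact_coded_by_reals[OF Z(1)] by blast
  define bd where "bd k \<longleftrightarrow> (\<exists>B. \<forall>z. \<bar>k z\<bar> \<le> B)" for k :: "'b \<Rightarrow> real"
  \<comment> \<open>Over the discrete topology every bounded function is continuous, so the type of
    bounded continuous functions provides the vector space of all bounded functions.\<close>
  define D :: "('b \<Rightarrow> real) \<Rightarrow> ('b discrete \<Rightarrow>\<^sub>C real)" where "D k = Bcontfun (\<lambda>x. k (of_discrete x))" for k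
  have cd: "continuous_on UNIV h" for h :: "'b discrete \<Rightarrow> real"
    by (simp add: continuous_on_open_vimage open_discrete)
  have Dapp: "apply_bcontfun (D k) x = k (of_discrete x)" if k: "bd k" for k x
  proof -
    obtain B where "\<And>z. \<bar>k z\<bar> \<le> B" using k unfolding bd_def by blast
    then have "(\<lambda>x. k (of_discrete x)) \<in> bcontfun" by (intro bcontfun_normI[of _ B] cd) auto
    then show ?thesis unfolding D_def by (simp add: Bcontfun_inverse)
  qed
  have hB: "bd (apply_bcontfun h)" for h
    unfolding bd_def using norm_bounded[of h] by (auto intro: exI[of _ "norm h"])
  \<comment> \<open>The supremum over \<open>Z\<close> alone makes the extended functional positive
    and blind to values off \<open>Z\<close>.\<close>
  define p where "p \<theta> = (SUP z\<in>Z. apply_bcontfun \<theta> (discrete z))" for \<theta> :: "'b discrete \<Rightarrow>\<^sub>C real"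
  have bdd: "bdd_above ((\<lambda>z. apply_bcontfun \<theta> (discrete z)) ` Z)" for \<theta> :: "'b discrete \<Rightarrow>\<^sub>C real"
    by (rule bdd_aboveI[of _ "norm \<theta>"]) (use norm_bounded[of \<theta>] in \<open>auto simp: abs_le_iff\<close>)
  have pu: "apply_bcontfun \<theta> (discrete z) \<le> p \<theta>" if "z \<in> Z" for \<theta> z
    unfolding p_def by (rule cSUP_upper[OF that bdd])
  have pl: "p \<theta> \<le> b" if "\<And>z. z \<in> Z \<Longrightarrow> apply_bcontfun \<theta> (discrete z) \<le> b" for \<theta> b
    unfolding p_def by (rule cSUP_least[OF Z(2)]) (use that in auto)
  have psc: "p (r *\<^sub>R \<theta>) \<le> r * p \<theta>" if "0 \<le> r" for r \<theta>
    by (rule pl) (use pu that in \<open>auto intro!: mult_left_mono\<close>)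
  define G where "G = range (\<lambda>h. (D (apply_bcontfun h), l h))"
  have Dadd: "D (\<lambda>z. k z + k' z) = D k + D k'" if "bd k" "bd k'" for k k'
  proof -
    obtain B B' where "\<And>z. \<bar>k z\<bar> \<le> B" "\<And>z. \<bar>k' z\<bar> \<le> B'" using \<open>bd k\<close> \<open>bd k'\<close> unfolding bd_def by blast
    then have "\<bar>k z + k' z\<bar> \<le> B + B'" for z by (meson abs_triangle_ineq add_mono order_trans)
    then have "bd (\<lambda>z. k z + k' z)" unfolding bd_def by blast
    then show ?thesis by (intro bcontfun_eqI) (simp add: Dapp that)
  qed
  have Dsc: "D (\<lambda>z. r * k z) = r *\<^sub>R D k" if "bd k" for k r
  proof -
    obtain B where "\<And>z. \<bar>k z\<bar> \<le> B" using \<open>bd k\<close> unfolding bd_def by blast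
    then have "\<bar>r * k z\<bar> \<le> \<bar>r\<bar> * B" for z by (simp add: abs_mult mult_left_mono)
    then have "bd (\<lambda>z. r * k z)" unfolding bd_def by blast
    then show ?thesis by (intro bcontfun_eqI) (simp add: Dapp that)
  qed
  have lsc: "l (r *\<^sub>R h) = r * l h" for r h using linear_scale[OF l] by simp
  have ladd: "l (h + k) = l h + l k" for h k using linear_add[OF l] .
  have lneg: "l (- h) = - l h" for h using linear_neg[OF l] .
  obtain L where L: "linear L" and Lp: "\<And>\<theta>. L \<theta> \<le> p \<theta>" and LG: "\<And>v a. (v, a) \<in> G \<Longrightarrow> L v = a"
  proof (rule Hahn_Banach_graph[of p G])
    show "p (u + v) \<le> p u + p v" for u v
      by (rule pl) (use pu in \<open>auto intro!: add_mono\<close>)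
    show "p (r *\<^sub>R v) = r * p v" if "0 \<le> r" for r v
    proof (cases "r = 0")
      case True
      have "p 0 = 0" unfolding p_def using Z(2) by simp
      then show ?thesis using True by simp
    next
      case False
      then have "p v \<le> (1/r) * p (r *\<^sub>R v)" using psc[of "1/r" "r *\<^sub>R v"] that by simp
      then show ?thesis using psc[OF that, of v] False that by (simp add: field_simps)
    qed
    show "subspace G"
    proof (rule subspaceI)
      have "D (apply_bcontfun 0) = 0" by (intro bcontfun_eqI) (subst Dapp[OF hB], simp)
      moreover have "l 0 = 0" using linear_0[OF l] .
      ultimately have "0 = (D (apply_bcontfun 0), l 0)" by (simp only: zero_prod_def)
      then show "0 \<in> G" unfolding G_def by (rule image_eqI) simp
    next
      fix x y assume "x \<in> G" "y \<in> G"
      then obtain h k where "x = (D (apply_bcontfun h), l h)" "y = (D (apply_bcontfun k), l k)"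
        unfolding G_def by blast
      then have "x + y = (D (apply_bcontfun (h + k)), l (h + k))"
        using Dadd[OF hB hB, of h k] by (simp add: ladd plus_bcontfun.rep_eq[abs_def])
      then show "x + y \<in> G" unfolding G_def by blast
    next
      fix r x assume "x \<in> G"
      then obtain h where "x = (D (apply_bcontfun h), l h)" unfolding G_def by blast
      then have "r *\<^sub>R x = (D (apply_bcontfun (r *\<^sub>R h)), l (r *\<^sub>R h))"
        using Dsc[OF hB, of r h] by (simp add: lsc scaleR_bcontfun.rep_eq[abs_def])
      then show "r *\<^sub>R x \<in> G" unfolding G_def by blast
    qed
    show "a \<le> p v" if va: "(v, a) \<in> G" for v a
    proof -
      obtain h where h: "v = D (apply_bcontfun h)" "a = l h" using va unfolding G_def by blast
      have "0 \<le> l (p v *\<^sub>R const_bcontfun 1 + (- h))"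
        by (rule pos) (use pu[of _ v] in \<open>auto simp: h Dapp hB discrete_inverse\<close>)
      then have "0 \<le> p v * 1 + (- l h)" by (simp only: ladd lsc lneg one)
      then show ?thesis by (simp add: h)
    qed
  qed auto
  define E where "E k = L (D k)" for k
  have El: "E (apply_bcontfun h) = l h" for h
    unfolding E_def by (rule LG) (auto simp: G_def)
  have Eadd: "E (\<lambda>z. k z + k' z) = E k + E k'" if "bd k" "bd k'" for k k'
    unfolding E_def Dadd[OF that] by (rule linear_add[OF L])
  have Esc: "E (\<lambda>z. r * k z) = r * E k" if "bd k" for k r
    unfolding E_def Dsc[OF that] using linear_scale[OF L] by simp
  have Ele: "E k \<le> b" if "bd k" "\<And>z. z \<in> Z \<Longrightarrow> k z \<le> b" for k b
    unfolding E_def by (rule order_trans[OF Lp pl]) (use that in \<open>auto simp: Dapp discrete_inverse\<close>)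
  have bdneg: "bd (\<lambda>z. r * k z)" if "bd k" for r k
  proof -
    obtain B where "\<And>z. \<bar>k z\<bar> \<le> B" using \<open>bd k\<close> unfolding bd_def by blast
    then have "\<bar>r * k z\<bar> \<le> \<bar>r\<bar> * B" for z by (simp add: abs_mult mult_left_mono)
    then show ?thesis unfolding bd_def by blast
  qed
  have bdadd: "bd (\<lambda>z. k z + k' z)" if k: "bd k" "bd k'" for k k'
  proof -
    obtain B B' where "\<And>z. \<bar>k z\<bar> \<le> B" "\<And>z. \<bar>k' z\<bar> \<le> B'" using k unfolding bd_def by blast
    then have "\<bar>k z + k' z\<bar> \<le> B + B'" for z by (meson abs_triangle_ineq add_mono order_trans)
    then show ?thesis unfolding bd_def by blast
  qed
  have Ege: "b \<le> E k" if "bd k" "\<And>z. z \<in> Z \<Longrightarrow> b \<le> k z" for k b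
    using Ele[OF bdneg[OF that(1), of "-1"], of "-b"] Esc[OF that(1), of "-1"] that(2) by simp
  have Eabs: "\<bar>E k - E k'\<bar> \<le> b" if "bd k" "bd k'" "\<And>z. z \<in> Z \<Longrightarrow> \<bar>k z - k' z\<bar> \<le> b" for k k' b
  proof -
    have bdm: "bd (\<lambda>z. k z + (-1) * k' z)" by (intro bdadd bdneg that)
    have "E (\<lambda>z. k z + (-1) * k' z) = E k - E k'"
      using Eadd[OF that(1) bdneg[OF that(2), of "-1"]] Esc[OF that(2), of "-1"] by simp
    moreover have "E (\<lambda>z. k z + (-1) * k' z) \<le> b"
      by (rule Ele[OF bdm]) (use that(3) in \<open>force simp: abs_le_iff\<close>)
    moreover have "-b \<le> E (\<lambda>z. k z + (-1) * k' z)"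
      by (rule Ege[OF bdm]) (use that(3) in \<open>force simp: abs_le_iff\<close>)
    ultimately show ?thesis by linarith
  qed
  have Esum: "bd (\<lambda>z. \<Sum>j\<in>J. k j z) \<and> E (\<lambda>z. \<Sum>j\<in>J. k j z) = (\<Sum>j\<in>J. E (k j))"
    if "finite J" "\<And>j. j \<in> J \<Longrightarrow> bd (k j)" for J :: "nat set" and k
    using that
  proof (induction J rule: finite_induct)
    case empty
    have "bd (\<lambda>z. 0)" unfolding bd_def by auto
    moreover then have "E (\<lambda>z. 0) = 0" using Ele[of "\<lambda>z. 0" 0] Ege[of "\<lambda>z. 0" 0] by simp
    ultimately show ?case by simp
  next
    case (insert j J)
    then show ?case by (simp add: bdadd Eadd)
  qed
  \<comment> \<open>The extension \<open>E\<close> is only finitely additive. Rounding the code to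
    multiples of \<open>1 / Suc N\<close> produces finitely many cells, and finite additivity
    suffices to turn their values \<open>pm\<close> into a discrete probability
    distribution.\<close>
  define fl where "fl N z = nat \<lfloor>real (Suc N) * c z\<rfloor>" for N z
  have flle: "fl N z \<le> Suc N" for N z
  proof -
    have "real (Suc N) * c z \<le> real (Suc N)" using c1[of z] mult_left_mono[of "c z" 1 "real (Suc N)"] by simp
    then have "\<lfloor>real (Suc N) * c z\<rfloor> \<le> \<lfloor>real (Suc N)\<rfloor>" by (rule floor_mono)
    then have "\<lfloor>real (Suc N) * c z\<rfloor> \<le> int (Suc N)" by (simp only: floor_of_nat)
    then show ?thesis unfolding fl_def by simp
  qed
  have flc: "\<bar>real (fl N z) / real (Suc N) - c z\<bar> \<le> 1 / real (Suc N)" for N z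
  proof -
    have nn: "0 \<le> real (Suc N) * c z" using c0 by simp
    then have "real (fl N z) = of_int \<lfloor>real (Suc N) * c z\<rfloor>" unfolding fl_def by simp
    then have "\<bar>real (fl N z) - real (Suc N) * c z\<bar> \<le> 1" by linarith
    then have "\<bar>real (fl N z) - real (Suc N) * c z\<bar> / real (Suc N) \<le> 1 / real (Suc N)"
      by (rule divide_right_mono) simp
    moreover have "\<bar>real (fl N z) - real (Suc N) * c z\<bar> / real (Suc N) = \<bar>(real (fl N z) - real (Suc N) * c z) / real (Suc N)\<bar>"
      by simp
    moreover have "(real (fl N z) - real (Suc N) * c z) / real (Suc N) = real (fl N z) / real (Suc N) - c z"
      by (simp add: diff_divide_distrib)
    ultimately show ?thesis by metis
  qed
  define ch where "ch N j z = (if fl N z = j then 1 else 0 :: real)" for N j z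
  have bdch: "bd (ch N j)" for N j unfolding bd_def ch_def by (auto intro: exI[of _ 1])
  define pm where "pm N j = E (ch N j)" for N j
  have pm0: "0 \<le> pm N j" for N j
    unfolding pm_def by (rule Ege[OF bdch]) (simp add: ch_def)
  have psum: "(\<Sum>j\<le>Suc N. pm N j * v j) = E (\<lambda>z. v (fl N z))" for N and v :: "nat \<Rightarrow> real"
  proof -
    have "v (fl N z) = (\<Sum>j\<le>Suc N. v j * ch N j z)" for z
    proof -
      have "(\<Sum>j\<le>Suc N. v j * ch N j z) = (\<Sum>j\<in>{..Suc N}. if fl N z = j then v j else 0)"
        by (intro sum.cong) (auto simp: ch_def)
      also have "\<dots> = v (fl N z)" by (subst sum.delta') (use flle[of N z] in auto)
      finally show ?thesis by simp
    qed
    then have "(\<lambda>z. v (fl N z)) = (\<lambda>z. \<Sum>j\<le>Suc N. v j * ch N j z)" by blast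
    then have "E (\<lambda>z. v (fl N z)) = (\<Sum>j\<le>Suc N. E (\<lambda>z. v j * ch N j z))"
      using Esum[of "{..Suc N}" "\<lambda>j z. v j * ch N j z"] bdneg[OF bdch] by simp
    then show ?thesis using Esc[OF bdch] by (simp add: pm_def mult.commute)
  qed
  have E1: "E (\<lambda>z. 1) = 1" using El[of "const_bcontfun 1"] one by simp
  define PM where "PM N = point_measure {..Suc N} (\<lambda>j. ennreal (pm N j))" for N
  define MM where "MM N = distr (PM N) borel (\<lambda>j. real j / real (Suc N))" for N
  have meas[measurable]: "(\<lambda>j. real j / real (Suc N)) \<in> measurable (PM N) borel" for N
    unfolding PM_def by simp
  have prob: "prob_space (PM N)" for N
  proof
    have "emeasure (PM N) {..Suc N} = (\<Sum>j\<le>Suc N. ennreal (pm N j))"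
      unfolding PM_def by (subst emeasure_point_measure_finite) auto
    also have "\<dots> = ennreal (\<Sum>j\<le>Suc N. pm N j)" using pm0 by (simp add: sum_ennreal del: sum.atMost_Suc)
    also have "\<dots> = 1" using psum[of N "\<lambda>_. 1"] E1 by simp
    finally show "emeasure (PM N) (space (PM N)) = 1" unfolding PM_def by (simp add: space_point_measure)
  qed
  have rd: "real_distribution (MM N)" for N
    unfolding real_distribution_def real_distribution_axioms_def MM_def
    using prob_space.prob_space_distr[OF prob meas] by simp
  have intM: "integral\<^sup>L (MM N) v = E (\<lambda>z. v (real (fl N z) / real (Suc N)))"
    if [measurable]: "v \<in> borel_measurable borel" for N and v :: "real \<Rightarrow> real"
  proof -
    have "integral\<^sup>L (MM N) v = integral\<^sup>L (PM N) (\<lambda>j. v (real j / real (Suc N)))"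
      unfolding MM_def by (rule integral_distr[OF meas that])
    also have "\<dots> = (\<Sum>j\<le>Suc N. pm N j *\<^sub>R v (real j / real (Suc N)))"
      unfolding PM_def by (rule lebesgue_integral_point_measure_finite) (auto simp: pm0)
    also have "\<dots> = E (\<lambda>z. v (real (fl N z) / real (Suc N)))"
      using psum[of N "\<lambda>j. v (real j / real (Suc N))"] by simp
    finally show ?thesis .
  qed
  have tight: "tight MM"
    unfolding tight_def
  proof (intro conjI allI impI rd)
    fix \<epsilon> :: real assume "\<epsilon> > 0"
    have "measure (MM N) {-1<..1} = 1" for N
    proof -
      have "(\<lambda>j. real j / real (Suc N)) -` {-1<..1} \<inter> space (PM N) = space (PM N)"
        unfolding PM_def by (auto simp: space_point_measure field_simps)
      then have "measure (MM N) {-1<..1} = measure (PM N) (space (PM N))"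
        unfolding MM_def by (subst measure_distr[OF meas]) auto
      then show ?thesis using prob_space.prob_space[OF prob] by simp
    qed
    then show "\<exists>a b. a < b \<and> (\<forall>n. 1 - \<epsilon> < measure (MM n) {a<..b})"
      using \<open>\<epsilon> > 0\<close> by (intro exI[of _ "-1"] exI[of _ 1]) auto
  qed
  obtain r M where r: "strict_mono (r :: nat \<Rightarrow> nat)" and M: "real_distribution M"
    and conv: "weak_conv_m (MM \<circ> id \<circ> r) M"
    using tight_imp_convergent_subsubsequence[OF tight strict_mono_id] by blast
  interpret M: real_distribution M by fact
  \<comment> \<open>The integrals against \<open>MM\<close> are evaluated twice: along the
    subsequence by weak convergence, and along the whole sequence by uniform continuity of
    \<open>v\<close> on \<open>{0..1}\<close>, since rounding moves the code by at most
    \<open>1 / Suc N\<close>.\<close>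
  have intL: "integral\<^sup>L M v = E (\<lambda>z. v (c z))"
    if vc: "continuous_on UNIV v" and vB: "\<And>x. \<bar>v x\<bar> \<le> B" for v :: "real \<Rightarrow> real" and B
  proof -
    have vm: "v \<in> borel_measurable borel" using vc by (rule borel_measurable_continuous_onI)
    have l1: "(\<lambda>n. integral\<^sup>L ((MM \<circ> id \<circ> r) n) v) \<longlonglongrightarrow> integral\<^sup>L M v"
      by (rule weak_conv_imp_integral_bdd_continuous_conv[OF _ M conv])
         (use rd vc vB in \<open>auto simp: continuous_on_eq_continuous_at\<close>)
    have "(\<lambda>N. integral\<^sup>L (MM N) v) \<longlonglongrightarrow> E (\<lambda>z. v (c z))"
    proof (rule LIMSEQ_I)
      fix e :: real assume "e > 0"
      have "uniformly_continuous_on {0..1} v"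
        using vc by (intro compact_uniformly_continuous) (auto intro: continuous_on_subset)
      then obtain \<delta> where "\<delta> > 0" and \<delta>: "\<And>x y. x \<in> {0..1} \<Longrightarrow> y \<in> {0..1} \<Longrightarrow> \<bar>x - y\<bar> < \<delta> \<Longrightarrow> \<bar>v x - v y\<bar> < e/2"
        unfolding uniformly_continuous_on_def dist_real_def using \<open>e > 0\<close> by (meson half_gt_zero)
      obtain N0 where N0: "1 / real (Suc N0) < \<delta>" using \<open>\<delta> > 0\<close> nat_approx_posE by blast
      have "\<bar>integral\<^sup>L (MM N) v - E (\<lambda>z. v (c z))\<bar> < e" if "N \<ge> N0" for N
      proof -
        have "1 / real (Suc N) \<le> 1 / real (Suc N0)" using that by (simp add: field_simps)
        then have lt: "1 / real (Suc N) < \<delta>" using N0 by linarith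
        have "\<bar>E (\<lambda>z. v (real (fl N z) / real (Suc N))) - E (\<lambda>z. v (c z))\<bar> \<le> e/2"
        proof (rule Eabs)
          show "bd (\<lambda>z. v (real (fl N z) / real (Suc N)))" "bd (\<lambda>z. v (c z))"
            unfolding bd_def using vB by auto
          fix z
          have "real (fl N z) / real (Suc N) \<in> {0..1}" using flle[of N z] by (simp add: field_simps)
          moreover have "c z \<in> {0..1}" using c0 c1 by simp
          ultimately have "\<bar>v (real (fl N z) / real (Suc N)) - v (c z)\<bar> < e/2"
            by (rule \<delta>) (use flc[of N z] lt in linarith)
          then show "\<bar>v (real (fl N z) / real (Suc N)) - v (c z)\<bar> \<le> e/2" by simp
        qed
        then show ?thesis using intM[OF vm] \<open>e > 0\<close> by simp
      qed
      then show "\<exists>no. \<forall>n\<ge>no. norm (integral\<^sup>L (MM n) v - E (\<lambda>z. v (c z))) < e" by auto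
    qed
    then have "((\<lambda>N. integral\<^sup>L (MM N) v) \<circ> r) \<longlonglongrightarrow> E (\<lambda>z. v (c z))"
      using r by (rule LIMSEQ_subseq_LIMSEQ)
    then have "(\<lambda>n. integral\<^sup>L ((MM \<circ> id \<circ> r) n) v) \<longlonglongrightarrow> E (\<lambda>z. v (c z))"
      by (simp add: o_def)
    then show ?thesis using l1 LIMSEQ_unique by blast
  qed
  \<comment> \<open>Because \<open>d\<close> is continuous, a bounded continuous function composed
    with it is again one, which is what weak convergence can test.\<close>
  define \<pi> where "\<pi> = distr M borel d"
  have dm[measurable]: "d \<in> borel_measurable M"
    using borel_measurable_continuous_onI[OF dcont] by simp
  have int\<pi>: "integral\<^sup>L \<pi> (apply_bcontfun h) = l h" for h
  proof -
    have "continuous_on UNIV (\<lambda>x. apply_bcontfun h (d x))"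
      using continuous_on_compose2[OF continuous_on_apply_bcontfun dcont, of UNIV h] by simp
    moreover have "\<bar>apply_bcontfun h (d x)\<bar> \<le> norm h" for x using norm_bounded[of h "d x"] by simp
    ultimately have "integral\<^sup>L M (\<lambda>x. apply_bcontfun h (d x)) = E (\<lambda>z. apply_bcontfun h (d (c z)))"
      by (rule intL)
    moreover have "integral\<^sup>L \<pi> (apply_bcontfun h) = integral\<^sup>L M (\<lambda>x. apply_bcontfun h (d x))"
      unfolding \<pi>_def
      by (rule integral_distr[OF dm]) (intro borel_measurable_continuous_onI continuous_on_apply_bcontfun)
    \<comment> \<open>\<open>E\<close> sees only the values on \<open>Z\<close>, where
      \<open>d\<close> inverts the code.\<close>
    moreover have "\<bar>E (\<lambda>z. apply_bcontfun h (d (c z))) - E (apply_bcontfun h)\<bar> \<le> 0"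
    proof (rule Eabs)
      show "bd (\<lambda>z. apply_bcontfun h (d (c z)))"
        unfolding bd_def using norm_bounded[of h] by (auto intro: exI[of _ "norm h"])
    qed (use dc hB in auto)
    ultimately show ?thesis using El by simp
  qed
  have prob\<pi>: "prob_space \<pi>" unfolding \<pi>_def by (rule M.prob_space_distr[OF dm])
  interpret \<pi>: prob_space \<pi> by fact
  have sets\<pi>: "sets \<pi> = sets borel" unfolding \<pi>_def by simp
  have "AE z in \<pi>. z \<in> Z"
  proof -
    \<comment> \<open>A bounded continuous function with zero set \<open>Z\<close>. Both it and its
      negative are nonnegative on \<open>Z\<close>, so positivity forces its integral to be
      0.\<close>
    define u where "u z = min 1 (infdist z Z)" for z
    have ucont: "continuous_on UNIV u" unfolding u_def by (intro continuous_intros)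
    have u0: "0 \<le> u z" for z unfolding u_def by (simp add: infdist_nonneg)
    have u1: "u z \<le> 1" for z unfolding u_def by simp
    define h where "h = Bcontfun u"
    have h: "apply_bcontfun h = u" unfolding h_def
      by (rule Bcontfun_inverse) (use ucont u0 u1 in \<open>auto intro!: bcontfun_normI[of _ 1]\<close>)
    have hZ: "apply_bcontfun h z = 0" if "z \<in> Z" for z unfolding h u_def using that by simp
    have "0 \<le> l h" by (rule pos) (simp add: hZ)
    moreover have "0 \<le> l (- h)" by (rule pos) (simp add: hZ)
    ultimately have "integral\<^sup>L \<pi> u = 0" using int\<pi>[of h] by (simp add: h lneg)
    moreover have um: "u \<in> borel_measurable \<pi>"
      using borel_measurable_continuous_onI[OF ucont] measurable_cong_sets[OF sets\<pi> refl] by blast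
    moreover then have "integrable \<pi> u"
      by (intro \<pi>.integrable_const_bound[of _ 1]) (use u0 u1 in auto)
    ultimately have "AE z in \<pi>. u z = 0"
      using integral_nonneg_eq_0_iff_AE[of \<pi> u] u0 by auto
    then show ?thesis
    proof eventually_elim
      case (elim z)
      then have "infdist z Z = 0" unfolding u_def by (auto simp: min_def split: if_splits)
      then show ?case using in_closed_iff_infdist_zero[OF compact_imp_closed[OF Z(1)] Z(2)] by simp
    qed
  qed
  with prob\<pi> sets\<pi> int\<pi> that show thesis by blast
qed

section \<open>Lebesgue points for finite Borel measures\<close>

text \<open>Take a centre of largest radius, discard the points in its ball and repeat. Later
  centres lie outside the earlier balls and have smaller radii, so any two selected centres are at
  least as far apart as the larger of their radii.\<close>

lemma greedy_ball_selection:
  fixes r :: "'a::metric_space \<Rightarrow> real"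
  assumes "finite F"
  shows "\<exists>G\<subseteq>F. (\<forall>x\<in>F. (\<exists>y\<in>G. dist x y < r y) \<or> r x \<le> 0) \<and> (\<forall>x\<in>G. \<forall>y\<in>G. x \<noteq> y \<longrightarrow> r x \<le> dist x y)"
  using assms
proof (induction F rule: finite_psubset_induct)
  case (psubset F)
  show ?case
  proof (cases "\<exists>x\<in>F. r x > 0")
    case False
    then show ?thesis by (intro exI[of _ "{}"]) force
  next
    case True
    then have ne: "F \<noteq> {}" by auto
    have "Max (r ` F) \<in> r ` F" using ne psubset(1) by simp
    then obtain y where y: "y \<in> F" "r y = Max (r ` F)" by force
    have ymax: "r x \<le> r y" if "x \<in> F" for x unfolding y(2) using that psubset(1) by simp
    have ypos: "r y > 0" using True ymax by force
    define F' where "F' = {x \<in> F. \<not> dist x y < r y}"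
    have "y \<notin> F'" using ypos unfolding F'_def by simp
    then have "F' \<subset> F" using y(1) unfolding F'_def by blast
    from psubset(2)[OF this] obtain G where G: "G \<subseteq> F'" "\<forall>x\<in>F'. (\<exists>y\<in>G. dist x y < r y) \<or> r x \<le> 0"
      "\<forall>x\<in>G. \<forall>y\<in>G. x \<noteq> y \<longrightarrow> r x \<le> dist x y"
      by auto
    have far: "r y \<le> dist x y" "r x \<le> r y" if "x \<in> G" for x
      using G(1) that ymax unfolding F'_def by auto
    have "\<forall>x\<in>insert y G. \<forall>z\<in>insert y G. x \<noteq> z \<longrightarrow> r x \<le> dist x z"
      using G(3) far by (auto simp: dist_commute) (meson order_trans)
    moreover have "\<forall>x\<in>F. (\<exists>y\<in>insert y G. dist x y < r y) \<or> r x \<le> 0"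
      using G(2) unfolding F'_def by auto
    moreover have "insert y G \<subseteq> F" using G(1) y(1) unfolding F'_def by auto
    ultimately show ?thesis by blast
  qed
qed

text \<open>In a triangle whose third side is strictly the longest, the angle opposite to it exceeds
  60 degrees, and unit vectors at such an angle are more than 1 apart.\<close>

lemma separated_directions:
  fixes u v :: "'a::real_inner"
  assumes "u \<noteq> 0" "v \<noteq> 0" "norm u < norm (u - v)" "norm v < norm (u - v)"
  shows "1 < norm (u /\<^sub>R norm u - v /\<^sub>R norm v)"
proof -
  define a b where "a = norm u" and "b = norm v"
  have ab: "a > 0" "b > 0" using assms by (auto simp: a_def b_def)
  have exp: "(norm (u - v))\<^sup>2 = a\<^sup>2 + b\<^sup>2 - 2 * inner u v"
    unfolding a_def b_def by (simp add: power2_norm_eq_inner inner_diff inner_commute)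
  have "a\<^sup>2 < (norm (u - v))\<^sup>2" "b\<^sup>2 < (norm (u - v))\<^sup>2"
    using assms unfolding a_def b_def by (auto intro!: power_strict_mono)
  then have ip: "2 * inner u v < b\<^sup>2" "2 * inner u v < a\<^sup>2" using exp by linarith+
  have "2 * inner u v < a * b"
  proof (cases "a \<le> b")
    case True
    then have "a\<^sup>2 \<le> a * b" using ab by (simp add: power2_eq_square)
    then show ?thesis using ip by linarith
  next
    case False
    then have "b\<^sup>2 \<le> a * b" using ab by (simp add: power2_eq_square)
    then show ?thesis using ip by linarith
  qed
  then have lt: "2 * inner u v / (a * b) < 1" using ab by (simp add: field_simps)
  have "(norm (u /\<^sub>R a - v /\<^sub>R b))\<^sup>2 = inner u u / a\<^sup>2 + inner v v / b\<^sup>2 - 2 * (inner u v / (a * b))"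
    using ab by (simp only: power2_norm_eq_inner) (simp add: inner_diff inner_commute power2_eq_square field_simps)
  also have "inner u u / a\<^sup>2 = 1" using ab by (simp add: a_def power2_norm_eq_inner flip: power2_norm_eq_inner)
  also have "inner v v / b\<^sup>2 = 1" using ab by (simp add: b_def power2_norm_eq_inner flip: power2_norm_eq_inner)
  finally have "1 < (norm (u /\<^sub>R a - v /\<^sub>R b))\<^sup>2" using lt by simp
  then have "1\<^sup>2 < (norm (u /\<^sub>R a - v /\<^sub>R b))\<^sup>2" by simp
  then show ?thesis unfolding a_def b_def by (rule power_less_imp_less_base) simp
qed

text \<open>Seen from a common point \<open>z\<close> of the balls, the directions to the centres
  are more than 1 apart, so balls of radius 1/2 covering the unit sphere each hold at most one. If
  \<open>z\<close> is itself one of these centres, it is the only one; hence the maximum with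
  1.\<close>

lemma bounded_overlap:
  "\<exists>N::nat. \<forall>(G::'a::euclidean_space set) r z. finite G \<longrightarrow> (\<forall>x\<in>G. \<forall>y\<in>G. x \<noteq> y \<longrightarrow> r x \<le> dist x y)
     \<longrightarrow> card {y\<in>G. dist y z < r y} \<le> N"
proof -
  obtain k where k: "finite k" "sphere (0::'a) 1 \<subseteq> (\<Union>x\<in>k. ball x (1/2))"
    using compact_sphere[of "0::'a" 1] unfolding compact_eq_totally_bounded
    by (metis half_gt_zero zero_less_one)
  have "card {y\<in>G. dist y z < r y} \<le> max 1 (card k)"
    if G: "finite G" "\<forall>x\<in>G. \<forall>y\<in>G. x \<noteq> y \<longrightarrow> r x \<le> dist x y" for G :: "'a set" and r z
  proof -
    define H where "H = {y\<in>G. dist y z < r y}"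
    show ?thesis
    proof (cases "z \<in> H")
      case True
      have "H \<subseteq> {z}"
      proof
        fix y assume "y \<in> H"
        then show "y \<in> {z}" using G(2) True unfolding H_def by force
      qed
      then have "card H \<le> card {z}" by (intro card_mono) auto
      then show ?thesis unfolding H_def by simp
    next
      case False
      define u where "u y = (y - z) /\<^sub>R norm (y - z)" for y
      have "\<exists>x\<in>k. u y \<in> ball x (1/2)" if "y \<in> H" for y
      proof -
        have "y \<noteq> z" using that False by auto
        then have "u y \<in> sphere 0 1" by (simp add: u_def)
        then show ?thesis using k(2) by blast
      qed
      then obtain c where c: "\<And>y. y \<in> H \<Longrightarrow> c y \<in> k" "\<And>y. y \<in> H \<Longrightarrow> u y \<in> ball (c y) (1/2)" by metis
      have "inj_on c H"
      proof (rule inj_onI, rule ccontr)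
        fix y y' assume yy: "y \<in> H" "y' \<in> H" "c y = c y'" "y \<noteq> y'"
        have "y \<noteq> z" "y' \<noteq> z" using yy False by auto
        moreover have "dist y z < dist y y'" using yy G(2) unfolding H_def by force
        moreover have "dist y' z < dist y y'" using yy G(2) unfolding H_def
          by (metis (mono_tags, lifting) dist_commute mem_Collect_eq order_less_le_trans)
        ultimately have "1 < dist (u y) (u y')"
          unfolding u_def dist_norm using separated_directions[of "y - z" "y' - z"] by simp
        moreover have "dist (u y) (u y') < 1"
          using c(2)[OF yy(1)] c(2)[OF yy(2)] yy(3) dist_triangle_half_r[of "c y" "u y" 1 "u y'"] by simp
        ultimately show False by simp
      qed
      then have "card H \<le> card k" using c(1) k(1) by (intro card_inj_on_le[of c]) auto
      then show ?thesis unfolding H_def by simp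
    qed
  qed
  then show ?thesis by blast
qed

text \<open>Continuity from below along open balls. The slack \<open>s\<close> is what later allows
  the centre to move and the radius to grow.\<close>

lemma measure_ball_shrink:
  fixes \<sigma> :: "'a::metric_space measure"
  assumes \<sigma>: "finite_measure \<sigma>" "sets \<sigma> = sets borel" and r: "r > 0" and c: "c < measure \<sigma> (ball x r)"
  shows "\<exists>s>0. s < r \<and> c < measure \<sigma> (ball x (r - s))"
proof -
  interpret finite_measure \<sigma> by fact
  have [measurable]: "ball x r \<in> sets \<sigma>" for x r using \<sigma>(2) by simp
  have "(\<lambda>n. measure \<sigma> (ball x (r - r / real (n + 2)))) \<longlonglongrightarrow> measure \<sigma> (\<Union>n. ball x (r - r / real (n + 2)))"
  proof (rule finite_Lim_measure_incseq)
    show "incseq (\<lambda>n. ball x (r - r / real (n + 2)))"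
      using r by (intro incseq_SucI subset_ball) (auto intro!: divide_left_mono)
  qed auto
  moreover have "(\<Union>n. ball x (r - r / real (n + 2))) = ball x r"
  proof
    show "(\<Union>n. ball x (r - r / real (n + 2))) \<subseteq> ball x r"
    proof
      fix y assume "y \<in> (\<Union>n. ball x (r - r / real (n + 2)))"
      then obtain n where "dist x y < r - r / real (n + 2)" by auto
      moreover have "r / real (n + 2) > 0" using r by simp
      ultimately show "y \<in> ball x r" unfolding mem_ball by linarith
    qed
    show "ball x r \<subseteq> (\<Union>n. ball x (r - r / real (n + 2)))"
    proof
      fix y assume y: "y \<in> ball x r"
      then obtain n where n: "inverse (real (Suc n)) < (r - dist x y) / r"
        using reals_Archimedean[of "(r - dist x y) / r"] r by auto
      have "inverse (real (n + 2)) \<le> inverse (real (Suc n))" by (simp add: field_simps)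
      then have "inverse (real (n + 2)) < (r - dist x y) / r" using n by linarith
      then have "r * inverse (real (n + 2)) < r - dist x y" using r by (simp add: pos_less_divide_eq mult.commute)
      then have "dist x y < r - r / real (n + 2)" unfolding divide_inverse by linarith
      then show "y \<in> (\<Union>n. ball x (r - r / real (n + 2)))" by auto
    qed
  qed
  ultimately have "\<forall>\<^sub>F n in sequentially. c < measure \<sigma> (ball x (r - r / real (n + 2)))"
    using c by (simp add: order_tendstoD(1))
  then obtain n where "c < measure \<sigma> (ball x (r - r / real (n + 2)))"
    by (auto simp: eventually_sequentially)
  moreover have "r / real (n + 2) < r" using r by (simp add: pos_divide_less_eq)
  moreover have "r / real (n + 2) > 0" using r by simp
  ultimately show ?thesis by blast
qed

text \<open>The slack in the radius absorbs a small displacement of the centre. Openness makes the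
  set measurable and accessible from inside by compact sets.\<close>

lemma open_maximal_set:
  fixes lam \<sigma> :: "'a::metric_space measure"
  assumes lam: "finite_measure lam" "sets lam = sets borel"
    and \<sigma>: "finite_measure \<sigma>" "sets \<sigma> = sets borel" and t: "0 \<le> t"
  shows "open {x. \<exists>r>0. t * measure lam (ball x r) < measure \<sigma> (ball x r)}"
  unfolding open_dist
proof
  interpret lam: finite_measure lam by fact
  interpret \<sigma>: finite_measure \<sigma> by fact
  fix x assume "x \<in> {x. \<exists>r>0. t * measure lam (ball x r) < measure \<sigma> (ball x r)}"
  then obtain r where r: "r > 0" "t * measure lam (ball x r) < measure \<sigma> (ball x r)" by blast
  then obtain s where s: "s > 0" "s < r" "t * measure lam (ball x r) < measure \<sigma> (ball x (r - s))"
    using measure_ball_shrink[OF \<sigma>] by blast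
  have "\<exists>r>0. t * measure lam (ball y r) < measure \<sigma> (ball y r)" if "dist y x < s/2" for y
  proof (intro exI conjI)
    show "r - s / 2 > 0" using s by simp
    have "ball y (r - s/2) \<subseteq> ball x r"
    proof
      fix z assume "z \<in> ball y (r - s/2)"
      then show "z \<in> ball x r" using that s dist_triangle[of x z y] by (simp add: dist_commute)
    qed
    then have "measure lam (ball y (r - s/2)) \<le> measure lam (ball x r)"
      by (rule lam.finite_measure_mono) (simp add: lam)
    then have "t * measure lam (ball y (r - s/2)) \<le> t * measure lam (ball x r)"
      using t by (rule mult_left_mono)
    also have "\<dots> < measure \<sigma> (ball x (r - s))" by fact
    also have "\<dots> \<le> measure \<sigma> (ball y (r - s/2))"
    proof (rule \<sigma>.finite_measure_mono)
      show "ball x (r - s) \<subseteq> ball y (r - s/2)"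
      proof
        fix z assume "z \<in> ball x (r - s)"
        then show "z \<in> ball y (r - s/2)" using that dist_triangle[of y z x] by simp
      qed
    qed (simp add: \<sigma>)
    finally show "t * measure lam (ball y (r - s/2)) < measure \<sigma> (ball y (r - s/2))" .
  qed
  then show "\<exists>e>0. \<forall>y. dist y x < e \<longrightarrow> y \<in> {x. \<exists>r>0. t * measure lam (ball x r) < measure \<sigma> (ball x r)}"
    using s(1) by (intro exI[of _ "s/2"]) simp
qed

text \<open>Enlarging the radii by a uniform amount reduces the Besicovitch covering argument to finite families.\<close>

lemma weak_type_maximal:
  "\<exists>N::nat. \<forall>(lam::'a::euclidean_space measure) \<sigma> t. finite_measure lam \<longrightarrow> sets lam = sets borel \<longrightarrow>
     finite_measure \<sigma> \<longrightarrow> sets \<sigma> = sets borel \<longrightarrow> 0 < t \<longrightarrow>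
     t * measure lam {x. \<exists>r>0. t * measure lam (ball x r) < measure \<sigma> (ball x r)} \<le> N * measure \<sigma> UNIV"
proof -
  obtain N where N: "\<And>(G::'a set) r z. finite G \<Longrightarrow> (\<And>x y. x\<in>G \<Longrightarrow> y\<in>G \<Longrightarrow> x \<noteq> y \<Longrightarrow> r x \<le> dist x y)
     \<Longrightarrow> card {y\<in>G. dist y z < r y} \<le> N"
    using bounded_overlap[where 'a = 'a] by meson
  have "t * measure lam {x. \<exists>r>0. t * measure lam (ball x r) < measure \<sigma> (ball x r)} \<le> N * measure \<sigma> UNIV"
    if lam: "finite_measure lam" "sets lam = sets borel"
      and \<sigma>: "finite_measure \<sigma>" "sets \<sigma> = sets borel" and t: "0 < t"
    for lam \<sigma> :: "'a measure" and t
  proof -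
    interpret lam: finite_measure lam by fact
    interpret \<sigma>: finite_measure \<sigma> by fact
    have sp: "space \<sigma> = UNIV" using sets_eq_imp_space_eq[OF \<sigma>(2)] by simp
    define A where "A = {x. \<exists>r>0. t * measure lam (ball x r) < measure \<sigma> (ball x r)}"
    have A: "open A" unfolding A_def using open_maximal_set[OF lam \<sigma>] t by simp
    have cpt: "t * measure lam C \<le> N * measure \<sigma> UNIV" if C: "compact C" "C \<subseteq> A" for C
    proof -
      have "\<exists>r s. r > 0 \<and> s > 0 \<and> t * measure lam (ball x (r + s)) < measure \<sigma> (ball x r)" if xC: "x \<in> C" for x
      proof -
        obtain r where "r > 0" "t * measure lam (ball x r) < measure \<sigma> (ball x r)"
          using xC C(2) unfolding A_def by blast
        then obtain s where "s > 0" "s < r" "t * measure lam (ball x r) < measure \<sigma> (ball x (r - s))"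
          using measure_ball_shrink[OF \<sigma>] by blast
        then show ?thesis by (intro exI[of _ "r - s"] exI[of _ s]) simp
      qed
      then obtain r s where rs: "\<And>x. x \<in> C \<Longrightarrow> r x > 0" "\<And>x. x \<in> C \<Longrightarrow> s x > 0"
        "\<And>x. x \<in> C \<Longrightarrow> t * measure lam (ball x (r x + s x)) < measure \<sigma> (ball x (r x))" by metis
      have cov: "C \<subseteq> (\<Union>x\<in>C. ball x (s x / 4))" using rs(2) by force
      obtain J where J: "J \<subseteq> C" "finite J" "C \<subseteq> (\<Union>x\<in>J. ball x (s x / 4))"
        by (rule compactE_image[OF C(1) _ cov]) auto
      \<comment> \<open>The margins of a finite subcover provide one margin for all of
        \<open>C\<close>; \<open>insert 1\<close> keeps \<open>Min\<close> meaningful when the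
        subcover is empty.\<close>
      define s0 where "s0 = Min (insert 1 ((\<lambda>x. s x / 4) ` J))"
      have s0: "s0 > 0" unfolding s0_def using J(1,2) rs(2) by auto
      have s0J: "s0 \<le> s x / 4" if "x \<in> J" for x unfolding s0_def by (rule Min_le) (use J(2) that in auto)
      have "\<exists>\<rho>>0. t * measure lam (ball y (\<rho> + s0)) < measure \<sigma> (ball y \<rho>)" if yC: "y \<in> C" for y
      proof -
        obtain x where x: "x \<in> J" "dist x y < s x / 4" using J(3) yC by auto
        then have xC: "x \<in> C" using J(1) by auto
        have "ball y (r x + s x / 4 + s0) \<subseteq> ball x (r x + s x)"
        proof
          fix z assume "z \<in> ball y (r x + s x / 4 + s0)"
          then show "z \<in> ball x (r x + s x)" using x(2) s0J[OF x(1)] rs(2)[OF xC] dist_triangle[of x z y] by simp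
        qed
        then have "measure lam (ball y (r x + s x / 4 + s0)) \<le> measure lam (ball x (r x + s x))"
          by (rule lam.finite_measure_mono) (simp add: lam)
        then have "t * measure lam (ball y (r x + s x / 4 + s0)) \<le> t * measure lam (ball x (r x + s x))"
          using t by simp
        also have "\<dots> < measure \<sigma> (ball x (r x))" using rs(3) xC .
        also have "\<dots> \<le> measure \<sigma> (ball y (r x + s x / 4))"
        proof (rule \<sigma>.finite_measure_mono)
          show "ball x (r x) \<subseteq> ball y (r x + s x / 4)"
          proof
            fix z assume "z \<in> ball x (r x)"
            then show "z \<in> ball y (r x + s x / 4)" using x(2) dist_triangle[of y z x] by (simp add: dist_commute)
          qed
        qed (simp add: \<sigma>)
        finally show ?thesis using rs(1,2)[OF xC] by (intro exI[of _ "r x + s x / 4"]) auto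
      qed
      then obtain \<rho> where \<rho>: "\<And>y. y \<in> C \<Longrightarrow> \<rho> y > 0"
        "\<And>y. y \<in> C \<Longrightarrow> t * measure lam (ball y (\<rho> y + s0)) < measure \<sigma> (ball y (\<rho> y))" by metis
      have cov2: "C \<subseteq> (\<Union>x\<in>C. ball x s0)" using s0 by force
      obtain F where F: "F \<subseteq> C" "finite F" "C \<subseteq> (\<Union>x\<in>F. ball x s0)"
        by (rule compactE_image[OF C(1) _ cov2]) auto
      \<comment> \<open>Each point of the net \<open>F\<close> lies in a selected ball, and each
        point of \<open>C\<close> is within \<open>s0\<close> of \<open>F\<close>. So the selected
        balls enlarged by \<open>s0\<close> cover \<open>C\<close>, and the margin built into
        \<open>\<rho>\<close> pays for the enlargement.\<close>
      obtain G where G: "G \<subseteq> F" "\<And>x. x \<in> F \<Longrightarrow> (\<exists>y\<in>G. dist x y < \<rho> y) \<or> \<rho> x \<le> 0"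
        "\<And>x y. x \<in> G \<Longrightarrow> y \<in> G \<Longrightarrow> x \<noteq> y \<Longrightarrow> \<rho> x \<le> dist x y"
        using greedy_ball_selection[OF F(2), of \<rho>] by blast
      have finG: "finite G" using G(1) F(2) by (rule finite_subset)
      have "C \<subseteq> (\<Union>y\<in>G. ball y (\<rho> y + s0))"
      proof
        fix z assume "z \<in> C"
        then obtain x where x: "x \<in> F" "dist x z < s0" using F(3) by auto
        then obtain y where y: "y \<in> G" "dist x y < \<rho> y" using G(2)[OF x(1)] \<rho>(1)[of x] F(1) by force
        then have "dist y z < \<rho> y + s0" using x(2) dist_triangle[of y z x] by (simp add: dist_commute)
        then show "z \<in> (\<Union>y\<in>G. ball y (\<rho> y + s0))" using y(1) by auto
      qed
      then have "measure lam C \<le> measure lam (\<Union>y\<in>G. ball y (\<rho> y + s0))"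
        using finG by (intro lam.finite_measure_mono) (auto simp: lam)
      also have "\<dots> \<le> (\<Sum>y\<in>G. measure lam (ball y (\<rho> y + s0)))"
        using finG by (intro measure_UNION_le) (auto simp: lam)
      finally have "t * measure lam C \<le> (\<Sum>y\<in>G. t * measure lam (ball y (\<rho> y + s0)))"
        using t by (simp add: sum_distrib_left[symmetric])
      also have "\<dots> \<le> (\<Sum>y\<in>G. measure \<sigma> (ball y (\<rho> y)))"
        using \<rho>(2) G(1) F(1) by (intro sum_mono less_imp_le) auto
      \<comment> \<open>The sum of the measures is the integral of the number of selected balls
        through a point, which is at most \<open>N\<close>.\<close>
      also have "\<dots> = (\<Sum>y\<in>G. \<integral>z. indicator (ball y (\<rho> y)) z \<partial>\<sigma>)"
        by (intro sum.cong refl) (simp add: sp)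
      also have "\<dots> = (\<integral>z. (\<Sum>y\<in>G. indicator (ball y (\<rho> y)) z) \<partial>\<sigma>)"
        by (rule Bochner_Integration.integral_sum[symmetric]) (simp add: \<sigma> integrable_indicator_iff \<sigma>.emeasure_finite less_top[symmetric])
      also have "\<dots> \<le> (\<integral>z. real N \<partial>\<sigma>)"
      proof (rule integral_mono)
        show "integrable \<sigma> (\<lambda>z. \<Sum>y\<in>G. indicator (ball y (\<rho> y)) z :: real)"
          by (intro Bochner_Integration.integrable_sum) (simp add: \<sigma> integrable_indicator_iff \<sigma>.emeasure_finite less_top[symmetric])
        fix z
        have "(\<Sum>y\<in>G. indicator (ball y (\<rho> y)) z :: real) = card {y\<in>G. dist y z < \<rho> y}"
          using finG by (simp add: indicator_def sum.If_cases Int_def)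
        also have "\<dots> \<le> N" using N[OF finG G(3)] by simp
        finally show "(\<Sum>y\<in>G. indicator (ball y (\<rho> y)) z) \<le> real N" .
      qed simp
      also have "\<dots> = N * measure \<sigma> UNIV" by (simp add: sp)
      finally show ?thesis .
    qed
    have "measure lam A \<le> N * measure \<sigma> UNIV / t"
    proof (rule ccontr)
      assume "\<not> ?thesis"
      then have lt: "ennreal (N * measure \<sigma> UNIV / t) < emeasure lam A"
        using t by (simp add: lam.emeasure_eq_measure ennreal_less_iff)
      have "emeasure lam A = (SUP K \<in> {K. K \<subseteq> A \<and> compact K}. emeasure lam K)"
        by (rule inner_regular) (use A lam lam.emeasure_finite in auto)
      then obtain C where C: "C \<subseteq> A" "compact C" "ennreal (N * measure \<sigma> UNIV / t) < emeasure lam C"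
        using lt by (auto simp: less_SUP_iff)
      then have "N * measure \<sigma> UNIV / t < measure lam C"
        using t by (simp add: lam.emeasure_eq_measure ennreal_less_iff)
      then show False using cpt[OF C(2,1)] t by (simp add: field_simps)
    qed
    then show ?thesis using t unfolding A_def by (simp add: field_simps)
  qed
  then show ?thesis by blast
qed

section \<open>Regularity of finite Borel measures and differentiation\<close>

lemma inner_compact_approx:
  fixes M :: "'a::euclidean_space measure"
  assumes M: "finite_measure M" "sets M = sets borel" and E: "E \<in> sets borel" and e: "(e::real) > 0"
  shows "\<exists>C. compact C \<and> C \<subseteq> E \<and> measure M (E - C) < e"
proof -
  interpret finite_measure M by fact
  have "\<exists>C. C \<subseteq> E \<and> compact C \<and> measure M E - e < measure M C"
  \<comment> \<open>A null set is treated apart because \<open>ennreal\<close> truncates a negative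
    number to 0, so no strict inequality would be left to pass to the supremum.\<close>
  proof (cases "measure M E = 0")
    case True
    then show ?thesis using e by (intro exI[of _ "{}"]) simp
  next
    case False
    then have "ennreal (measure M E - e) < ennreal (measure M E)"
      using e by (intro ennreal_lessI) (auto simp: zero_less_measure_iff)
    then have "ennreal (measure M E - e) < (SUP K \<in> {K. K \<subseteq> E \<and> compact K}. emeasure M K)"
      using inner_regular[OF M(2) _ E] emeasure_finite by (simp add: emeasure_eq_measure)
    then obtain C where C: "C \<subseteq> E" "compact C" "ennreal (measure M E - e) < ennreal (measure M C)"
      by (auto simp: less_SUP_iff emeasure_eq_measure)
    have "measure M E - e < measure M C"
    proof (rule ccontr)
      assume "\<not> ?thesis"
      then show False using C(3) ennreal_leI[of "measure M C" "measure M E - e"] by simp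
    qed
    then show ?thesis using C by blast
  qed
  then obtain C where C: "C \<subseteq> E" "compact C" "measure M E - e < measure M C" by blast
  have "measure M (E - C) = measure M E - measure M C"
    by (rule finite_measure_Diff) (use C E M(2) in \<open>auto simp: compact_imp_closed borel_closed\<close>)
  then show ?thesis using C by (intro exI[of _ C]) auto
qed

lemma outer_open_approx:
  fixes M :: "'a::euclidean_space measure"
  assumes M: "finite_measure M" "sets M = sets borel" and E: "E \<in> sets borel" and e: "(e::real) > 0"
  shows "\<exists>U. open U \<and> E \<subseteq> U \<and> measure M (U - E) < e"
proof -
  obtain C where C: "compact C" "C \<subseteq> -E" "measure M (-E - C) < e"
    using inner_compact_approx[OF M _ e, of "-E"] E by auto
  have "-C - E = -E - C" by auto
  then show ?thesis using C by (intro exI[of _ "-C"]) (auto simp: compact_imp_closed)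
qed

text \<open>All but a little of \<sigma> lives on a compact set \<open>C\<close> disjoint from
  \<open>E\<close>. Small balls around a point of \<open>E\<close> miss \<open>C\<close>, so a bad
  point lies in the maximal set of the small rest, whose \<open>lam\<close>-measure the weak-type
  bound makes arbitrarily small.\<close>

lemma density_zero_off_support:
  fixes lam \<sigma> :: "'a::euclidean_space measure"
  assumes lam: "finite_measure lam" "sets lam = sets borel"
    and \<sigma>: "finite_measure \<sigma>" "sets \<sigma> = sets borel"
    and E: "E \<in> sets borel" "measure \<sigma> E = 0" and t: "t > 0"
  shows "AE x in lam. x \<in> E \<longrightarrow> (\<forall>\<^sub>F r in at_right 0. measure \<sigma> (ball x r) \<le> t * measure lam (ball x r))"
proof -
  interpret lam: finite_measure lam by fact
  interpret \<sigma>: finite_measure \<sigma> by fact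
  have sp: "space \<sigma> = UNIV" "space lam = UNIV" using sets_eq_imp_space_eq[OF \<sigma>(2)] sets_eq_imp_space_eq[OF lam(2)] by simp_all
  from weak_type_maximal obtain N :: nat where
    N: "\<forall>(lam::'a::euclidean_space measure) \<sigma> t. finite_measure lam \<longrightarrow> sets lam = sets borel \<longrightarrow>
     finite_measure \<sigma> \<longrightarrow> sets \<sigma> = sets borel \<longrightarrow> 0 < t \<longrightarrow>
     t * measure lam {x. \<exists>r>0. t * measure lam (ball x r) < measure \<sigma> (ball x r)} \<le> N * measure \<sigma> UNIV" ..
  define Bad where "Bad = {x \<in> E. \<not> (\<forall>\<^sub>F r in at_right 0. measure \<sigma> (ball x r) \<le> t * measure lam (ball x r))}"
  have small: "\<exists>A. open A \<and> Bad \<subseteq> A \<and> measure lam A < e" if e: "e > 0" for e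
  proof -
    \<comment> \<open>Chosen so that the weak-type bound, with constant \<open>N\<close>, yields
      measure below \<open>e\<close>; the \<open>+ 1\<close> allows \<open>N = 0\<close>.\<close>
    define \<eta> where "\<eta> = t * e / (N + 1)"
    have \<eta>: "\<eta> > 0" unfolding \<eta>_def using t e by simp
    obtain C where C: "C \<subseteq> -E" "compact C" "measure \<sigma> (-E - C) < \<eta>"
      using inner_compact_approx[OF \<sigma> _ \<eta>, of "-E"] E(1) by auto
    define \<sigma>' where "\<sigma>' = density \<sigma> (indicator (-C))"
    have Cb: "-C \<in> sets \<sigma>" using C(2) \<sigma>(2) by (simp add: compact_imp_closed borel_closed)
    have \<sigma>': "finite_measure \<sigma>'" "sets \<sigma>' = sets borel"
      unfolding \<sigma>'_def using \<sigma>.finite_measure_restricted[OF Cb] \<sigma>(2) by simp_all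
    have m\<sigma>': "measure \<sigma>' B = measure \<sigma> (-C \<inter> B)" if "B \<in> sets borel" for B
      unfolding \<sigma>'_def by (rule measure_restricted[OF Cb]) (use that \<sigma>(2) in simp)
    have "measure \<sigma> (-C \<inter> UNIV) \<le> measure \<sigma> ((-E - C) \<union> E)"
      by (rule \<sigma>.finite_measure_mono) (use E(1) \<sigma>(2) C(2) in \<open>auto simp: compact_imp_closed borel_closed\<close>)
    also have "\<dots> \<le> measure \<sigma> (-E - C) + measure \<sigma> E"
      by (rule measure_Un_le) (use E(1) \<sigma>(2) C(2) in \<open>auto simp: compact_imp_closed borel_closed\<close>)
    finally have mU: "measure \<sigma>' UNIV < \<eta>" using C(3) E(2) m\<sigma>'[of UNIV] by simp
    define A where "A = {x. \<exists>r>0. t * measure lam (ball x r) < measure \<sigma>' (ball x r)}"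
    have "open A" unfolding A_def using open_maximal_set[OF lam \<sigma>'] t by simp
    moreover have "Bad \<subseteq> A"
    proof
      fix x assume "x \<in> Bad"
      then have xE: "x \<in> E" and fr: "\<exists>\<^sub>F r in at_right 0. t * measure lam (ball x r) < measure \<sigma> (ball x r)"
        unfolding Bad_def frequently_def by (auto simp: not_less)
      have "open (-C)" "x \<in> -C" using C xE by (auto simp: compact_imp_closed)
      then obtain d where d: "d > 0" "ball x d \<subseteq> -C" using open_contains_ball by blast
      have "\<forall>\<^sub>F r in at_right 0. r < d \<and> (0::real) < r"
        using d(1) unfolding eventually_at_right_field by (intro exI[of _ d]) auto
      then have "\<exists>\<^sub>F r in at_right 0. t * measure lam (ball x r) < measure \<sigma> (ball x r) \<and> (r < d \<and> 0 < r)"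
        using frequently_eventually_frequently[OF fr] by blast
      then obtain r where r: "t * measure lam (ball x r) < measure \<sigma> (ball x r)" "r < d" "0 < r"
        by (auto dest: frequently_ex)
      have "-C \<inter> ball x r = ball x r" using d(2) r(2) subset_ball[of r d x] by auto
      then have "measure \<sigma>' (ball x r) = measure \<sigma> (ball x r)" by (simp add: m\<sigma>')
      then show "x \<in> A" unfolding A_def using r by auto
    qed
    moreover have "measure lam A < e"
    proof -
      have "t * measure lam A \<le> N * measure \<sigma>' UNIV" unfolding A_def by (rule N[rule_format, OF lam \<sigma>' t])
      also have "\<dots> \<le> N * \<eta>" using mU by (simp add: mult_left_mono)
      also have "\<dots> < (N + 1) * \<eta>" using \<eta> by (simp add: algebra_simps)
      also have "\<dots> = t * e" unfolding \<eta>_def by (simp add: field_simps)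
      finally show ?thesis using t by simp
    qed
    ultimately show ?thesis by blast
  qed
  obtain A where A: "\<And>n. open (A n)" "\<And>n. Bad \<subseteq> A n" "\<And>n. measure lam (A n) < 1 / real (Suc n)"
  proof -
    have "\<forall>n. \<exists>A. open A \<and> Bad \<subseteq> A \<and> measure lam A < 1 / real (Suc n)" using small by simp
    from choice[OF this] show ?thesis using that by auto
  qed
  have "(\<Inter>n. A n) \<in> null_sets lam"
  proof (rule null_setsI)
    show meas: "(\<Inter>n. A n) \<in> sets lam" using A(1) lam(2) by auto
    have "measure lam (\<Inter>n. A n) \<le> 1 / real (Suc n)" for n
    proof -
      have "measure lam (\<Inter>n. A n) \<le> measure lam (A n)"
        by (rule lam.finite_measure_mono) (use A(1) lam(2) in auto)
      then show ?thesis using A(3)[of n] by simp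
    qed
    then have "measure lam (\<Inter>n. A n) \<le> 0"
      using LIMSEQ_le_const[OF LIMSEQ_Suc[OF lim_1_over_n]] by blast
    then show "emeasure lam (\<Inter>n. A n) = 0" by (simp add: lam.emeasure_eq_measure measure_le_0_iff)
  qed
  then show ?thesis
    by (rule AE_I') (use A(2) sp in \<open>auto simp: Bad_def\<close>)
qed

text \<open>For \<open>q\<close> in a countable dense set, the measure with density |h - q| cut off
  to the complement of \<open>E q n\<close> vanishes on \<open>E q n\<close>, so the previous lemma
  makes it negligible around almost every point of \<open>E q n\<close>. Inside \<open>E q n\<close>
  the integrand is small anyway, and at a given \<open>x\<close> one picks \<open>q\<close> close to
  \<open>h x\<close>.\<close>

lemma Lebesgue_points:
  fixes lam :: "'a::euclidean_space measure" and h :: "'a \<Rightarrow> 'b::euclidean_space"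
  assumes lam: "finite_measure lam" "sets lam = sets borel" and h: "integrable lam h"
  shows "AE x in lam. \<forall>e>0. \<forall>\<^sub>F r in at_right 0.
    (\<integral>y. indicator (ball x r) y * norm (h y - h x) \<partial>lam) \<le> e * measure lam (ball x r)"
proof -
  interpret lam: finite_measure lam by fact
  have [measurable]: "h \<in> borel_measurable borel" using h lam(2) borel_measurable_integrable measurable_cong_sets by blast
  have [measurable_cong]: "sets lam = sets borel" by fact
  obtain D :: "'b set" where D: "countable D" "\<And>X. open X \<Longrightarrow> X \<noteq> {} \<Longrightarrow> \<exists>d\<in>D. d \<in> X"
    using countable_dense_exists by metis
  define E where "E q n = {y. norm (h y - q) < 1 / real (Suc n)}" for q n
  have [measurable]: "E q n \<in> sets borel" for q n unfolding E_def by measurable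
  have int: "integrable lam (\<lambda>y. norm (h y - q))" for q using h by auto
  have intB: "integrable lam (\<lambda>y. indicator B y * norm (h y - q))" if "B \<in> sets borel" for q B
    using integrable_mult_indicator[of B lam "\<lambda>y. norm (h y - q)"] int that lam(2) by simp
  define \<sigma> where "\<sigma> q n = density lam (\<lambda>y. ennreal (indicator (- E q n) y * norm (h y - q)))" for q n
  have em: "emeasure (\<sigma> q n) B = ennreal (\<integral>y. indicator B y * (indicator (- E q n) y * norm (h y - q)) \<partial>lam)"
    if [measurable]: "B \<in> sets borel" for q n B
  proof -
    have "emeasure (\<sigma> q n) B = (\<integral>\<^sup>+y. ennreal (indicator (- E q n) y * norm (h y - q)) * indicator B y \<partial>lam)"
      unfolding \<sigma>_def by (rule emeasure_density) measurable
    also have "\<dots> = (\<integral>\<^sup>+y. ennreal (indicator B y * (indicator (- E q n) y * norm (h y - q))) \<partial>lam)"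
      by (intro nn_integral_cong) (auto simp: indicator_def)
    also have "\<dots> = ennreal (\<integral>y. indicator B y * (indicator (- E q n) y * norm (h y - q)) \<partial>lam)"
    proof (rule nn_integral_eq_integral)
      have "integrable lam (\<lambda>y. indicator (B \<inter> - E q n) y * norm (h y - q))" by (rule intB) measurable
      then show "integrable lam (\<lambda>y. indicator B y * (indicator (- E q n) y * norm (h y - q)))"
        by (simp add: indicator_inter_arith mult.assoc)
    qed simp
    finally show ?thesis .
  qed
  have \<sigma>: "finite_measure (\<sigma> q n)" "sets (\<sigma> q n) = sets borel" for q n
  proof
    show "sets (\<sigma> q n) = sets borel" unfolding \<sigma>_def by (simp add: lam)
    then have "space (\<sigma> q n) = UNIV" using sets_eq_imp_space_eq by fastforce
    then show "emeasure (\<sigma> q n) (space (\<sigma> q n)) \<noteq> \<infinity>" using em[of UNIV q n] by simp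
  qed
  have m\<sigma>: "measure (\<sigma> q n) B = (\<integral>y. indicator B y * (indicator (- E q n) y * norm (h y - q)) \<partial>lam)"
    if "B \<in> sets borel" for q n B
    using em[OF that, of q n] by (simp add: measure_def integral_nonneg_AE)
  have E0: "measure (\<sigma> q n) (E q n) = 0" for q n
  proof -
    have "(\<lambda>y. indicator (E q n) y * (indicator (- E q n) y * norm (h y - q))) = (\<lambda>y. 0)"
      by (auto simp: indicator_def)
    then show ?thesis using m\<sigma>[of "E q n" q n] by simp
  qed
  have "AE x in lam. \<forall>q\<in>D. \<forall>n. x \<in> E q n \<longrightarrow>
      (\<forall>\<^sub>F r in at_right 0. measure (\<sigma> q n) (ball x r) \<le> 1 / real (Suc n) * measure lam (ball x r))"
    unfolding AE_ball_countable[OF D(1)] AE_all_countable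
    by (intro ballI allI density_zero_off_support lam \<sigma> E0) auto
  then show ?thesis
  proof eventually_elim
    case (elim x)
    show ?case
    proof (intro allI impI)
      fix e :: real assume "e > 0"
      \<comment> \<open>Three errors of size \<open>1 / Suc n\<close> occur: the distance from
        \<open>h x\<close> to \<open>q\<close>, the values of |h - q| inside \<open>E q n\<close>,
        and the contribution of the complement.\<close>
      then obtain n where n: "1 / real (Suc n) < e / 3" using nat_approx_posE[of "e/3"] by auto
      obtain q where q: "q \<in> D" "q \<in> ball (h x) (1 / real (Suc n))"
        using D(2)[of "ball (h x) (1 / real (Suc n))"] by auto
      have qn: "norm (h x - q) < 1 / real (Suc n)" using q(2) by (simp add: dist_norm)
      then have "x \<in> E q n" unfolding E_def by simp
      then have "\<forall>\<^sub>F r in at_right 0. measure (\<sigma> q n) (ball x r) \<le> 1 / real (Suc n) * measure lam (ball x r)"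
        using elim q(1) by blast
      then show "\<forall>\<^sub>F r in at_right 0.
        (\<integral>y. indicator (ball x r) y * norm (h y - h x) \<partial>lam) \<le> e * measure lam (ball x r)"
      proof eventually_elim
        case (elim r)
        have i1: "integrable lam (\<lambda>y. indicator (ball x r) y * (indicator (- E q n) y * norm (h y - q)))"
        proof -
          have "integrable lam (\<lambda>y. indicator (ball x r \<inter> - E q n) y * norm (h y - q))" by (rule intB) measurable
          then show ?thesis by (simp add: indicator_inter_arith mult.assoc)
        qed
        have i2: "integrable lam (\<lambda>y. indicator (ball x r) y * (2 / real (Suc n)))"
          by (intro integrable_mult_left) (simp add: integrable_indicator_iff lam lam.emeasure_finite less_top[symmetric])
        have "(\<integral>y. indicator (ball x r) y * norm (h y - h x) \<partial>lam)
          \<le> (\<integral>y. indicator (ball x r) y * (indicator (- E q n) y * norm (h y - q)) + indicator (ball x r) y * (2 / real (Suc n)) \<partial>lam)"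
        proof (rule integral_mono)
          show "integrable lam (\<lambda>y. indicator (ball x r) y * norm (h y - h x))" by (rule intB) simp
          show "integrable lam (\<lambda>y. indicator (ball x r) y * (indicator (- E q n) y * norm (h y - q)) + indicator (ball x r) y * (2 / real (Suc n)))"
            using i1 i2 by (rule Bochner_Integration.integrable_add)
          fix y
          have "norm (h y - h x) \<le> norm (h y - q) + 1 / real (Suc n)"
            using norm_triangle_ineq4[of "h y - q" "h x - q"] qn by simp
          moreover have "norm (h y - q) \<le> indicator (- E q n) y * norm (h y - q) + 1 / real (Suc n)"
            by (auto simp: E_def indicator_def)
          ultimately have "norm (h y - h x) \<le> indicator (- E q n) y * norm (h y - q) + 2 / real (Suc n)" by simp
          then show "indicator (ball x r) y * norm (h y - h x) \<le>
            indicator (ball x r) y * (indicator (- E q n) y * norm (h y - q)) + indicator (ball x r) y * (2 / real (Suc n))"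
            by (simp add: indicator_def)
        qed
        also have "\<dots> = measure (\<sigma> q n) (ball x r) + measure lam (ball x r) * (2 / real (Suc n))"
          unfolding Bochner_Integration.integral_add[OF i1 i2] m\<sigma>[OF borel_open[OF open_ball]]
          by (simp add: lam sets_eq_imp_space_eq[OF lam(2)])
        also have "\<dots> \<le> 3 * (1 / real (Suc n)) * measure lam (ball x r)"
          using elim by (simp add: algebra_simps)
        also have "\<dots> \<le> e * measure lam (ball x r)"
          using n by (intro mult_right_mono) auto
        finally show ?case .
      qed
    qed
  qed
qed

section \<open>Prescribing small gradients\<close>

text \<open>For each basis set \<open>B n\<close>, its preimage and the rest of \<open>A\<close> are
  approximated from inside by compact sets \<open>C n\<close> and \<open>D n\<close> with summable
  loss. On the intersection of all the unions of \<open>C n\<close> and \<open>D n\<close>, the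
  preimage of \<open>B n\<close> is the complement of the closed set \<open>D n\<close>, hence
  relatively open.\<close>

lemma Lusin_compact:
  fixes M :: "'a::euclidean_space measure" and F :: "'a \<Rightarrow> 'b::euclidean_space"
  assumes M: "finite_measure M" "sets M = sets borel" and F: "F \<in> borel_measurable borel"
    and A: "A \<in> sets borel" and e: "(e::real) > 0"
  shows "\<exists>K. compact K \<and> K \<subseteq> A \<and> measure M (A - K) < e \<and> continuous_on K F"
proof -
  interpret finite_measure M by fact
  obtain \<B> :: "'b set set" where \<B>: "countable \<B>" "topological_basis \<B>"
    using ex_countable_basis by blast
  have ne: "\<B> \<noteq> {}" using \<B>(2) topological_basisE[of \<B> UNIV undefined] by auto
  define B where "B = from_nat_into \<B>"
  have rB: "range B = \<B>" unfolding B_def using ne \<B>(1) by (rule range_from_nat_into)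
  have opB: "open (B n)" for n by (rule topological_basis_open[OF \<B>(2)]) (use rB in auto)
  define P where "P n = A \<inter> F -` B n" for n
  have Pb: "P n \<in> sets borel" for n
    unfolding P_def using A measurable_sets_borel[OF F, of "B n"] opB by auto
  have APb: "A - P n \<in> sets borel" for n using Pb A by auto
  \<comment> \<open>Two pieces are lost at each \<open>n\<close>; the total is at most
    \<open>e / 2\<close>, which leaves the inequality strict.\<close>
  define \<eta> where "\<eta> n = e * (1/2)^(n+3)" for n :: nat
  have \<eta>: "\<eta> n > 0" for n unfolding \<eta>_def using e by simp
  have "\<forall>n. \<exists>C. compact C \<and> C \<subseteq> P n \<and> measure M (P n - C) < \<eta> n"
    using inner_compact_approx[OF M Pb \<eta>] by blast
  from choice[OF this] obtain C where C: "\<And>n. compact (C n)" "\<And>n. C n \<subseteq> P n" "\<And>n. measure M (P n - C n) < \<eta> n" by blast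
  have "\<forall>n. \<exists>D. compact D \<and> D \<subseteq> A - P n \<and> measure M (A - P n - D) < \<eta> n"
    using inner_compact_approx[OF M APb \<eta>] by blast
  from choice[OF this] obtain D where D: "\<And>n. compact (D n)" "\<And>n. D n \<subseteq> A - P n" "\<And>n. measure M (A - P n - D n) < \<eta> n" by blast
  define K where "K = (\<Inter>n. C n \<union> D n)"
  have CDb: "C n \<in> sets borel" "D n \<in> sets borel" for n
    using C(1) D(1) by (auto simp: compact_imp_closed borel_closed)
  have "compact K" unfolding K_def
    by (rule compact_Inter) (use C D in auto)
  moreover have "K \<subseteq> A" unfolding K_def using C(2)[of 0] D(2)[of 0] unfolding P_def by auto
  moreover have "measure M (A - K) < e"
  proof -
    define W where "W n = (P n - C n) \<union> (A - P n - D n)" for n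
    have Wb: "W n \<in> sets M" for n unfolding W_def M(2) using Pb A CDb by auto
    have Wm: "measure M (W n) \<le> e * (1/2)^(n+2)" for n
    proof -
      have "measure M (W n) \<le> measure M (P n - C n) + measure M (A - P n - D n)"
        unfolding W_def by (rule measure_Un_le) (use Pb A CDb M(2) in auto)
      moreover have "e * (1/2)^(n+2) = 2 * \<eta> n" by (simp add: \<eta>_def power_add eval_nat_numeral)
      ultimately show ?thesis using C(3)[of n] D(3)[of n] by linarith
    qed
    have sums: "(\<lambda>n. e * (1/2)^(n+2)) sums (e / 2)"
    proof -
      have "(\<lambda>n. (e/4) * (1/2)^n) sums ((e/4) * (1 / (1 - 1/2)))" by (intro sums_mult geometric_sums) simp
      then show ?thesis by (simp add: algebra_simps)
    qed
    have summ: "summable (\<lambda>n. measure M (W n))"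
      by (rule summable_comparison_test[OF _ sums_summable[OF sums]]) (use Wm in auto)
    have "measure M (A - K) \<le> measure M (\<Union>n. W n)"
      by (rule finite_measure_mono) (use Wb in \<open>auto simp: K_def W_def\<close>)
    also have "\<dots> \<le> (\<Sum>n. measure M (W n))"
      by (rule finite_measure_subadditive_countably) (use Wb summ in auto)
    also have "\<dots> \<le> (\<Sum>n. e * (1/2)^(n+2))" by (rule suminf_le[OF Wm summ sums_summable[OF sums]])
    also have "\<dots> = e / 2" using sums by (simp add: sums_iff)
    finally show ?thesis using e by simp
  qed
  moreover have "continuous_on K F"
    unfolding continuous_on_open_invariant
  proof (intro allI impI)
    fix V :: "'b set" assume V: "open V"
    define I where "I = {n. B n \<subseteq> V}"
    have "(\<Union>n\<in>I. - D n) \<inter> K = F -` V \<inter> K"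
    proof (intro equalityI subsetI)
      fix x assume "x \<in> (\<Union>n\<in>I. - D n) \<inter> K"
      then obtain n where n: "n \<in> I" "x \<notin> D n" "x \<in> K" by auto
      then have "x \<in> C n" unfolding K_def by auto
      then have "F x \<in> B n" using C(2)[of n] unfolding P_def by auto
      then show "x \<in> F -` V \<inter> K" using n unfolding I_def by auto
    next
      fix x assume x: "x \<in> F -` V \<inter> K"
      then obtain X where X: "X \<in> \<B>" "F x \<in> X" "X \<subseteq> V"
        using topological_basisE[OF \<B>(2) V, of "F x"] by auto
      then obtain n where n: "X = B n" using rB by auto
      then have "x \<notin> D n" using X D(2)[of n] unfolding P_def by auto
      then show "x \<in> (\<Union>n\<in>I. - D n) \<inter> K" using x X n unfolding I_def by auto
    qed
    moreover have "open (\<Union>n\<in>I. - D n)"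
      by (intro open_UN ballI open_Compl compact_imp_closed D(1))
    ultimately show "\<exists>T. open T \<and> T \<inter> K = F -` V \<inter> K" by blast
  qed
  ultimately show ?thesis by blast
qed

text \<open>The gradient is carried as explicit data on the whole space, so that sums, products,
  compositions and uniformly convergent series come with a formula for it.\<close>

definition C1_gradient :: "('a::euclidean_space \<Rightarrow> real) \<Rightarrow> ('a \<Rightarrow> 'a) \<Rightarrow> bool" where
  "C1_gradient g G \<longleftrightarrow> continuous_on UNIV G \<and> (\<forall>x. (g has_derivative (\<lambda>v. inner (G x) v)) (at x))"

lemma C1_gradient_continuous: "C1_gradient g G \<Longrightarrow> continuous_on A g"
  unfolding C1_gradient_def
  by (meson continuous_at_imp_continuous_on has_derivative_continuous)

lemma C1_gradient_add:
  "C1_gradient f F \<Longrightarrow> C1_gradient g G \<Longrightarrow> C1_gradient (\<lambda>x. f x + g x) (\<lambda>x. F x + G x)"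
  unfolding C1_gradient_def
  by (auto intro!: continuous_intros derivative_eq_intros simp: inner_add_left)

lemma C1_gradient_mult:
  assumes "C1_gradient f F" "C1_gradient g G"
  shows "C1_gradient (\<lambda>x. f x * g x) (\<lambda>x. f x *\<^sub>R G x + g x *\<^sub>R F x)"
proof -
  have "continuous_on UNIV f" "continuous_on UNIV g" using assms by (auto intro: C1_gradient_continuous)
  then show ?thesis using assms unfolding C1_gradient_def
    by (auto intro!: continuous_intros derivative_eq_intros simp: inner_add_left mult.commute)
qed

lemma C1_gradient_sum:
  assumes "finite I" "\<And>i. i \<in> I \<Longrightarrow> C1_gradient (f i) (F i)"
  shows "C1_gradient (\<lambda>x. \<Sum>i\<in>I. f i x) (\<lambda>x. \<Sum>i\<in>I. F i x)"
  using assms unfolding C1_gradient_def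
  by (auto intro!: continuous_intros derivative_eq_intros simp: inner_sum_left)

lemma C1_gradient_const: "C1_gradient (\<lambda>x. c) (\<lambda>x. 0)"
  unfolding C1_gradient_def by (auto intro!: derivative_eq_intros)

lemma C1_gradient_compose:
  assumes f: "C1_gradient f F" and s: "\<And>t. (s has_real_derivative q t) (at t)" "continuous_on UNIV q"
  shows "C1_gradient (\<lambda>x. s (f x)) (\<lambda>x. q (f x) *\<^sub>R F x)"
  unfolding C1_gradient_def
proof (intro conjI allI)
  have fc: "continuous_on UNIV f" using f by (rule C1_gradient_continuous)
  show "continuous_on UNIV (\<lambda>x. q (f x) *\<^sub>R F x)"
    using f unfolding C1_gradient_def
    by (intro continuous_intros continuous_on_compose2[OF s(2) fc]) auto
  fix x
  have "(f has_derivative (\<lambda>v. inner (F x) v)) (at x)" using f unfolding C1_gradient_def by blast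
  moreover have "(s has_derivative (\<lambda>h. q (f x) * h)) (at (f x))" using s(1) by (simp add: has_field_derivative_def)
  ultimately have "(s \<circ> f has_derivative (\<lambda>h. q (f x) * h) \<circ> (\<lambda>v. inner (F x) v)) (at x)"
    by (rule diff_chain_at)
  then show "((\<lambda>x. s (f x)) has_derivative (\<lambda>v. inner (q (f x) *\<^sub>R F x) v)) (at x)" by (simp add: o_def)
qed

lemma C1_gradient_affine: "C1_gradient (\<lambda>x. l * inner x i - a) (\<lambda>x. l *\<^sub>R i)"
  unfolding C1_gradient_def
  by (auto intro!: continuous_intros derivative_eq_intros simp: inner_commute)

text \<open>Stone-Weierstrass for the algebra of functions whose values and gradients are bounded on
  the whole space. Coordinates are unbounded, so their arctangents are used to separate
  points.\<close>

lemma bounded_C1_dense: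
  fixes K :: "'a::euclidean_space set"
  assumes K: "compact K" and r: "continuous_on K r" and e: "e > 0"
  shows "\<exists>u U B. C1_gradient u U \<and> (\<forall>x. \<bar>u x\<bar> \<le> B \<and> norm (U x) \<le> B) \<and> (\<forall>x\<in>K. \<bar>r x - u x\<bar> < e)"
proof -
  define R where "R = {u :: 'a \<Rightarrow> real. \<exists>U B. C1_gradient u U \<and> (\<forall>x. \<bar>u x\<bar> \<le> B \<and> norm (U x) \<le> B)}"
  interpret function_ring_on R K
  proof
    show "compact K" by fact
    show "continuous_on K u" if "u \<in> R" for u using that unfolding R_def by (auto intro: C1_gradient_continuous)
    show "(\<lambda>_. c) \<in> R" for c
      unfolding R_def by (auto intro!: exI[of _ "\<lambda>_. 0"] exI[of _ "\<bar>c\<bar>"] C1_gradient_const)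
    show "(\<lambda>x. f x + g x) \<in> R" if "f \<in> R" "g \<in> R" for f g
    proof -
      obtain F B where F: "C1_gradient f F" "\<And>x. \<bar>f x\<bar> \<le> B" "\<And>x. norm (F x) \<le> B"
        using \<open>f \<in> R\<close> unfolding R_def by auto
      obtain G D where G: "C1_gradient g G" "\<And>x. \<bar>g x\<bar> \<le> D" "\<And>x. norm (G x) \<le> D"
        using \<open>g \<in> R\<close> unfolding R_def by auto
      have "\<bar>f x + g x\<bar> \<le> B + D" "norm (F x + G x) \<le> B + D" for x
        using F(2,3)[of x] G(2,3)[of x] norm_triangle_ineq[of "F x" "G x"] by linarith+
      then show ?thesis unfolding R_def using C1_gradient_add[OF F(1) G(1)] by blast
    qed
    show "(\<lambda>x. f x * g x) \<in> R" if "f \<in> R" "g \<in> R" for f g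
    proof -
      obtain F B where F: "C1_gradient f F" "\<And>x. \<bar>f x\<bar> \<le> B" "\<And>x. norm (F x) \<le> B"
        using \<open>f \<in> R\<close> unfolding R_def by auto
      obtain G D where G: "C1_gradient g G" "\<And>x. \<bar>g x\<bar> \<le> D" "\<And>x. norm (G x) \<le> D"
        using \<open>g \<in> R\<close> unfolding R_def by auto
      have BD: "0 \<le> B" "0 \<le> D" using F(2)[of 0] G(2)[of 0] by linarith+
      have "\<bar>f x * g x\<bar> \<le> B * D + D * B" for x
      proof -
        have "\<bar>f x\<bar> * \<bar>g x\<bar> \<le> B * D" using F(2) G(2) BD by (intro mult_mono) auto
        then show ?thesis using mult_nonneg_nonneg[OF BD(2,1)] unfolding abs_mult by linarith
      qed
      moreover have "norm (f x *\<^sub>R G x + g x *\<^sub>R F x) \<le> B * D + D * B" for x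
      proof -
        have "\<bar>f x\<bar> * norm (G x) \<le> B * D" "\<bar>g x\<bar> * norm (F x) \<le> D * B"
          using F G BD by (auto intro!: mult_mono)
        then show ?thesis using norm_triangle_ineq[of "f x *\<^sub>R G x" "g x *\<^sub>R F x"] unfolding norm_scaleR by linarith
      qed
      ultimately show ?thesis unfolding R_def using C1_gradient_mult[OF F(1) G(1)] by blast
    qed
    show "\<exists>f\<in>R. f x \<noteq> f y" if "x \<noteq> y" for x y
    proof -
      obtain i where i: "i \<in> Basis" "inner x i \<noteq> inner y i" using \<open>x \<noteq> y\<close> euclidean_eqI by blast
      have c: "C1_gradient (\<lambda>x. arctan (1 * inner x i - 0)) (\<lambda>x. inverse (1 + (1 * inner x i - 0)\<^sup>2) *\<^sub>R (1 *\<^sub>R i))"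
        by (rule C1_gradient_compose[OF C1_gradient_affine, of arctan "\<lambda>t. inverse (1 + t\<^sup>2)"])
           (auto intro!: DERIV_arctan continuous_intros simp: add_nonneg_eq_0_iff)
      have at: "\<bar>arctan t\<bar> \<le> pi" for t :: real using arctan_bounded[of t] by (simp add: abs_le_iff)
      have bt: "norm (inverse (1 + t\<^sup>2) *\<^sub>R (1 *\<^sub>R i)) \<le> pi" for t :: real
      proof -
        have "inverse (1 + t\<^sup>2) \<le> inverse 1" by (intro le_imp_inverse_le) auto
        then show ?thesis using i(1) pi_gt3 by (simp add: abs_of_nonneg)
      qed
      have inR: "(\<lambda>x. arctan (1 * inner x i - 0)) \<in> R" unfolding R_def mem_Collect_eq
        by (intro exI[of _ "\<lambda>x. inverse (1 + (1 * inner x i - 0)\<^sup>2) *\<^sub>R (1 *\<^sub>R i)"] exI[of _ pi] conjI allI c at bt)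
      have "arctan (1 * inner x i - 0) \<noteq> arctan (1 * inner y i - 0)" using i(2) by (simp add: arctan_eq_iff)
      then show ?thesis by (rule bexI[of "\<lambda>f. f x \<noteq> f y", OF _ inR])
    qed
  qed
  obtain u where "u \<in> R" "\<forall>x\<in>K. \<bar>r x - u x\<bar> < e" using Stone_Weierstrass_basic[OF r e] by blast
  then show ?thesis unfolding R_def by blast
qed

lemma sin_Lipschitz: "\<bar>sin x - sin y\<bar> \<le> \<bar>x - y\<bar>" for x y :: real
proof -
  have "\<bar>sin x - sin y\<bar> = 2 * \<bar>sin ((x - y) / 2)\<bar> * \<bar>cos ((x + y) / 2)\<bar>" by (simp add: sin_diff_sin abs_mult)
  also have "\<dots> \<le> 2 * \<bar>(x - y) / 2\<bar> * 1"
    using abs_sin_x_le_abs_x[of "(x - y) / 2"] by (intro mult_mono) auto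
  finally show ?thesis by simp
qed

text \<open>The bound must hold off \<open>K\<close> too, and a sharp truncation would destroy
  differentiability. So \<open>b * arcsin (r / b)\<close> is approximated and then sent through
  \<open>b * sin (_ / b)\<close>, which is bounded by \<open>b\<close>, does not increase distances
  and undoes the arcsine on \<open>K\<close>.\<close>

lemma bounded_C1_approx:
  fixes K :: "'a::euclidean_space set"
  assumes K: "compact K" and r: "continuous_on K r" and \<delta>: "\<delta> > 0" "\<And>x. x \<in> K \<Longrightarrow> \<bar>r x\<bar> \<le> \<delta>" and e: "e > 0"
  shows "\<exists>u U B. C1_gradient u U \<and> (\<forall>x. \<bar>u x\<bar> \<le> 2 * \<delta> \<and> norm (U x) \<le> B) \<and> (\<forall>x\<in>K. \<bar>r x - u x\<bar> < e)"
proof -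
  define b where "b = 2 * \<delta>"
  have b: "b > 0" using \<delta> by (simp add: b_def)
  have rb: "\<bar>r x / b\<bar> \<le> 1" if "x \<in> K" for x using \<delta>(2)[OF that] b by (simp add: b_def field_simps)
  have rb2: "-1 \<le> r x / b \<and> r x / b \<le> 1" if "x \<in> K" for x using rb[OF that] by linarith
  have "continuous_on K (\<lambda>x. b * arcsin (r x / b))"
    using rb2 b by (intro continuous_intros r) auto
  from bounded_C1_dense[OF K this e] obtain v V B where v: "C1_gradient v V" "\<And>x. norm (V x) \<le> B"
    "\<And>x. x \<in> K \<Longrightarrow> \<bar>b * arcsin (r x / b) - v x\<bar> < e" by blast
  have d: "((\<lambda>t. b * sin (t / b)) has_real_derivative cos (t / b)) (at t)" for t
    using b by (auto intro!: derivative_eq_intros)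
  have c: "continuous_on UNIV (\<lambda>t. cos (t / b))" using b by (intro continuous_intros) auto
  have "C1_gradient (\<lambda>x. b * sin (v x / b)) (\<lambda>x. cos (v x / b) *\<^sub>R V x)"
    by (rule C1_gradient_compose[OF v(1) d c])
  moreover have "\<bar>b * sin (v x / b)\<bar> \<le> 2 * \<delta>" for x
    using b abs_sin_le_one[of "v x / b"] mult_left_mono[of "\<bar>sin (v x / b)\<bar>" 1 b] by (simp add: abs_mult b_def)
  moreover have "norm (cos (v x / b) *\<^sub>R V x) \<le> B" for x
    using v(2)[of x] mult_right_mono[OF abs_cos_le_one[of "v x / b"], of "norm (V x)"] by simp
  moreover have "\<bar>r x - b * sin (v x / b)\<bar> < e" if x: "x \<in> K" for x
  proof -
    have e1: "b * sin (arcsin (r x / b)) = r x" using sin_arcsin[of "r x / b"] rb2[OF x] b by simp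
    have "\<bar>r x - b * sin (v x / b)\<bar> = \<bar>b * (sin (arcsin (r x / b)) - sin (v x / b))\<bar>"
      by (simp only: right_diff_distrib e1)
    also have "\<dots> = b * \<bar>sin (arcsin (r x / b)) - sin (v x / b)\<bar>"
      using b by (simp add: abs_mult)
    also have "\<dots> \<le> b * \<bar>arcsin (r x / b) - v x / b\<bar>" using b sin_Lipschitz by (intro mult_left_mono) auto
    also have "\<dots> = \<bar>b * (arcsin (r x / b) - v x / b)\<bar>" using b by (simp add: abs_mult)
    also have "b * (arcsin (r x / b) - v x / b) = b * arcsin (r x / b) - v x" using b by (simp add: algebra_simps)
    finally show ?thesis using v(3)[OF x] by simp
  qed
  ultimately show ?thesis by blast
qed

text \<open>A slope equal to 1 most of the time has a bounded antiderivative only if it is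
  compensated elsewhere. Here the slope dips on the arcs \<open>cos t > c0\<close>, so that its mean
  over a period vanishes and the antiderivative becomes periodic.\<close>

lemma periodic_profile:
  assumes c0: "c0 < (1::real)"
  obtains s q :: "real \<Rightarrow> real" and C
  where "\<And>t. (s has_real_derivative q t) (at t)" "continuous_on UNIV q"
    "\<And>t. \<bar>s t\<bar> \<le> C" "\<And>t. \<bar>q t\<bar> \<le> C" "\<And>t. cos t \<le> c0 \<Longrightarrow> q t = 1"
proof -
  define h where "h t = max 0 (cos t - c0)" for t
  have hc: "continuous_on UNIV h" unfolding h_def by (intro continuous_intros)
  have "\<exists>H. \<forall>x::real. -\<infinity> < ereal x \<longrightarrow> ereal x < \<infinity> \<longrightarrow> (H has_vector_derivative h x) (at x)"
    by (rule einterval_antiderivative) (use hc in \<open>auto simp: continuous_on_eq_continuous_at\<close>)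
  then obtain H where H: "\<And>x. (H has_real_derivative h x) (at x)"
    by (auto simp: has_real_derivative_iff_has_vector_derivative)
  define I where "I = H (2 * pi) - H 0"
  have per: "H (t + 2 * pi) = H t + I" for t
  proof -
    have "((\<lambda>t. H (t + 2 * pi) - H t) has_real_derivative 0) (at t)" for t
    proof -
      have "((\<lambda>t. H (t + 2 * pi) - H t) has_real_derivative h (t + 2 * pi) - h t) (at t)"
        by (intro DERIV_diff H) (use DERIV_shift[of H "h (t + 2 * pi)" t "2 * pi"] H in blast)
      then show ?thesis by (simp add: h_def)
    qed
    then have "(\<lambda>t. H (t + 2 * pi) - H t) t = (\<lambda>t. H (t + 2 * pi) - H t) 0"
      by (intro DERIV_isconst_all) auto
    then show ?thesis by (simp add: I_def)
  qed
  have I: "I > 0"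
  proof -
    have h0: "0 \<le> h x" for x by (simp add: h_def)
    have mono: "H a \<le> H b" if "a \<le> b" for a b
      by (rule DERIV_nonneg_imp_nondecreasing[OF that]) (use H h0 in blast)
    have "h 0 > 0" using c0 by (simp add: h_def)
    from DERIV_pos_inc_right[OF H this] obtain d where d: "d > 0" "\<And>k. k > 0 \<Longrightarrow> k < d \<Longrightarrow> H 0 < H (0 + k)" by blast
    define k where "k = min (d/2) pi"
    have k: "k > 0" "k < d" "k \<le> 2 * pi" using d(1) pi_gt_zero unfolding k_def by (auto simp: min_def)
    then have "H 0 < H k" using d(2) by simp
    then show ?thesis using mono[OF k(3)] by (simp add: I_def)
  qed
  \<comment> \<open>\<open>I\<close> is the integral of the bump \<open>h\<close> over one period,
    positive because \<open>c0 < 1\<close>. The factor \<open>2 * pi / I\<close> makes the gain of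
    the linear part over a period cancel.\<close>
  define s where "s t = t - (2 * pi / I) * H t" for t
  define q where "q t = 1 - (2 * pi / I) * h t" for t
  have sq: "(s has_real_derivative q t) (at t)" for t
    unfolding s_def[abs_def] q_def using I by (auto intro!: derivative_eq_intros H)
  have qc: "continuous_on UNIV q" unfolding q_def[abs_def] by (intro continuous_intros hc)
  have sper: "s (t + 2 * pi) = s t" for t unfolding s_def per using I by (simp add: field_simps)
  have sn: "s (t + 2 * pi * real n) = s t" for t n
  proof (induction n)
    case (Suc n)
    have "s (t + 2 * pi * real (Suc n)) = s ((t + 2 * pi * real n) + 2 * pi)" by (simp add: algebra_simps)
    then show ?case using Suc sper by simp
  qed simp
  have si: "s (t + 2 * pi * real_of_int n) = s t" for t n
  proof (cases "n \<ge> 0")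
    case True
    then show ?thesis using sn[of t "nat n"] by simp
  next
    case False
    then show ?thesis using sn[of "t + 2 * pi * real_of_int n" "nat (-n)"] by simp
  qed
  have sc: "continuous_on {0..2*pi} s" by (rule DERIV_continuous_on) (rule has_field_derivative_at_within[OF sq])
  then have "bounded (s ` {0..2*pi})" using compact_continuous_image compact_imp_bounded by blast
  then obtain S where "\<forall>y\<in>s ` {0..2*pi}. norm y \<le> S" unfolding bounded_iff by blast
  then have S: "\<bar>s t\<bar> \<le> S" if "t \<in> {0..2*pi}" for t using that by auto
  have sb: "\<bar>s t\<bar> \<le> S" for t
  proof -
    define n where "n = \<lfloor>t / (2 * pi)\<rfloor>"
    have "real_of_int n \<le> t / (2 * pi)" "t / (2 * pi) < real_of_int n + 1" unfolding n_def by linarith+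
    then have "2 * pi * real_of_int n \<le> t" "t < 2 * pi * real_of_int n + 2 * pi"
      by (simp_all add: field_simps)
    then have "t - 2 * pi * real_of_int n \<in> {0..2*pi}" by simp
    from S[OF this] show ?thesis using si[of "t - 2 * pi * real_of_int n" n] by simp
  qed
  have qb: "\<bar>q t\<bar> \<le> 1 + (2 * pi / I) * (1 + \<bar>c0\<bar>)" for t
  proof -
    have h: "0 \<le> h t" "h t \<le> 1 + \<bar>c0\<bar>" unfolding h_def using cos_le_one[of t] by linarith+
    then have "0 \<le> (2 * pi / I) * h t" "(2 * pi / I) * h t \<le> (2 * pi / I) * (1 + \<bar>c0\<bar>)"
      using I by (auto intro!: mult_nonneg_nonneg mult_left_mono divide_right_mono)
    then show ?thesis unfolding q_def by linarith
  qed
  show thesis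
  proof (rule that[of s q "max S (1 + (2 * pi / I) * (1 + \<bar>c0\<bar>))"])
    show "q t = 1" if "cos t \<le> c0" for t using that by (simp add: q_def h_def)
  qed (use sq qc sb qb in \<open>auto intro: order_trans[OF _ max.cobounded1] order_trans[OF _ max.cobounded2]\<close>)
qed

text \<open>The \<open>N\<close> phases are equally spaced on the circle, and for \<open>c0\<close>
  close to 1 the arcs around them are disjoint. Then the bad sets of the shifted profiles are
  disjoint for any measure whatsoever, and one of them carries at most a fraction
  \<open>1 / N\<close> of the mass.\<close>

lemma separated_shifts:
  obtains c0 :: real and a :: "nat \<Rightarrow> real"
  where "c0 < 1" "\<And>j k t. j < N \<Longrightarrow> k < N \<Longrightarrow> cos (t - a j) > c0 \<Longrightarrow> cos (t - a k) > c0 \<Longrightarrow> j = k"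
proof -
  define a where "a j = 2 * pi * (real j / real N)" for j
  define m where "m = Max (insert 0 ((\<lambda>(j, k). cos (a j - a k)) ` {(j, k). j < N \<and> k < N \<and> j \<noteq> k}))"
  have fin: "finite {(j, k). j < N \<and> k < N \<and> j \<noteq> k}"
    by (rule finite_subset[of _ "{..<N} \<times> {..<N}"]) auto
  have lt: "cos (a j - a k) < 1" if jk: "j < N" "k < N" "j \<noteq> k" for j k
  proof (rule ccontr)
    assume "\<not> ?thesis"
    then have "cos (a j - a k) = 1" using cos_le_one[of "a j - a k"] by linarith
    then obtain n :: int where n: "a j - a k = real_of_int n * 2 * pi" using cos_one_2pi_int by blast
    then have "2 * pi * (real j / real N - real k / real N) = 2 * pi * real_of_int n"
      by (simp add: a_def algebra_simps)
    then have "real j / real N - real k / real N = real_of_int n" by simp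
    then have "real j - real k = real_of_int n * real N" using jk by (simp add: field_simps)
    then have "real_of_int (int j - int k) = real_of_int (n * int N)" by simp
    then have eq: "int j - int k = n * int N" by (simp only: of_int_eq_iff)
    moreover have "\<bar>int j - int k\<bar> < int N" using jk by auto
    ultimately have "\<bar>n\<bar> * int N < 1 * int N" by (simp add: abs_mult)
    then have "\<bar>n\<bar> < 1" by (rule mult_right_less_imp_less) simp
    then show False using eq jk(3) by simp
  qed
  have m1: "m < 1" unfolding m_def using fin lt by auto
  have m: "cos (a j - a k) \<le> m" if "j < N" "k < N" "j \<noteq> k" for j k
    unfolding m_def by (rule Max_ge) (use fin that in auto)
  \<comment> \<open>Two points of the unit circle close to 1 are close to each other: below,
    \<open>2 - 2 * cos (v - u) < 8 * (1 - c0)\<close>, and this choice makes the right-hand side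
    \<open>2 * (1 - m)\<close>.\<close>
  define c0 where "c0 = 1 - (1 - m) / 4"
  have "j = k" if jk: "j < N" "k < N" and c: "cos (t - a j) > c0" "cos (t - a k) > c0" for j k t
  proof (rule ccontr)
    assume ne: "j \<noteq> k"
    define u v where "u = t - a j" and "v = t - a k"
    have su: "(sin u)\<^sup>2 = 1 - (cos u)\<^sup>2" "(sin v)\<^sup>2 = 1 - (cos v)\<^sup>2" by (simp_all add: sin_squared_eq)
    have "2 - 2 * cos (v - u) = (cos u - cos v)\<^sup>2 + (sin u - sin v)\<^sup>2"
      by (simp add: cos_diff power2_diff su algebra_simps)
    also have "(cos u - cos v)\<^sup>2 \<le> 2 * (cos u - 1)\<^sup>2 + 2 * (cos v - 1)\<^sup>2"
      using zero_le_power2[of "cos u + cos v - 2"] by (simp add: power2_eq_square algebra_simps)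
    also have "(sin u - sin v)\<^sup>2 \<le> 2 * (sin u)\<^sup>2 + 2 * (sin v)\<^sup>2"
      using zero_le_power2[of "sin u + sin v"] by (simp add: power2_eq_square algebra_simps)
    finally have "2 - 2 * cos (v - u) \<le> 2 * (cos u - 1)\<^sup>2 + 2 * (cos v - 1)\<^sup>2 + (2 * (sin u)\<^sup>2 + 2 * (sin v)\<^sup>2)" by simp
    also have "\<dots> = 8 - 4 * cos u - 4 * cos v" by (simp add: su power2_diff algebra_simps)
    also have "\<dots> < 8 * (1 - c0)" using c by (simp add: u_def v_def)
    finally have "cos (v - u) > m" by (simp add: c0_def)
    moreover have "v - u = a j - a k" by (simp add: u_def v_def)
    ultimately show False using m[OF jk ne] by simp
  qed
  moreover have "c0 < 1" using m1 by (simp add: c0_def)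
  ultimately show thesis using that by blast
qed

text \<open>The gradient of a sum of products \<open>u i x * \<sigma> i x\<close> consists of the
  main part with coefficients \<open>u i x * Q i x\<close>, equal to \<open>u i x\<close> where the
  profile has slope 1, and a tail that a high frequency \<open>l\<close> makes small. The constant
  \<open>C\<close> depends on the measure and \<epsilon> but is fixed before \<open>K\<close>, the
  field and both tolerances; the iteration rests on this order.\<close>

lemma gradient_step:
  fixes M :: "'a::euclidean_space measure"
  assumes M: "finite_measure M" "sets M = sets borel" and \<epsilon>: "(\<epsilon>::real) > 0"
  obtains C :: real where "C > 0"
    "\<And>(K::'a set) r \<delta> \<delta>'. compact K \<Longrightarrow> continuous_on K r \<Longrightarrow> 0 < \<delta> \<Longrightarrow> (\<And>x. x \<in> K \<Longrightarrow> norm (r x) \<le> \<delta>) \<Longrightarrow> 0 < \<delta>' \<Longrightarrow>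
      \<exists>g G K'. C1_gradient g G \<and> (\<forall>x. norm (G x) \<le> C * \<delta>) \<and> compact K' \<and> K' \<subseteq> K \<and>
        measure M (K - K') < \<epsilon> \<and> (\<forall>x\<in>K'. norm (r x - G x) \<le> \<delta>')"
proof -
  interpret finite_measure M by fact
  define n where "n = real DIM('a)"
  have n: "n \<ge> 1" unfolding n_def using DIM_positive[where 'a='a] by linarith
  \<comment> \<open>One bad set per coordinate, each of measure at most
    \<open>measure M UNIV / N\<close>, must sum to less than \<epsilon>.\<close>
  obtain N :: nat where N: "real N > n * measure M UNIV / \<epsilon>" using reals_Archimedean2 by blast
  have "n * measure M UNIV / \<epsilon> \<ge> 0" using n \<epsilon> by simp
  then have Npos: "real N > 0" using N by linarith
  obtain c0 :: real and a where c0: "c0 < 1"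
    and a: "\<And>j k t. j < N \<Longrightarrow> k < N \<Longrightarrow> cos (t - a j) > c0 \<Longrightarrow> cos (t - a k) > c0 \<Longrightarrow> j = k"
    by (rule separated_shifts[of N]) blast
  obtain s q :: "real \<Rightarrow> real" and S where sq: "\<And>t. (s has_real_derivative q t) (at t)" "continuous_on UNIV q"
    and Sb: "\<And>t. \<bar>s t\<bar> \<le> S" "\<And>t. \<bar>q t\<bar> \<le> S" and q1: "\<And>t. cos t \<le> c0 \<Longrightarrow> q t = 1"
    by (rule periodic_profile[OF c0]) blast
  have S0: "S \<ge> 0" using Sb(1)[of 0] by linarith
  \<comment> \<open>\<open>2 * n * S\<close> bounds the main part of the gradient relative to
    \<delta>; the summand 1 pays for the tail, which is kept below \<delta>.\<close>
  define C where "C = 2 * n * S + 1"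
  have C: "C > 0" unfolding C_def using n S0 by (simp add: add_nonneg_pos)
  show thesis
  proof (rule that[OF C])
    fix K :: "'a set" and r :: "'a \<Rightarrow> 'a" and \<delta> \<delta>' :: real
    assume K: "compact K" and r: "continuous_on K r" and \<delta>: "0 < \<delta>" and rb: "\<And>x. x \<in> K \<Longrightarrow> norm (r x) \<le> \<delta>" and \<delta>': "0 < \<delta>'"
    have "\<exists>u U B. C1_gradient u U \<and> (\<forall>x. \<bar>u x\<bar> \<le> 2 * \<delta> \<and> norm (U x) \<le> B) \<and> (\<forall>x\<in>K. \<bar>inner (r x) i - u x\<bar> < \<delta>' / (2 * n))"
      if i: "i \<in> Basis" for i
    proof (rule bounded_C1_approx[OF K _ \<delta>])
      show "continuous_on K (\<lambda>x. inner (r x) i)" using r by (intro continuous_intros)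
      show "\<bar>inner (r x) i\<bar> \<le> \<delta>" if "x \<in> K" for x using Basis_le_norm[OF i, of "r x"] rb[OF that] by linarith
      show "0 < \<delta>' / (2 * n)" using \<delta>' n by simp
    qed
    then have "\<forall>i\<in>Basis. \<exists>p. C1_gradient (fst p) (fst (snd p)) \<and> (\<forall>x. \<bar>fst p x\<bar> \<le> 2 * \<delta> \<and> norm (fst (snd p) x) \<le> snd (snd p))
        \<and> (\<forall>x\<in>K. \<bar>inner (r x) i - fst p x\<bar> < \<delta>' / (2 * n))"
      by simp
    from bchoice[OF this] obtain p where p: "\<And>i. i \<in> Basis \<Longrightarrow> C1_gradient (fst (p i)) (fst (snd (p i)))"
      "\<And>i x. i \<in> Basis \<Longrightarrow> \<bar>fst (p i) x\<bar> \<le> 2 * \<delta>" "\<And>i x. i \<in> Basis \<Longrightarrow> norm (fst (snd (p i)) x) \<le> snd (snd (p i))"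
      "\<And>i x. i \<in> Basis \<Longrightarrow> x \<in> K \<Longrightarrow> \<bar>inner (r x) i - fst (p i) x\<bar> < \<delta>' / (2 * n)" by auto
    define u where "u i = fst (p i)" for i
    define U where "U i = fst (snd (p i))" for i
    define B where "B = (\<Sum>i\<in>Basis. snd (snd (p i)))"
    have nn: "0 \<le> snd (snd (p i))" if "i \<in> Basis" for i using p(3)[OF that, of 0] norm_ge_zero order_trans by blast
    have u: "C1_gradient (u i) (U i)" "\<bar>u i x\<bar> \<le> 2 * \<delta>" "norm (U i x) \<le> B" if i: "i \<in> Basis" for i x
    proof -
      show "C1_gradient (u i) (U i)" "\<bar>u i x\<bar> \<le> 2 * \<delta>" using p(1,2) i by (auto simp: u_def U_def)
      have "norm (U i x) \<le> snd (snd (p i))" using p(3) i by (simp add: U_def)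
      also have "\<dots> \<le> B" unfolding B_def by (rule member_le_sum) (use i nn in auto)
      finally show "norm (U i x) \<le> B" .
    qed
    have ur: "\<bar>inner (r x) i - u i x\<bar> < \<delta>' / (2 * n)" if "i \<in> Basis" "x \<in> K" for i x using p(4) that by (simp add: u_def)
    have B0: "B \<ge> 0" unfolding B_def by (rule sum_nonneg) (use nn in auto)
    define e where "e = min \<delta> (\<delta>' / 2)"
    have e: "e > 0" unfolding e_def using \<delta> \<delta>' by simp
    \<comment> \<open>The frequency is chosen after the bound \<open>B\<close> on the gradients of
      the coefficients, so that the tail is at most \<open>e\<close>. The size and slope bound
      \<open>S\<close> of the profile does not depend on it.\<close>
    define l where "l = n * S * B / e + 1"
    have l: "l > 0" unfolding l_def using n S0 B0 e by (simp add: add_nonneg_pos)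
    have le: "n * (S / l * B) \<le> e"
    proof -
      have "n * S * B \<le> e * l" unfolding l_def using e by (simp add: field_simps)
      then show ?thesis using l by (simp add: field_simps)
    qed
    define bad where "bad i j = {x \<in> K. cos (l * inner x i - a j) > c0}" for i j
    have Kb: "K \<in> sets borel" using K by (simp add: compact_imp_closed borel_closed)
    have badb: "bad i j \<in> sets M" for i j
    proof -
      have "bad i j = K \<inter> {x. cos (l * inner x i - a j) > c0}" unfolding bad_def by auto
      moreover have "open {x. cos (l * inner x i - a j) > c0}"
        by (intro open_Collect_less continuous_intros)
      ultimately show ?thesis using Kb M(2) by auto
    qed
    \<comment> \<open>Pigeonhole: the sets \<open>bad i j\<close> are disjoint in \<open>j\<close>,
      so their measures cannot all exceed the average.\<close>
    have "\<exists>j<N. real N * measure M (bad i j) \<le> measure M UNIV" for i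
    proof (rule ccontr)
      assume "\<not> ?thesis"
      then have gt: "real N * measure M (bad i j) > measure M UNIV" if "j < N" for j using that by force
      have "(\<Sum>j<N. measure M (bad i j)) = measure M (\<Union>j<N. bad i j)"
      proof (rule finite_measure_finite_Union[symmetric])
        show "disjoint_family_on (bad i) {..<N}"
          unfolding disjoint_family_on_def bad_def using a by auto
      qed (use badb in auto)
      also have "\<dots> \<le> measure M UNIV"
        by (rule finite_measure_mono) (use M(2) in auto)
      finally have "real N * (\<Sum>j<N. measure M (bad i j)) \<le> real N * measure M UNIV" by (simp add: mult_left_mono)
      moreover have "(\<Sum>j<N. real N * measure M (bad i j)) > (\<Sum>j<N. measure M UNIV)"
        by (rule sum_strict_mono) (use gt Npos in auto)
      ultimately show False by (simp add: sum_distrib_left)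
    qed
    then obtain J where J: "\<And>i. J i < N" "\<And>i. real N * measure M (bad i (J i)) \<le> measure M UNIV" by metis
    define \<sigma> where "\<sigma> i x = (1 / l) * s (l * inner x i - a (J i))" for i and x :: 'a
    define Q where "Q i x = q (l * inner x i - a (J i))" for i and x :: 'a
    have \<sigma>: "C1_gradient (\<sigma> i) (\<lambda>x. Q i x *\<^sub>R i)" for i
    proof -
      have "C1_gradient (\<lambda>x. (1 / l) * s (l * inner x i - a (J i))) (\<lambda>x. ((1 / l) * q (l * inner x i - a (J i))) *\<^sub>R (l *\<^sub>R i))"
      proof (rule C1_gradient_compose[OF C1_gradient_affine])
        show "((\<lambda>t. (1 / l) * s t) has_real_derivative (1 / l) * q t) (at t)" for t by (rule DERIV_cmult[OF sq(1)])
        show "continuous_on UNIV (\<lambda>t. (1 / l) * q t)" by (intro continuous_intros sq(2))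
      qed
      then show ?thesis unfolding \<sigma>_def Q_def using l by simp
    qed
    define g where "g x = (\<Sum>i\<in>Basis. u i x * \<sigma> i x)" for x
    define G where "G x = (\<Sum>i\<in>Basis. u i x *\<^sub>R (Q i x *\<^sub>R i) + \<sigma> i x *\<^sub>R U i x)" for x
    have gG: "C1_gradient g G" unfolding g_def[abs_def] G_def[abs_def]
      by (intro C1_gradient_sum C1_gradient_mult u \<sigma>) auto
    have \<sigma>b: "\<bar>\<sigma> i x\<bar> \<le> S / l" for i x
      unfolding \<sigma>_def using Sb(1) l by (simp add: abs_mult divide_right_mono)
    have sU: "norm (\<sigma> i x *\<^sub>R U i x) \<le> S / l * B" if "i \<in> Basis" for i x
      unfolding norm_scaleR using \<sigma>b u(3)[OF that] S0 l by (intro mult_mono) auto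
    have tail: "norm (\<Sum>i\<in>Basis. \<sigma> i x *\<^sub>R U i x) \<le> e" for x
    proof -
      have "norm (\<Sum>i\<in>Basis. \<sigma> i x *\<^sub>R U i x) \<le> (\<Sum>i\<in>(Basis::'a set). S / l * B)"
        by (rule sum_norm_le) (rule sU)
      also have "\<dots> = n * (S / l * B)" by (simp add: n_def)
      finally show ?thesis using le by linarith
    qed
    have Gsplit: "G x = (\<Sum>i\<in>Basis. (u i x * Q i x) *\<^sub>R i) + (\<Sum>i\<in>Basis. \<sigma> i x *\<^sub>R U i x)" for x
      unfolding G_def by (simp add: sum.distrib)
    have "norm (G x) \<le> C * \<delta>" for x
    proof -
      have "norm (\<Sum>i\<in>Basis. (u i x * Q i x) *\<^sub>R i) \<le> (\<Sum>i\<in>(Basis::'a set). 2 * \<delta> * S)"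
      proof (rule sum_norm_le)
        fix i :: 'a assume i: "i \<in> Basis"
        have "\<bar>u i x\<bar> * \<bar>Q i x\<bar> \<le> 2 * \<delta> * S"
          using u(2)[OF i] Sb(2) \<delta> unfolding Q_def by (intro mult_mono) auto
        then show "norm ((u i x * Q i x) *\<^sub>R i) \<le> 2 * \<delta> * S" using i by (simp add: abs_mult)
      qed
      also have "\<dots> = 2 * n * S * \<delta>" by (simp add: n_def)
      finally have "norm (G x) \<le> 2 * n * S * \<delta> + e"
        unfolding Gsplit using tail[of x] norm_triangle_ineq[of "\<Sum>i\<in>Basis. (u i x * Q i x) *\<^sub>R i" "\<Sum>i\<in>Basis. \<sigma> i x *\<^sub>R U i x"] by linarith
      moreover have "e \<le> \<delta>" unfolding e_def by simp
      ultimately show ?thesis by (simp add: C_def algebra_simps)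
    qed
    moreover define K' where "K' = K \<inter> (\<Inter>i\<in>Basis. {x. cos (l * inner x i - a (J i)) \<le> c0})"
    have "compact K'" unfolding K'_def
      by (intro compact_Int_closed K closed_INT ballI closed_Collect_le continuous_intros)
    moreover have "K' \<subseteq> K" unfolding K'_def by auto
    moreover have "measure M (K - K') < \<epsilon>"
    proof -
      have "measure M (K - K') \<le> measure M (\<Union>i\<in>Basis. bad i (J i))"
        by (rule finite_measure_mono) (use badb in \<open>auto simp: K'_def bad_def not_le\<close>)
      also have "\<dots> \<le> (\<Sum>i\<in>(Basis::'a set). measure M (bad i (J i)))"
        by (rule measure_UNION_le) (use badb in auto)
      also have "\<dots> \<le> (\<Sum>i\<in>(Basis::'a set). measure M UNIV / real N)"
        using J(2) Npos by (intro sum_mono) (simp add: field_simps)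
      also have "\<dots> = n * measure M UNIV / real N" by (simp add: n_def)
      also have "\<dots> < \<epsilon>" using N Npos \<epsilon> by (simp add: field_simps)
      finally show ?thesis .
    qed
    moreover have "norm (r x - G x) \<le> \<delta>'" if x: "x \<in> K'" for x
    proof -
      have Q1: "Q i x = 1" if "i \<in> Basis" for i unfolding Q_def by (rule q1) (use x that in \<open>auto simp: K'_def\<close>)
      have xK: "x \<in> K" using x by (auto simp: K'_def)
      have "r x - (\<Sum>i\<in>Basis. (u i x * Q i x) *\<^sub>R i) = (\<Sum>i\<in>Basis. (inner (r x) i - u i x) *\<^sub>R i)"
        using Q1 by (simp add: scaleR_diff_left sum_subtractf euclidean_representation)
      also have "norm \<dots> \<le> (\<Sum>i\<in>(Basis::'a set). \<delta>' / (2 * n))"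
        by (rule sum_norm_le) (use ur[OF _ xK] in \<open>auto intro: less_imp_le\<close>)
      also have "\<dots> = \<delta>' / 2" using n by (simp add: n_def)
      finally have "norm (r x - (\<Sum>i\<in>Basis. (u i x * Q i x) *\<^sub>R i)) \<le> \<delta>' / 2" .
      moreover have "r x - G x = (r x - (\<Sum>i\<in>Basis. (u i x * Q i x) *\<^sub>R i)) - (\<Sum>i\<in>Basis. \<sigma> i x *\<^sub>R U i x)"
        unfolding Gsplit by simp
      moreover have "e \<le> \<delta>' / 2" unfolding e_def by simp
      ultimately show ?thesis
        using tail[of x] norm_triangle_ineq4[of "r x - (\<Sum>i\<in>Basis. (u i x * Q i x) *\<^sub>R i)" "\<Sum>i\<in>Basis. \<sigma> i x *\<^sub>R U i x"]
        by (metis (no_types, lifting) add_mono field_sum_of_halves order_trans)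
    qed
    ultimately show "\<exists>g G K'. C1_gradient g G \<and> (\<forall>x. norm (G x) \<le> C * \<delta>) \<and> compact K' \<and> K' \<subseteq> K \<and>
        measure M (K - K') < \<epsilon> \<and> (\<forall>x\<in>K'. norm (r x - G x) \<le> \<delta>')" using gG by blast
  qed
qed

lemma C1_gradient_series:
  fixes G :: "nat \<Rightarrow> 'a::euclidean_space \<Rightarrow> 'a"
  assumes g: "\<And>k. C1_gradient (g k) (G k)" and b: "\<And>k x. norm (G k x) \<le> b k" and sb: "summable b"
  obtains h where "C1_gradient h (\<lambda>x. \<Sum>k. G k x)"
proof -
  define S where "S x = (\<Sum>k. G k x)" for x
  have ul: "uniform_limit UNIV (\<lambda>n x. \<Sum>k<n. G k x) S sequentially"
    unfolding S_def[abs_def] by (rule Weierstrass_m_test[OF _ sb]) (use b in auto)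
  have "continuous_on UNIV S"
    by (rule uniform_limit_theorem[OF _ ul])
       (use g in \<open>auto intro!: always_eventually continuous_intros simp: C1_gradient_def\<close>)
  moreover
  \<comment> \<open>Only the gradients are summable. Subtracting the values at 0 makes the series of
    potentials converge at that point, and the uniform convergence of the derivatives then gives it
    everywhere.\<close>
  have "\<exists>h. \<forall>x\<in>UNIV. (\<lambda>n. g n x - g n 0) sums h x \<and> (h has_derivative (\<lambda>v. inner (S x) v)) (at x within UNIV)"
  proof (rule has_derivative_series[where f' = "\<lambda>k x v. inner (G k x) v" and x = 0 and l = 0])
    show "((\<lambda>x. g n x - g n 0) has_derivative (\<lambda>v. inner (G n x) v)) (at x)" for n x
      using g[of n] unfolding C1_gradient_def by (auto intro!: derivative_eq_intros)
    show "\<forall>\<^sub>F n in sequentially. \<forall>x\<in>UNIV. \<forall>h. norm ((\<Sum>i<n. inner (G i x) h) - inner (S x) h) \<le> e * norm h"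
      if "e > 0" for e
    proof -
      have "\<forall>\<^sub>F n in sequentially. \<forall>x\<in>UNIV. dist (\<Sum>k<n. G k x) (S x) < e"
        using ul that unfolding uniform_limit_iff by blast
      then show ?thesis
      proof eventually_elim
        case (elim n)
        show ?case
        proof (intro ballI allI)
          fix x h
          have "norm ((\<Sum>i<n. inner (G i x) h) - inner (S x) h) = \<bar>inner ((\<Sum>k<n. G k x) - S x) h\<bar>"
            by (simp add: inner_diff_left inner_sum_left)
          also have "\<dots> \<le> norm ((\<Sum>k<n. G k x) - S x) * norm h" by (rule Cauchy_Schwarz_ineq2)
          also have "\<dots> \<le> e * norm h"
            using elim by (intro mult_right_mono) (auto simp: dist_norm intro: less_imp_le)
          finally show "norm ((\<Sum>i<n. inner (G i x) h) - inner (S x) h) \<le> e * norm h" .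
        qed
      qed
    qed
  qed auto
  ultimately show thesis using that unfolding C1_gradient_def S_def by auto
qed

text \<open>The step is applied again to what remains of the field. Its constants \<open>C k\<close>
  are known in advance, so the sizes \<open>\<delta> k\<close> can be fixed beforehand, and each
  remainder is made small enough to be cheap in the following step. The gradients and the losses of
  measure both sum geometrically.\<close>

lemma small_field_is_gradient:
  fixes M :: "'a::euclidean_space measure"
  assumes M: "finite_measure M" "sets M = sets borel" and \<epsilon>: "(\<epsilon>::real) > 0" and \<theta>: "(\<theta>::real) > 0"
  obtains \<delta> :: real where "\<delta> > 0"
    "\<And>(K::'a set) r. compact K \<Longrightarrow> continuous_on K r \<Longrightarrow> (\<And>x. x \<in> K \<Longrightarrow> norm (r x) \<le> \<delta>) \<Longrightarrow>
      \<exists>g G K'. C1_gradient g G \<and> (\<forall>x. norm (G x) \<le> \<theta>) \<and> compact K' \<and> K' \<subseteq> K \<and>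
        measure M (K - K') < \<epsilon> \<and> (\<forall>x\<in>K'. G x = r x)"
proof -
  interpret finite_measure M by fact
  define \<epsilon>k where "\<epsilon>k k = \<epsilon> * (1/2)^(k+2)" for k :: nat
  have \<epsilon>k: "\<epsilon>k k > 0" for k unfolding \<epsilon>k_def using \<epsilon> by simp
  define P where "P k C \<longleftrightarrow> C > 0 \<and> (\<forall>(K::'a set) r \<delta> \<delta>'. compact K \<longrightarrow> continuous_on K r \<longrightarrow> 0 < \<delta> \<longrightarrow> (\<forall>x\<in>K. norm (r x) \<le> \<delta>) \<longrightarrow> 0 < \<delta>' \<longrightarrow>
      (\<exists>g G K'. C1_gradient g G \<and> (\<forall>x. norm (G x) \<le> C * \<delta>) \<and> compact K' \<and> K' \<subseteq> K \<and>
        measure M (K - K') < \<epsilon>k k \<and> (\<forall>x\<in>K'. norm (r x - G x) \<le> \<delta>')))" for k C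
  have "\<exists>C. P k C" for k
    by (rule gradient_step[OF M \<epsilon>k[of k]]) (auto simp: P_def)
  then obtain C where CP: "\<And>k. P k (C k)" by metis
  have C: "C k > 0" for k using CP[of k] unfolding P_def by blast
  \<comment> \<open>Makes the gradient of step \<open>k\<close> at most
    \<open>\<theta> * (1/2)^(k+1)\<close>, and these bounds sum to \<theta>.\<close>
  define \<delta> where "\<delta> k = \<theta> * (1/2)^(k+1) / C k" for k
  have \<delta>: "\<delta> k > 0" for k unfolding \<delta>_def using \<theta> C by simp
  have C\<delta>: "C k * \<delta> k = \<theta> * (1/2)^(k+1)" for k unfolding \<delta>_def using C[of k] by simp
  \<comment> \<open>The tolerance meets two demands: \<open>\<delta> (Suc k)\<close> is the entry
    size of the next step, and \<open>(1/2)^k\<close> forces the remainders to 0, so that the limit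
    is exact.\<close>
  have step: "\<exists>g G K'. C1_gradient g G \<and> (\<forall>x. norm (G x) \<le> C k * \<delta> k) \<and> compact K' \<and> K' \<subseteq> K \<and>
        measure M (K - K') < \<epsilon>k k \<and> (\<forall>x\<in>K'. norm (r x - G x) \<le> min (\<delta> (Suc k)) ((1/2)^k))"
    if "compact K" "continuous_on K r" "\<forall>x\<in>K. norm (r x) \<le> \<delta> k" for k and K :: "'a set" and r
    by (rule CP[of k, unfolded P_def, THEN conjunct2, rule_format]) (use that \<delta>[of k] \<delta>[of "Suc k"] in auto)
  show thesis
  proof (rule that[OF \<delta>[of 0]])
    fix K0 :: "'a set" and r0 :: "'a \<Rightarrow> 'a"
    assume K0: "compact K0" "continuous_on K0 r0" "\<And>x. x \<in> K0 \<Longrightarrow> norm (r0 x) \<le> \<delta> 0"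
    \<comment> \<open>A state is a compact set with the field still to be realised on it. The clause
      for \<open>k = 0\<close> pins the initial state, which dependent choice alone would leave
      free.\<close>
    define St where "St k x \<longleftrightarrow> compact (fst x) \<and> continuous_on (fst x) (snd x) \<and> (\<forall>y\<in>fst x. norm (snd x y) \<le> \<delta> k) \<and> (k = 0 \<longrightarrow> x = (K0, r0))"
      for k and x :: "'a set \<times> ('a \<Rightarrow> 'a)"
    define Tr where "Tr k x x' \<longleftrightarrow> (\<exists>g G. C1_gradient g G \<and> (\<forall>y. norm (G y) \<le> C k * \<delta> k) \<and> fst x' \<subseteq> fst x \<and>
      measure M (fst x - fst x') < \<epsilon>k k \<and> snd x' = (\<lambda>y. snd x y - G y) \<and> (\<forall>y\<in>fst x'. norm (snd x' y) \<le> (1/2)^k))"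
      for k and x x' :: "'a set \<times> ('a \<Rightarrow> 'a)"
    have "\<exists>f. \<forall>k. St k (f k) \<and> Tr k (f k) (f (Suc k))"
    proof (rule dependent_nat_choice)
      show "\<exists>x. St 0 x" unfolding St_def using K0 by (intro exI[of _ "(K0, r0)"]) simp
      fix x k assume "St k x"
      then have x: "compact (fst x)" "continuous_on (fst x) (snd x)" "\<forall>y\<in>fst x. norm (snd x y) \<le> \<delta> k"
        unfolding St_def by auto
      from step[OF this] obtain g G K' where G: "C1_gradient g G" "\<forall>y. norm (G y) \<le> C k * \<delta> k" "compact K'" "K' \<subseteq> fst x"
        "measure M (fst x - K') < \<epsilon>k k" "\<forall>y\<in>K'. norm (snd x y - G y) \<le> min (\<delta> (Suc k)) ((1/2)^k)" by blast
      have "continuous_on K' (\<lambda>y. snd x y - G y)"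
        using continuous_on_subset[OF x(2) G(4)] G(1) unfolding C1_gradient_def
        by (intro continuous_intros) (auto intro: continuous_on_subset)
      then have "St (Suc k) (K', \<lambda>y. snd x y - G y)" unfolding St_def using G by simp
      moreover have "Tr k x (K', \<lambda>y. snd x y - G y)" unfolding Tr_def using G by auto
      ultimately show "\<exists>y. St (Suc k) y \<and> Tr k x y" by blast
    qed
    then obtain f where f: "\<And>k. St k (f k)" "\<And>k. Tr k (f k) (f (Suc k))" by blast
    have f0: "f 0 = (K0, r0)" using f(1)[of 0] unfolding St_def by simp
    define K where "K k = fst (f k)" for k
    define r where "r k = snd (f k)" for k
    have "\<forall>k. \<exists>p. C1_gradient (fst p) (snd p) \<and> (\<forall>y. norm (snd p y) \<le> C k * \<delta> k) \<and> K (Suc k) \<subseteq> K k \<and>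
      measure M (K k - K (Suc k)) < \<epsilon>k k \<and> r (Suc k) = (\<lambda>y. r k y - snd p y) \<and> (\<forall>y\<in>K (Suc k). norm (r (Suc k) y) \<le> (1/2)^k)"
      using f(2) unfolding Tr_def K_def r_def by simp
    from choice[OF this] obtain p where
      pp: "\<forall>k. C1_gradient (fst (p k)) (snd (p k)) \<and> (\<forall>y. norm (snd (p k) y) \<le> C k * \<delta> k) \<and> K (Suc k) \<subseteq> K k \<and>
      measure M (K k - K (Suc k)) < \<epsilon>k k \<and> r (Suc k) = (\<lambda>y. r k y - snd (p k) y) \<and> (\<forall>y\<in>K (Suc k). norm (r (Suc k) y) \<le> (1/2)^k)" ..
    have p: "\<And>k. C1_gradient (fst (p k)) (snd (p k))" "\<And>k y. norm (snd (p k) y) \<le> C k * \<delta> k"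
      "\<And>k. K (Suc k) \<subseteq> K k" "\<And>k. measure M (K k - K (Suc k)) < \<epsilon>k k" "\<And>k. r (Suc k) = (\<lambda>y. r k y - snd (p k) y)"
      "\<And>k y. y \<in> K (Suc k) \<Longrightarrow> norm (r (Suc k) y) \<le> (1/2)^k" using pp by blast+
    have Kc: "compact (K k)" for k using f(1)[of k] unfolding St_def K_def by simp
    have sums: "(\<lambda>k. c * (1/2)^(k+1)) sums c" for c :: real
    proof -
      have "(\<lambda>k. (c/2) * (1/2)^k) sums ((c/2) * (1 / (1 - 1/2)))" by (intro sums_mult geometric_sums) simp
      then show ?thesis by simp
    qed
    have pb: "norm (snd (p k) y) \<le> \<theta> * (1/2)^(k+1)" for k y using p(2)[of k y] unfolding C\<delta> .
    define G where "G x = (\<Sum>k. snd (p k) x)" for x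
    obtain h where h: "C1_gradient h G"
      using C1_gradient_series[of "\<lambda>k. fst (p k)" "\<lambda>k. snd (p k)", OF p(1) pb sums_summable[OF sums]]
      unfolding G_def[abs_def] by blast
    have sn: "summable (\<lambda>k. norm (snd (p k) x))" for x
      by (rule summable_comparison_test[OF _ sums_summable[OF sums[of \<theta>]]]) (use pb in auto)
    have Gb: "norm (G x) \<le> \<theta>" for x
    proof -
      have "norm (G x) \<le> (\<Sum>k. norm (snd (p k) x))" unfolding G_def by (rule summable_norm[OF sn])
      also have "\<dots> \<le> (\<Sum>k. \<theta> * (1/2)^(k+1))" by (rule suminf_le[OF pb sn sums_summable[OF sums]])
      also have "\<dots> = \<theta>" using sums[of \<theta>] by (simp add: sums_iff)
      finally show ?thesis .
    qed
    define K' where "K' = (\<Inter>k. K k)"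
    have K'c: "compact K'" unfolding K'_def by (rule compact_Inter) (use Kc in auto)
    have K0eq: "K 0 = K0" "r 0 = r0" using f0 by (simp_all add: K_def r_def)
    have K'0: "K' \<subseteq> K0" using K0eq unfolding K'_def by auto
    have rk: "r k x = r0 x - (\<Sum>j<k. snd (p j) x)" for k x
      by (induction k) (simp_all add: K0eq p(5))
    have Geq: "G x = r0 x" if x: "x \<in> K'" for x
    proof -
      have "(\<lambda>k. r (Suc k) x) \<longlonglongrightarrow> 0"
      proof (rule Lim_null_comparison)
        show "\<forall>\<^sub>F k in sequentially. norm (r (Suc k) x) \<le> (1/2)^k"
          using p(6) x unfolding K'_def by auto
        show "(\<lambda>k. (1/2::real)^k) \<longlonglongrightarrow> 0" by (rule LIMSEQ_realpow_zero) auto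
      qed
      then have "(\<lambda>k. r k x) \<longlonglongrightarrow> 0" by (rule LIMSEQ_imp_Suc)
      then have "(\<lambda>k. r0 x - r k x) \<longlonglongrightarrow> r0 x - 0" by (intro tendsto_intros)
      then have "(\<lambda>k. \<Sum>j<k. snd (p j) x) \<longlonglongrightarrow> r0 x" unfolding rk by simp
      moreover have "(\<lambda>k. \<Sum>j<k. snd (p j) x) \<longlonglongrightarrow> G x"
        unfolding G_def using summable_LIMSEQ[OF summable_norm_cancel[OF sn]] .
      ultimately show ?thesis using LIMSEQ_unique by blast
    qed
    have "measure M (K0 - K') < \<epsilon>"
    proof -
      define W where "W k = K k - K (Suc k)" for k
      have Wb: "W k \<in> sets M" for k unfolding W_def M(2)
        using Kc by (intro sets.Diff) (auto simp: compact_imp_closed borel_closed)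
      have sume: "(\<lambda>k. \<epsilon>k k) sums (\<epsilon> / 2)" using sums[of "\<epsilon>/2"] by (simp add: \<epsilon>k_def)
      have Wm: "measure M (W k) \<le> \<epsilon>k k" for k unfolding W_def using p(4) by (rule less_imp_le)
      have summ: "summable (\<lambda>k. measure M (W k))"
        by (rule summable_comparison_test[OF _ sums_summable[OF sume]]) (use Wm in auto)
      have "K0 - K' \<subseteq> (\<Union>k. W k)"
      proof
        fix x assume x: "x \<in> K0 - K'"
        then have ex: "\<exists>k. x \<notin> K k" unfolding K'_def by auto
        define m where "m = (LEAST k. x \<notin> K k)"
        have m: "x \<notin> K m" unfolding m_def by (rule LeastI_ex[OF ex])
        then obtain l where l: "m = Suc l" using x K0eq by (cases m) auto
        then have "x \<in> K l" using not_less_Least[of l "\<lambda>k. x \<notin> K k"] unfolding m_def by auto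
        then show "x \<in> (\<Union>k. W k)" using m l unfolding W_def by auto
      qed
      then have "measure M (K0 - K') \<le> measure M (\<Union>k. W k)"
        by (rule finite_measure_mono) (use Wb in auto)
      also have "\<dots> \<le> (\<Sum>k. measure M (W k))"
        by (rule finite_measure_subadditive_countably) (use Wb summ in auto)
      also have "\<dots> \<le> (\<Sum>k. \<epsilon>k k)" by (rule suminf_le[OF Wm summ sums_summable[OF sume]])
      also have "\<dots> = \<epsilon> / 2" using sume by (simp add: sums_iff)
      finally show ?thesis using \<epsilon> by simp
    qed
    then show "\<exists>g G K'. C1_gradient g G \<and> (\<forall>x. norm (G x) \<le> \<theta>) \<and> compact K' \<and> K' \<subseteq> K0 \<and>
        measure M (K0 - K') < \<epsilon> \<and> (\<forall>x\<in>K'. G x = r0 x)"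
      using h Gb K'c K'0 Geq by blast
  qed
qed

section \<open>Divergence-free measures and the decomposability bundle\<close>

lemma finite_density_exists:
  fixes lam \<nu> :: "'a::euclidean_space measure"
  assumes lam: "finite_measure lam" "sets lam = sets borel" and \<nu>: "finite_measure \<nu>" "sets \<nu> = sets borel"
    and ac: "\<And>N. N \<in> null_sets lam \<Longrightarrow> emeasure \<nu> N = 0"
  obtains k where "k \<in> borel_measurable borel" "\<And>x. 0 \<le> k x" "integrable lam k"
    "\<nu> = density lam (\<lambda>x. ennreal (k x))"
proof -
  interpret lam: finite_measure lam by fact
  interpret \<nu>: finite_measure \<nu> by fact
  have ac': "absolutely_continuous lam \<nu>" unfolding absolutely_continuous_def
    using ac lam \<nu> by (auto simp: null_sets_def)
  have seq: "sets \<nu> = sets lam" using lam \<nu> by simp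
  obtain k where k: "k \<in> borel_measurable lam" "AE x in lam. RN_deriv lam \<nu> x = ennreal (k x)" "\<And>x. 0 \<le> k x"
    using lam.real_RN_deriv[OF \<nu>(1) ac' seq] by metis
  have eq: "\<nu> = density lam (\<lambda>x. ennreal (k x))"
    using lam.density_RN_deriv[OF ac' seq] density_cong[OF _ _ k(2)] k(1) by simp
  have "emeasure \<nu> (space lam) = (\<integral>\<^sup>+x. ennreal (k x) \<partial>lam)"
    unfolding eq using k(1) by (subst emeasure_density) (auto intro!: nn_integral_cong)
  then have "(\<integral>\<^sup>+x. ennreal (k x) \<partial>lam) \<noteq> \<infinity>" using \<nu>.emeasure_finite[of "space lam"] by simp
  then have "integrable lam k" using k by (intro integrableI_nonneg) (auto simp: less_top)
  moreover have "k \<in> borel_measurable borel" using k(1) lam(2) measurable_cong_sets by blast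
  ultimately show thesis using that k(3) eq by blast
qed

text \<open>\<open>b\<close> is the Radon-Nikodym density of the image under \<open>P\<close> of the
  measure with density \<open>g\<close>. This brings measures on an auxiliary space of points,
  directions and tags back to the Euclidean space.\<close>

lemma scalar_disintegration:
  fixes \<pi> :: "'c measure" and lam :: "'a::euclidean_space measure" and P :: "'c \<Rightarrow> 'a" and g :: "'c \<Rightarrow> real"
  assumes \<pi>: "finite_measure \<pi>" and lam: "finite_measure lam" "sets lam = sets borel"
    and P: "P \<in> measurable \<pi> borel" and g: "g \<in> borel_measurable \<pi>" "\<And>z. 0 \<le> g z" "\<And>z. g z \<le> B"
    and ac: "\<And>N. N \<in> null_sets lam \<Longrightarrow> emeasure \<pi> (P -` N \<inter> space \<pi>) = 0"
  obtains b where "b \<in> borel_measurable borel" "integrable lam b"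
    "\<And>v. v \<in> borel_measurable borel \<Longrightarrow> (\<integral>z. v (P z) * g z \<partial>\<pi>) = (\<integral>x. v x * b x \<partial>lam)"
proof -
  interpret \<pi>: finite_measure \<pi> by fact
  define \<rho> where "\<rho> = density \<pi> (\<lambda>z. ennreal (g z))"
  have P': "P \<in> measurable \<rho> borel" unfolding \<rho>_def using P by simp
  define \<nu> where "\<nu> = distr \<rho> borel P"
  have \<nu>s: "sets \<nu> = sets borel" unfolding \<nu>_def by simp
  have \<rho>f: "finite_measure \<rho>"
  proof
    have "emeasure \<rho> (space \<rho>) = (\<integral>\<^sup>+z. ennreal (g z) \<partial>\<pi>)"
      unfolding \<rho>_def using g(1) by (simp add: emeasure_density cong: nn_integral_cong_simp)
    also have "\<dots> \<le> (\<integral>\<^sup>+z. ennreal B \<partial>\<pi>)" using g(3) by (intro nn_integral_mono ennreal_leI)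
    also have "\<dots> < \<infinity>" using \<pi>.emeasure_finite[of "space \<pi>"] by (simp add: ennreal_mult_eq_top_iff less_top[symmetric])
    finally show "emeasure \<rho> (space \<rho>) \<noteq> \<infinity>" by simp
  qed
  have \<nu>f: "finite_measure \<nu>" unfolding \<nu>_def using finite_measure.finite_measure_distr[OF \<rho>f P'] .
  have "emeasure \<nu> N = 0" if N: "N \<in> null_sets lam" for N
  proof -
    have Nb: "N \<in> sets borel" using N lam(2) by auto
    have "P -` N \<inter> space \<pi> \<in> null_sets \<pi>" using ac[OF N] measurable_sets[OF P Nb] by auto
    then have "P -` N \<inter> space \<pi> \<in> null_sets \<rho>"
      unfolding \<rho>_def using absolutely_continuousI_density[of "\<lambda>z. ennreal (g z)" \<pi>] g(1)
      by (auto simp: absolutely_continuous_def)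
    moreover have "space \<rho> = space \<pi>" unfolding \<rho>_def by simp
    ultimately show ?thesis unfolding \<nu>_def using emeasure_distr[OF P' Nb] by auto
  qed
  then obtain b where b: "b \<in> borel_measurable borel" "\<And>x. 0 \<le> b x" "integrable lam b"
    "\<nu> = density lam (\<lambda>x. ennreal (b x))"
    using finite_density_exists[OF lam \<nu>f \<nu>s] by metis
  have "(\<integral>z. v (P z) * g z \<partial>\<pi>) = (\<integral>x. v x * b x \<partial>lam)" if v: "v \<in> borel_measurable borel" for v
  proof -
    have vP: "(\<lambda>z. v (P z)) \<in> borel_measurable \<pi>" using measurable_compose[OF P v] .
    have v': "v \<in> borel_measurable lam" using v lam(2) measurable_cong_sets by blast
    have b': "b \<in> borel_measurable lam" using b lam(2) measurable_cong_sets by blast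
    have "(\<integral>x. v x * b x \<partial>lam) = (\<integral>x. v x \<partial>\<nu>)"
      unfolding b(4) by (subst integral_density) (use v' b' b(2) in \<open>auto simp: mult.commute\<close>)
    also have "\<dots> = (\<integral>z. v (P z) \<partial>\<rho>)" unfolding \<nu>_def by (rule integral_distr[OF P' v])
    also have "\<dots> = (\<integral>z. v (P z) * g z \<partial>\<pi>)"
      unfolding \<rho>_def by (subst integral_density) (use vP g in \<open>auto simp: mult.commute\<close>)
    finally show ?thesis by simp
  qed
  then show thesis using that b by blast
qed

text \<open>Applied to the positive and negative parts of the coordinates of \<open>g\<close>. The
  test field \<open>u\<close> may be any bounded Borel field, because the orthogonality to the
  bundle will later be tested with a discontinuous one.\<close>

lemma vector_disintegration:
  fixes \<pi> :: "'c measure" and lam :: "'a::euclidean_space measure" and P :: "'c \<Rightarrow> 'a" and g :: "'c \<Rightarrow> 'a"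
  assumes \<pi>: "finite_measure \<pi>" and lam: "finite_measure lam" "sets lam = sets borel"
    and P: "P \<in> measurable \<pi> borel" and g: "g \<in> borel_measurable \<pi>" "\<And>z. norm (g z) \<le> B"
    and ac: "\<And>N. N \<in> null_sets lam \<Longrightarrow> emeasure \<pi> (P -` N \<inter> space \<pi>) = 0"
  obtains b where "b \<in> borel_measurable borel" "integrable lam b"
    "\<And>u C. u \<in> borel_measurable borel \<Longrightarrow> (\<And>x. norm (u x) \<le> C) \<Longrightarrow>
       (\<integral>z. inner (u (P z)) (g z) \<partial>\<pi>) = (\<integral>x. inner (u x) (b x) \<partial>lam)"
proof -
  interpret \<pi>: finite_measure \<pi> by fact
  have gi: "\<bar>inner (g z) i\<bar> \<le> B" if "i \<in> Basis" for z i
    using Basis_le_norm[OF that, of "g z"] g(2)[of z] by linarith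
  have one: "\<exists>b. b \<in> borel_measurable borel \<and> integrable lam b \<and>
      (\<forall>v. v \<in> borel_measurable borel \<longrightarrow> (\<integral>z. v (P z) * max 0 (c * inner (g z) i) \<partial>\<pi>) = (\<integral>x. v x * b x \<partial>lam))"
    if i: "i \<in> Basis" and c: "\<bar>c\<bar> = 1" for i and c :: real
  proof -
    have "max 0 (c * inner (g z) i) \<le> B" for z
      using gi[OF i, of z] c by (auto simp: abs_if split: if_splits)
    then obtain b where "b \<in> borel_measurable borel" "integrable lam b"
      "\<And>v. v \<in> borel_measurable borel \<Longrightarrow> (\<integral>z. v (P z) * max 0 (c * inner (g z) i) \<partial>\<pi>) = (\<integral>x. v x * b x \<partial>lam)"
      using scalar_disintegration[OF \<pi> lam P, of "\<lambda>z. max 0 (c * inner (g z) i)" B] g(1) ac by auto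
    then show ?thesis by blast
  qed
  have "\<forall>i\<in>Basis. \<exists>b. b \<in> borel_measurable borel \<and> integrable lam b \<and>
      (\<forall>v. v \<in> borel_measurable borel \<longrightarrow> (\<integral>z. v (P z) * max 0 (1 * inner (g z) i) \<partial>\<pi>) = (\<integral>x. v x * b x \<partial>lam))"
    using one[of _ 1] by simp
  from bchoice[OF this] obtain bp where bp: "\<And>i. i \<in> Basis \<Longrightarrow> bp i \<in> borel_measurable borel" "\<And>i. i \<in> Basis \<Longrightarrow> integrable lam (bp i)"
    "\<And>i v. i \<in> Basis \<Longrightarrow> v \<in> borel_measurable borel \<Longrightarrow> (\<integral>z. v (P z) * max 0 (1 * inner (g z) i) \<partial>\<pi>) = (\<integral>x. v x * bp i x \<partial>lam)"
    by blast
  have "\<forall>i\<in>Basis. \<exists>b. b \<in> borel_measurable borel \<and> integrable lam b \<and>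
      (\<forall>v. v \<in> borel_measurable borel \<longrightarrow> (\<integral>z. v (P z) * max 0 (-1 * inner (g z) i) \<partial>\<pi>) = (\<integral>x. v x * b x \<partial>lam))"
    using one[of _ "-1"] by simp
  from bchoice[OF this] obtain bm where bm: "\<And>i. i \<in> Basis \<Longrightarrow> bm i \<in> borel_measurable borel" "\<And>i. i \<in> Basis \<Longrightarrow> integrable lam (bm i)"
    "\<And>i v. i \<in> Basis \<Longrightarrow> v \<in> borel_measurable borel \<Longrightarrow> (\<integral>z. v (P z) * max 0 (-1 * inner (g z) i) \<partial>\<pi>) = (\<integral>x. v x * bm i x \<partial>lam)"
    by blast
  define b where "b x = (\<Sum>i\<in>Basis. (bp i x - bm i x) *\<^sub>R i)" for x
  have bmeas: "b \<in> borel_measurable borel" unfolding b_def[abs_def]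
    using bp(1) bm(1) by (intro borel_measurable_sum borel_measurable_scaleR borel_measurable_diff) auto
  have bint: "integrable lam b" unfolding b_def[abs_def]
    using bp(2) bm(2) by (intro Bochner_Integration.integrable_sum integrable_scaleR_left Bochner_Integration.integrable_diff) auto
  have "(\<integral>z. inner (u (P z)) (g z) \<partial>\<pi>) = (\<integral>x. inner (u x) (b x) \<partial>lam)"
    if u: "u \<in> borel_measurable borel" and uC: "\<And>x. norm (u x) \<le> C" for u C
  proof -
    have ui: "(\<lambda>x. inner (u x) i) \<in> borel_measurable borel" for i using u by measurable
    have uPm: "(\<lambda>z. inner (u (P z)) i) \<in> borel_measurable \<pi>" for i using measurable_compose[OF P ui] .
    have uib: "\<bar>inner (u x) i\<bar> \<le> C" if "i \<in> Basis" for x i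
      using Basis_le_norm[OF that, of "u x"] uC[of x] by linarith
    have C0: "C \<ge> 0" using uC[of 0] norm_ge_zero order_trans by blast
    have intp: "integrable \<pi> (\<lambda>z. inner (u (P z)) i * max 0 (c * inner (g z) i))" if i: "i \<in> Basis" and c: "\<bar>c\<bar> = 1" for i and c :: real
    proof (rule \<pi>.integrable_const_bound[of _ "C * B"])
      show "(\<lambda>z. inner (u (P z)) i * max 0 (c * inner (g z) i)) \<in> borel_measurable \<pi>"
        using uPm g(1) by measurable
      have "\<bar>inner (u (P z)) i\<bar> * \<bar>max 0 (c * inner (g z) i)\<bar> \<le> C * B" for z
        using uib[OF i, of "P z"] gi[OF i, of z] c C0 by (intro mult_mono) (auto simp: abs_if split: if_splits)
      then show "AE z in \<pi>. norm (inner (u (P z)) i * max 0 (c * inner (g z) i)) \<le> C * B" by (simp add: abs_mult)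
    qed
    have intb: "integrable lam (\<lambda>x. inner (u x) i * w x)" if i: "i \<in> Basis" and w: "integrable lam w" for i and w :: "'a \<Rightarrow> real"
    proof (rule Bochner_Integration.integrable_bound[OF integrable_mult_right[OF w, of C]])
      have "(\<lambda>x. inner (u x) i) \<in> borel_measurable lam" using ui lam(2) measurable_cong_sets by blast
      then show "(\<lambda>x. inner (u x) i * w x) \<in> borel_measurable lam" using w by measurable
      show "AE x in lam. norm (inner (u x) i * w x) \<le> norm (C * w x)"
        using uib[OF i] C0 by (auto simp: abs_mult intro!: mult_right_mono)
    qed
    have "(\<integral>z. inner (u (P z)) (g z) \<partial>\<pi>) = (\<integral>z. (\<Sum>i\<in>Basis. inner (u (P z)) i * max 0 (1 * inner (g z) i) - inner (u (P z)) i * max 0 (-1 * inner (g z) i)) \<partial>\<pi>)"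
    proof (rule Bochner_Integration.integral_cong[OF refl])
      fix z
      have m: "max 0 (1 * t) - max 0 (-1 * t) = t" for t :: real by (auto simp: max_def)
      show "inner (u (P z)) (g z) = (\<Sum>i\<in>Basis. inner (u (P z)) i * max 0 (1 * inner (g z) i) - inner (u (P z)) i * max 0 (-1 * inner (g z) i))"
        unfolding right_diff_distrib[symmetric] m by (rule euclidean_inner)
    qed
    also have "\<dots> = (\<Sum>i\<in>Basis. (\<integral>z. inner (u (P z)) i * max 0 (1 * inner (g z) i) \<partial>\<pi>) - (\<integral>z. inner (u (P z)) i * max 0 (-1 * inner (g z) i) \<partial>\<pi>))"
    proof -
      have "(\<integral>z. (\<Sum>i\<in>Basis. inner (u (P z)) i * max 0 (1 * inner (g z) i) - inner (u (P z)) i * max 0 (-1 * inner (g z) i)) \<partial>\<pi>)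
        = (\<Sum>i\<in>Basis. \<integral>z. inner (u (P z)) i * max 0 (1 * inner (g z) i) - inner (u (P z)) i * max 0 (-1 * inner (g z) i) \<partial>\<pi>)"
        by (rule Bochner_Integration.integral_sum) (intro Bochner_Integration.integrable_diff intp; simp)
      then show ?thesis
        by (simp only:) (intro sum.cong refl Bochner_Integration.integral_diff intp; simp)
    qed
    also have "\<dots> = (\<Sum>i\<in>Basis. (\<integral>x. inner (u x) i * bp i x \<partial>lam) - (\<integral>x. inner (u x) i * bm i x \<partial>lam))"
      using bp(3)[OF _ ui] bm(3)[OF _ ui] by (intro sum.cong refl arg_cong2[where f = "(-)"]) auto
    also have "\<dots> = (\<integral>x. (\<Sum>i\<in>Basis. inner (u x) i * bp i x - inner (u x) i * bm i x) \<partial>lam)"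
      using intb bp(2) bm(2) by (simp add: Bochner_Integration.integral_sum Bochner_Integration.integral_diff)
    also have "\<dots> = (\<integral>x. inner (u x) (b x) \<partial>lam)"
      by (intro Bochner_Integration.integral_cong refl) (simp add: b_def inner_sum_right right_diff_distrib mult.commute)
    finally show ?thesis .
  qed
  then show thesis using that[OF bmeas bint] by blast
qed

section \<open>Total variation and membership in the bundle\<close>

lemma sum_indicator_disjoint_le:
  assumes "finite P" "disjoint P" "\<And>A. A \<in> P \<Longrightarrow> A \<subseteq> B"
  shows "(\<Sum>A\<in>P. indicator A y) \<le> (indicator B y :: real)"
proof (cases "\<exists>A\<in>P. y \<in> A")
  case True
  then obtain A where A: "A \<in> P" "y \<in> A" by blast
  have "indicator A' y = (if A' = A then 1 else 0 :: real)" if "A' \<in> P" for A'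
    using that A assms(2) by (auto simp: disjoint_def indicator_def)
  then have "(\<Sum>A\<in>P. indicator A y) = (\<Sum>A'\<in>P. if A' = A then 1 else 0 :: real)" by (intro sum.cong) auto
  also have "\<dots> = 1" using A assms(1) by simp
  finally show ?thesis using A assms(3) by (auto simp: indicator_def)
next
  case False
  then have "(\<Sum>A\<in>P. indicator A y) = (0::real)" by (intro sum.neutral) auto
  then show ?thesis by simp
qed

text \<open>With respect to \<open>lam\<close>, the vector measure under \<open>tv\<close> has
  density \<open>\<tau> - k v\<close>, and its variation is bounded by the integral of the norm. The
  representation of \<mu> is asked only inside \<open>B\<close>, because later it is available only
  inside the open set \<Omega>.\<close>

lemma tv_le_integral:
  fixes lam :: "'a::euclidean_space measure" and \<tau> :: "'a \<Rightarrow> 'a"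
  assumes lam: "finite_measure lam" "sets lam = sets borel" and \<tau>: "integrable lam \<tau>" and k: "integrable lam k"
    and \<mu>: "\<And>A. A \<in> sets borel \<Longrightarrow> A \<subseteq> B \<Longrightarrow> measure \<mu> A = (\<integral>x. indicator A x * k x \<partial>lam)" and B: "B \<in> sets borel"
  shows "tv (\<lambda>E. set_lebesgue_integral lam E \<tau> - measure \<mu> E *\<^sub>R v) B
    \<le> ereal (\<integral>x. indicator B x * norm (\<tau> x - k x *\<^sub>R v) \<partial>lam)"
  unfolding tv_def
proof (rule Sup_least)
  fix s assume "s \<in> {ereal (\<Sum>A\<in>P. norm (set_lebesgue_integral lam A \<tau> - measure \<mu> A *\<^sub>R v)) | P.
    finite P \<and> disjoint P \<and> (\<forall>A\<in>P. A \<in> sets borel \<and> A \<subseteq> B)}"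
  then obtain P where s: "s = ereal (\<Sum>A\<in>P. norm (set_lebesgue_integral lam A \<tau> - measure \<mu> A *\<^sub>R v))"
    and P: "finite P" "disjoint P" "\<And>A. A \<in> P \<Longrightarrow> A \<in> sets borel" "\<And>A. A \<in> P \<Longrightarrow> A \<subseteq> B" by auto
  define w where "w x = \<tau> x - k x *\<^sub>R v" for x
  have w: "integrable lam w" unfolding w_def[abs_def] using \<tau> k by (intro Bochner_Integration.integrable_diff integrable_scaleR_left)
  have wn: "integrable lam (\<lambda>x. indicator A x * norm (w x))" if "A \<in> sets borel" for A
    using integrable_mult_indicator[of A lam "\<lambda>x. norm (w x)"] w that lam(2) by simp
  have each: "norm (set_lebesgue_integral lam A \<tau> - measure \<mu> A *\<^sub>R v) \<le> (\<integral>x. indicator A x * norm (w x) \<partial>lam)"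
    if A: "A \<in> P" for A
  proof -
    have Ab: "A \<in> sets lam" using P(3)[OF A] lam(2) by simp
    have i1: "integrable lam (\<lambda>x. indicator A x *\<^sub>R \<tau> x)" using integrable_mult_indicator[OF Ab \<tau>] .
    have i2: "integrable lam (\<lambda>x. indicator A x * k x)" using integrable_mult_indicator[OF Ab k] by simp
    have "measure \<mu> A *\<^sub>R v = (\<integral>x. (indicator A x * k x) *\<^sub>R v \<partial>lam)"
      unfolding \<mu>[OF P(3)[OF A] P(4)[OF A]] using i2 by simp
    then have "set_lebesgue_integral lam A \<tau> - measure \<mu> A *\<^sub>R v
        = (\<integral>x. indicator A x *\<^sub>R \<tau> x \<partial>lam) - (\<integral>x. (indicator A x * k x) *\<^sub>R v \<partial>lam)"
      unfolding set_lebesgue_integral_def by simp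
    also have "\<dots> = (\<integral>x. indicator A x *\<^sub>R \<tau> x - (indicator A x * k x) *\<^sub>R v \<partial>lam)"
      using i1 i2 by (intro Bochner_Integration.integral_diff[symmetric] integrable_scaleR_left)
    also have "\<dots> = (\<integral>x. indicator A x *\<^sub>R w x \<partial>lam)"
      by (intro Bochner_Integration.integral_cong refl) (simp add: w_def scaleR_diff_right)
    also have "norm \<dots> \<le> (\<integral>x. norm (indicator A x *\<^sub>R w x) \<partial>lam)" by (rule integral_norm_bound)
    also have "\<dots> = (\<integral>x. indicator A x * norm (w x) \<partial>lam)" by simp
    finally show ?thesis .
  qed
  have "(\<Sum>A\<in>P. norm (set_lebesgue_integral lam A \<tau> - measure \<mu> A *\<^sub>R v)) \<le> (\<Sum>A\<in>P. \<integral>x. indicator A x * norm (w x) \<partial>lam)"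
    by (rule sum_mono[OF each])
  also have "\<dots> = (\<integral>x. (\<Sum>A\<in>P. indicator A x * norm (w x)) \<partial>lam)"
    by (rule Bochner_Integration.integral_sum[symmetric]) (use wn P(3) in auto)
  also have "\<dots> \<le> (\<integral>x. indicator B x * norm (w x) \<partial>lam)"
  proof (rule integral_mono)
    show "integrable lam (\<lambda>x. \<Sum>A\<in>P. indicator A x * norm (w x))"
      by (rule Bochner_Integration.integrable_sum) (use wn P(3) in auto)
    show "integrable lam (\<lambda>x. indicator B x * norm (w x))" using wn B .
    show "(\<Sum>A\<in>P. indicator A x * norm (w x)) \<le> indicator B x * norm (w x)" for x
      unfolding sum_distrib_right[symmetric]
      by (rule mult_right_mono[OF sum_indicator_disjoint_le[OF P(1,2,4)]]) auto
  qed
  finally show "s \<le> ereal (\<integral>x. indicator B x * norm (\<tau> x - k x *\<^sub>R v) \<partial>lam)" unfolding s w_def by simp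
qed

lemma tv_nonneg: "0 \<le> tv \<nu> B"
  unfolding tv_def by (rule Sup_upper) (auto intro!: exI[of _ "{}"])

text \<open>At a common Lebesgue point of \<tau> and \<open>k\<close>, the difference
  \<open>\<tau> - k v\<close> vanishes at \<open>x\<close> and so is small in mean over small balls.
  Positivity of \<open>k x\<close> makes the \<mu>-measure of these balls at least
  \<open>k x / 2\<close> times their \<open>lam\<close>-measure, which turns smallness relative to
  \<open>lam\<close> into smallness relative to \<mu>.\<close>

lemma div_free_density_in_decomp_set:
  fixes lam \<mu> :: "'a::euclidean_space measure" and \<tau> :: "'a \<Rightarrow> 'a"
  assumes lam: "finite_measure lam" "sets lam = sets borel" and \<tau>: "integrable lam \<tau>" "div_free lam \<tau>"
    and k: "integrable lam k" and \<Omega>: "open \<Omega>"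
    and \<mu>: "\<And>A. A \<in> sets borel \<Longrightarrow> A \<subseteq> \<Omega> \<Longrightarrow> measure \<mu> A = (\<integral>x. indicator A x * k x \<partial>lam)"
  shows "AE x in lam. x \<in> \<Omega> \<longrightarrow> 0 < k x \<longrightarrow> (1 / k x) *\<^sub>R \<tau> x \<in> decomp_set \<mu> x"
  using Lebesgue_points[OF lam \<tau>(1)] Lebesgue_points[OF lam k]
proof eventually_elim
  case (elim x)
  interpret lam: finite_measure lam by fact
  show ?case
  proof (intro impI)
    assume x: "x \<in> \<Omega>" "0 < k x"
    define v where "v = (1 / k x) *\<^sub>R \<tau> x"
    have v: "\<tau> x = k x *\<^sub>R v" using x(2) by (simp add: v_def)
    obtain d where d: "d > 0" "ball x d \<subseteq> \<Omega>" using \<Omega> x(1) open_contains_ball by blast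
    let ?T = "\<lambda>r. tv (\<lambda>E. set_lebesgue_integral lam E \<tau> - measure \<mu> E *\<^sub>R v) (ball x r)"
    have ev: "\<forall>\<^sub>F r in at_right 0. ?T r \<le> ereal (e * measure \<mu> (ball x r))" if e: "e > 0" for e
    proof -
      \<comment> \<open>The two oscillation terms may each use half of \<open>e * k x / 2\<close>,
        and \<open>e2 \<le> k x / 2\<close> secures the comparison of the two measures of the ball.
        The \<open>+ 1\<close> in \<open>e2\<close> covers \<open>v = 0\<close>.\<close>
      define e1 where "e1 = e * k x / 4"
      define e2 where "e2 = min (k x / 2) (e * k x / (4 * (norm v + 1)))"
      have e12: "e1 > 0" "e2 > 0" unfolding e1_def e2_def using e x(2) by (auto intro!: divide_pos_pos mult_pos_pos add_nonneg_pos)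
      have e2a: "e2 \<le> k x / 2" unfolding e2_def by (rule min.cobounded1)
      have e2b: "norm v * e2 \<le> e * k x / 4"
      proof -
        have "norm v * e2 \<le> (norm v + 1) * (e * k x / (4 * (norm v + 1)))"
          using e12 unfolding e2_def by (intro mult_mono) auto
        also have "\<dots> = e * k x / 4" using norm_ge_zero[of v] by (simp add: field_simps add_nonneg_eq_0_iff)
        finally show ?thesis .
      qed
      have "\<forall>\<^sub>F r in at_right 0. r < d" using d(1) eventually_at_right_field by blast
      moreover have "\<forall>\<^sub>F r in at_right 0. (\<integral>y. indicator (ball x r) y * norm (\<tau> y - \<tau> x) \<partial>lam) \<le> e1 * measure lam (ball x r)"
        using elim(1) e12(1) by blast
      moreover have "\<forall>\<^sub>F r in at_right 0. (\<integral>y. indicator (ball x r) y * norm (k y - k x) \<partial>lam) \<le> e2 * measure lam (ball x r)"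
        using elim(2) e12(2) by blast
      ultimately show ?thesis
      proof eventually_elim
        case (elim r)
        have bO: "ball x r \<subseteq> \<Omega>" using elim(1) d(2) subset_ball[of r d x] by auto
        have bs: "ball x r \<in> sets lam" using lam(2) by simp
        have ind: "integrable lam (\<lambda>y. indicator (ball x r) y * h y)" if "integrable lam h" for h :: "'a \<Rightarrow> real"
          using integrable_mult_indicator[OF bs that] by simp
        define I where "I h = (\<integral>y. indicator (ball x r) y * h y \<partial>lam)" for h :: "'a \<Rightarrow> real"
        have i\<tau>: "integrable lam (\<lambda>y. norm (\<tau> y - \<tau> x))" and ik: "integrable lam (\<lambda>y. norm (k y - k x))"
          using \<tau>(1) k by auto
        have spl: "sets lam = sets borel \<Longrightarrow> space lam = UNIV" using sets_eq_imp_space_eq by fastforce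
        have mlam: "I (\<lambda>y. 1) = measure lam (ball x r)" unfolding I_def using spl[OF lam(2)] by simp
        have "?T r \<le> ereal (I (\<lambda>y. norm (\<tau> y - k y *\<^sub>R v)))"
          unfolding I_def by (rule tv_le_integral[OF lam \<tau>(1) k]) (use \<mu> bO in auto)
        moreover have "I (\<lambda>y. norm (\<tau> y - k y *\<^sub>R v)) \<le> I (\<lambda>y. norm (\<tau> y - \<tau> x) + norm v * norm (k y - k x))"
          unfolding I_def
        proof (rule integral_mono)
          show "integrable lam (\<lambda>y. indicator (ball x r) y * norm (\<tau> y - k y *\<^sub>R v))" using \<tau>(1) k by (intro ind) auto
          show "integrable lam (\<lambda>y. indicator (ball x r) y * (norm (\<tau> y - \<tau> x) + norm v * norm (k y - k x)))"
            using i\<tau> ik by (intro ind) auto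
          fix y
          have "\<tau> y - k y *\<^sub>R v = (\<tau> y - \<tau> x) - (k y - k x) *\<^sub>R v" by (simp add: v scaleR_diff_left)
          then have "norm (\<tau> y - k y *\<^sub>R v) = norm ((\<tau> y - \<tau> x) - (k y - k x) *\<^sub>R v)" by (rule arg_cong)
          also have "\<dots> \<le> norm (\<tau> y - \<tau> x) + norm ((k y - k x) *\<^sub>R v)" by (rule norm_triangle_ineq4)
          finally have "norm (\<tau> y - k y *\<^sub>R v) \<le> norm (\<tau> y - \<tau> x) + norm v * norm (k y - k x)"
            by (simp add: mult.commute)
          then show "indicator (ball x r) y * norm (\<tau> y - k y *\<^sub>R v) \<le> indicator (ball x r) y * (norm (\<tau> y - \<tau> x) + norm v * norm (k y - k x))"
            by (intro mult_left_mono) auto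
        qed
        moreover have "I (\<lambda>y. norm (\<tau> y - \<tau> x) + norm v * norm (k y - k x)) = I (\<lambda>y. norm (\<tau> y - \<tau> x)) + norm v * I (\<lambda>y. norm (k y - k x))"
        proof -
          have "I (\<lambda>y. norm (\<tau> y - \<tau> x) + norm v * norm (k y - k x)) =
            (\<integral>y. indicator (ball x r) y * norm (\<tau> y - \<tau> x) + norm v * (indicator (ball x r) y * norm (k y - k x)) \<partial>lam)"
            unfolding I_def by (intro Bochner_Integration.integral_cong refl) (simp add: algebra_simps)
          also have "\<dots> = I (\<lambda>y. norm (\<tau> y - \<tau> x)) + norm v * I (\<lambda>y. norm (k y - k x))"
            unfolding I_def using ind[OF i\<tau>] ind[OF ik] by simp
          finally show ?thesis .
        qed
        moreover have "I (\<lambda>y. norm (\<tau> y - \<tau> x)) \<le> e1 * measure lam (ball x r)" unfolding I_def using elim(2) .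
        moreover have kb: "I (\<lambda>y. norm (k y - k x)) \<le> e2 * measure lam (ball x r)" unfolding I_def using elim(3) .
        moreover then have "norm v * I (\<lambda>y. norm (k y - k x)) \<le> norm v * (e2 * measure lam (ball x r))" by (intro mult_left_mono) auto
        moreover have "norm v * (e2 * measure lam (ball x r)) \<le> e * k x / 4 * measure lam (ball x r)"
          using mult_right_mono[OF e2b, of "measure lam (ball x r)"] by (simp add: mult.assoc)
        moreover have "k x * measure lam (ball x r) \<le> 2 * measure \<mu> (ball x r)"
        proof -
          have "k x * measure lam (ball x r) = I (\<lambda>y. k x)" unfolding I_def using spl[OF lam(2)] by (simp add: mult.commute)
          also have "\<dots> \<le> (\<integral>y. indicator (ball x r) y * k y + indicator (ball x r) y * norm (k y - k x) \<partial>lam)"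
            unfolding I_def
          proof (rule integral_mono)
            show "integrable lam (\<lambda>y. indicator (ball x r) y * k x)" by (rule ind) simp
            show "integrable lam (\<lambda>y. indicator (ball x r) y * k y + indicator (ball x r) y * norm (k y - k x))"
              using ind[OF k] ind[OF ik] by simp
            show "indicator (ball x r) y * k x \<le> indicator (ball x r) y * k y + indicator (ball x r) y * norm (k y - k x)" for y
              by (auto simp: indicator_def)
          qed
          also have "\<dots> = measure \<mu> (ball x r) + I (\<lambda>y. norm (k y - k x))"
            unfolding I_def \<mu>[OF borel_open[OF open_ball] bO] using ind[OF k] ind[OF ik] by simp
          finally have "k x * measure lam (ball x r) \<le> measure \<mu> (ball x r) + e2 * measure lam (ball x r)" using kb by linarith
          moreover have "e2 * measure lam (ball x r) \<le> k x / 2 * measure lam (ball x r)" using e2a by (intro mult_right_mono) auto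
          ultimately show ?thesis by simp
        qed
        moreover then have "(e / 2) * (k x * measure lam (ball x r)) \<le> (e / 2) * (2 * measure \<mu> (ball x r))"
          using e by (intro mult_left_mono) auto
        moreover have "e1 * measure lam (ball x r) + e * k x / 4 * measure lam (ball x r) = (e / 2) * (k x * measure lam (ball x r))"
          by (simp add: e1_def)
        ultimately have "I (\<lambda>y. norm (\<tau> y - k y *\<^sub>R v)) \<le> e * measure \<mu> (ball x r)" by linarith
        then show ?case using \<open>?T r \<le> ereal (I (\<lambda>y. norm (\<tau> y - k y *\<^sub>R v)))\<close> by (meson ereal_less_eq(3) order_trans)
      qed
    qed
    have "((\<lambda>r. ?T r / ereal (measure \<mu> (ball x r))) \<longlongrightarrow> 0) (at_right 0)"
    proof (rule order_tendstoI)
      fix a :: ereal assume "a < 0"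
      moreover have "0 \<le> ?T r / ereal (measure \<mu> (ball x r))" for r
        unfolding divide_ereal_def by (intro ereal_0_le_mult tv_nonneg inverse_ereal_ge0I) simp
      ultimately show "\<forall>\<^sub>F r in at_right 0. a < ?T r / ereal (measure \<mu> (ball x r))"
        by (intro always_eventually allI) (rule less_le_trans)
    next
      fix a :: ereal assume "0 < a"
      then obtain e where e: "0 < ereal e" "ereal e < a" using ereal_dense2 by blast
      then have e0: "e > 0" by simp
      show "\<forall>\<^sub>F r in at_right 0. ?T r / ereal (measure \<mu> (ball x r)) < a"
        using ev[OF e0]
      proof eventually_elim
        case (elim r)
        have "?T r / ereal (measure \<mu> (ball x r)) \<le> ereal e"
        proof (cases "measure \<mu> (ball x r) = 0")
          \<comment> \<open>On a \<mu>-null ball the estimate forces the variation to be 0 as well,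
            and in \<open>ereal\<close> the quotient of 0 by 0 is 0.\<close>
          case True
          then have "?T r \<le> 0" using elim by (simp add: zero_ereal_def)
          then have "?T r = 0" using tv_nonneg by (rule antisym)
          then show ?thesis using e0 by simp
        next
          case False
          then have pos: "measure \<mu> (ball x r) > 0" by (simp add: zero_less_measure_iff)
          have "?T r / ereal (measure \<mu> (ball x r)) \<le> ereal (e * measure \<mu> (ball x r)) / ereal (measure \<mu> (ball x r))"
            by (rule ereal_divide_right_mono[OF elim]) (use pos in simp)
          also have "\<dots> = ereal e" using pos by simp
          finally show ?thesis .
        qed
        then show ?case using e(2) by (rule le_less_trans)
      qed
    qed
    then show "(1 / k x) *\<^sub>R \<tau> x \<in> decomp_set \<mu> x"
      unfolding decomp_set_def v_def[symmetric] using lam \<tau> by blast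
  qed
qed

section \<open>Linear calculus of test functions and their gradients\<close>

lemma smooth_fun_differentiable: "smooth_fun \<phi> \<Longrightarrow> \<phi> differentiable (at x)"
  by (auto elim: smooth_fun.cases)

lemma smooth_fun_partial: "smooth_fun \<phi> \<Longrightarrow> i \<in> Basis \<Longrightarrow> smooth_fun (\<lambda>x. frechet_derivative \<phi> (at x) i)"
  by (auto elim: smooth_fun.cases)

lemma frechet_derivative_lincomb:
  fixes \<phi> \<psi> :: "'a::euclidean_space \<Rightarrow> real"
  assumes "\<phi> differentiable (at x)" "\<psi> differentiable (at x)"
  shows "frechet_derivative (\<lambda>x. a * \<phi> x + b * \<psi> x) (at x) =
    (\<lambda>v. a * frechet_derivative \<phi> (at x) v + b * frechet_derivative \<psi> (at x) v)"
  by (rule frechet_derivative_at[symmetric])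
     (use assms in \<open>auto intro!: derivative_eq_intros simp: frechet_derivative_works\<close>)

text \<open>Coinduction over all linear combinations with the fixed coefficients \<open>a\<close>
  and \<open>b\<close>: a partial derivative of such a combination is the same combination of
  partial derivatives.\<close>

lemma smooth_fun_lincomb:
  assumes "smooth_fun \<phi>" "smooth_fun \<psi>"
  shows "smooth_fun (\<lambda>x. a * \<phi> x + b * \<psi> x)"
  using assms
proof (coinduction arbitrary: \<phi> \<psi> rule: smooth_fun.coinduct)
  case (smooth_fun \<phi> \<psi>)
  have d: "\<phi> differentiable (at x)" "\<psi> differentiable (at x)" for x
    using smooth_fun smooth_fun_differentiable by blast+
  have "(\<lambda>x. a * \<phi> x + b * \<psi> x) differentiable (at x)" for x
    using d by (intro derivative_intros) auto
  moreover have "\<exists>\<phi>' \<psi>'. (\<lambda>x. frechet_derivative (\<lambda>x. a * \<phi> x + b * \<psi> x) (at x) i) = (\<lambda>x. a * \<phi>' x + b * \<psi>' x) \<and> smooth_fun \<phi>' \<and> smooth_fun \<psi>'"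
    if "i \<in> Basis" for i
    by (rule exI[of _ "\<lambda>x. frechet_derivative \<phi> (at x) i"], rule exI[of _ "\<lambda>x. frechet_derivative \<psi> (at x) i"])
       (use smooth_fun smooth_fun_partial that in \<open>auto simp: frechet_derivative_lincomb[OF d]\<close>)
  ultimately show ?case by blast
qed

lemma smooth_fun_zero: "smooth_fun (\<lambda>x::'a::euclidean_space. 0)"
proof (coinduction rule: smooth_fun.coinduct)
  case smooth_fun
  have "frechet_derivative (\<lambda>x::'a. 0::real) (at x) = (\<lambda>v. 0)" for x
    by (rule frechet_derivative_at[symmetric]) simp
  then show ?case by (intro exI[of _ "\<lambda>x. 0"]) simp
qed

lemma test_function_zero: "test_function (\<lambda>x. 0)"
  unfolding test_function_def using smooth_fun_zero by simp

lemma test_function_lincomb: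
  fixes \<phi> \<psi> :: "'a::euclidean_space \<Rightarrow> real"
  assumes "test_function \<phi>" "test_function \<psi>"
  shows "test_function (\<lambda>x. a * \<phi> x + b * \<psi> x)"
proof -
  have "closure {x. a * \<phi> x + b * \<psi> x \<noteq> 0} \<subseteq> closure {x. \<phi> x \<noteq> 0} \<union> closure {x. \<psi> x \<noteq> 0}"
    unfolding closure_Un[symmetric] by (rule closure_mono) auto
  moreover have "compact (closure {x. \<phi> x \<noteq> 0} \<union> closure {x. \<psi> x \<noteq> 0})"
    using assms unfolding test_function_def by (intro compact_Un) auto
  ultimately have "compact (closure {x. a * \<phi> x + b * \<psi> x \<noteq> 0})"
    by (meson closed_closure closed_Int_compact compact_closure bounded_subset compact_imp_bounded compact_eq_bounded_closed)
  then show ?thesis using assms smooth_fun_lincomb unfolding test_function_def by blast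
qed

lemma grad_lincomb:
  assumes "test_function \<phi>" "test_function \<psi>"
  shows "grad (\<lambda>x. a * \<phi> x + b * \<psi> x) x = a *\<^sub>R grad \<phi> x + b *\<^sub>R grad \<psi> x"
proof -
  have d: "\<phi> differentiable (at x)" "\<psi> differentiable (at x)"
    using assms smooth_fun_differentiable unfolding test_function_def by blast+
  show ?thesis unfolding grad_def frechet_derivative_lincomb[OF d]
    by (simp add: scaleR_add_left sum.distrib scaleR_sum_right)
qed

lemma grad_zero: "grad (\<lambda>x. 0) x = 0"
proof -
  have "frechet_derivative (\<lambda>x::'a. 0::real) (at x) = (\<lambda>v. 0)"
    by (rule frechet_derivative_at[symmetric]) simp
  then show ?thesis unfolding grad_def by simp
qed

text \<open>Continuity of the gradient is bought with one more derivative: partial derivatives of a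
  smooth function are smooth, in particular differentiable.\<close>

lemma test_function_C1_gradient:
  assumes "test_function \<phi>"
  shows "C1_gradient \<phi> (grad \<phi>)"
  unfolding C1_gradient_def
proof (intro conjI allI)
  have sm: "smooth_fun \<phi>" using assms unfolding test_function_def by blast
  have "continuous_on UNIV (\<lambda>x. frechet_derivative \<phi> (at x) i)" if "i \<in> Basis" for i
    using smooth_fun_differentiable[OF smooth_fun_partial[OF sm that]]
    by (intro continuous_at_imp_continuous_on ballI differentiable_imp_continuous_within) auto
  then show "continuous_on UNIV (grad \<phi>)"
    unfolding grad_def[abs_def] by (intro continuous_intros) auto
  fix x
  have hd: "(\<phi> has_derivative frechet_derivative \<phi> (at x)) (at x)"
    using smooth_fun_differentiable[OF sm] frechet_derivative_works by blast
  then have lin: "linear (frechet_derivative \<phi> (at x))" by (rule has_derivative_linear)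
  have "frechet_derivative \<phi> (at x) v = inner (grad \<phi> x) v" for v
  proof -
    have "frechet_derivative \<phi> (at x) v = frechet_derivative \<phi> (at x) (\<Sum>i\<in>Basis. inner v i *\<^sub>R i)"
      by (simp add: euclidean_representation)
    also have "\<dots> = (\<Sum>i\<in>Basis. inner v i * frechet_derivative \<phi> (at x) i)"
      using lin by (simp add: linear_sum linear_scale)
    also have "\<dots> = inner (grad \<phi> x) v"
      unfolding grad_def inner_sum_left by (intro sum.cong refl) (simp add: inner_commute mult.commute)
    finally show ?thesis .
  qed
  then have "frechet_derivative \<phi> (at x) = (\<lambda>v. inner (grad \<phi> x) v)" by blast
  then show "(\<phi> has_derivative (\<lambda>v. inner (grad \<phi> x) v)) (at x)" using hd by simp
qed

lemma test_function_grad_support: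
  assumes "test_function \<phi>"
  obtains R where "R > 0" "\<And>x. R < norm x \<Longrightarrow> grad \<phi> x = 0"
proof -
  have c: "compact (closure {x. \<phi> x \<noteq> 0})" using assms unfolding test_function_def by blast
  then obtain R where R: "R > 0" "\<And>x. x \<in> closure {x. \<phi> x \<noteq> 0} \<Longrightarrow> norm x \<le> R"
    using compact_imp_bounded bounded_pos by metis
  have "grad \<phi> x = 0" if "R < norm x" for x
  proof -
    have x: "x \<in> - closure {x. \<phi> x \<noteq> 0}" using R(2)[of x] that by force
    have "((\<lambda>x. 0::real) has_derivative (\<lambda>v. 0)) (at x)" by simp
    moreover have "open (- closure {x. \<phi> x \<noteq> 0})" by (intro open_Compl closed_closure)
    moreover have "0 = \<phi> y" if "y \<in> - closure {x. \<phi> x \<noteq> 0}" for y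
      using that closure_subset[of "{x. \<phi> x \<noteq> 0}"] by auto
    ultimately have "(\<phi> has_derivative (\<lambda>v. 0)) (at x)"
      by (rule has_derivative_transform_within_open[OF _ _ x])
    then have "frechet_derivative \<phi> (at x) = (\<lambda>v. 0)" by (rule frechet_derivative_at[symmetric])
    then show ?thesis unfolding grad_def by simp
  qed
  then show thesis using that R(1) by blast
qed

section \<open>Approximation by bounded gradients\<close>

lemma measure_add:
  assumes "sets N = sets M"
  obtains L where "sets L = sets M" "\<And>A. A \<in> sets M \<Longrightarrow> emeasure L A = emeasure M A + emeasure N A"
proof -
  define L where "L = measure_of (space M) (sets M) (\<lambda>A. emeasure M A + emeasure N A)"
  have s: "sets L = sets M" unfolding L_def by simp
  have "emeasure L A = emeasure M A + emeasure N A" if "A \<in> sets M" for A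
  proof (rule emeasure_measure_of[OF L_def])
    show "sets M \<subseteq> Pow (space M)" by (rule sets.space_closed)
    show "A \<in> sets L" using that s by simp
    show "positive (sets L) (\<lambda>A. emeasure M A + emeasure N A)" by (simp add: positive_def)
    show "countably_additive (sets L) (\<lambda>A. emeasure M A + emeasure N A)"
    proof (rule countably_additiveI)
      fix F :: "nat \<Rightarrow> 'a set" assume F: "range F \<subseteq> sets L" "disjoint_family F" "(\<Union>i. F i) \<in> sets L"
      have "(\<Sum>i. emeasure M (F i) + emeasure N (F i)) = (\<Sum>i. emeasure M (F i)) + (\<Sum>i. emeasure N (F i))"
        by (rule suminf_add[symmetric]) auto
      then show "(\<Sum>i. emeasure M (F i) + emeasure N (F i)) = emeasure M (\<Union>i. F i) + emeasure N (\<Union>i. F i)"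
        using suminf_emeasure[of F M] suminf_emeasure[of F N] F s assms by simp
    qed
  qed
  then show thesis using that s by blast
qed

text \<open>Adding a direction as a variable turns a vector field into a scalar function that is
  linear in the field; the supremum over directions recovers the norm. This lets scalar duality
  handle norms of vector fields.\<close>

lemma Sup_inner_sphere:
  fixes v :: "'a::euclidean_space"
  shows "(SUP e\<in>sphere 0 1. inner v e) = norm v"
proof (rule cSup_eq_maximum)
  obtain i :: 'a where i: "i \<in> Basis" using nonempty_Basis by blast
  show "norm v \<in> (\<lambda>e. inner v e) ` sphere 0 1"
  proof (cases "v = 0")
    case True
    then show ?thesis using i by (intro image_eqI[of _ _ i]) auto
  next
    case False
    then have "inner v (v /\<^sub>R norm v) = norm v" by (simp add: dot_square_norm power2_eq_square)
    then show ?thesis using False by (intro image_eqI[of _ _ "v /\<^sub>R norm v"]) auto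
  qed
  show "x \<le> norm v" if "x \<in> (\<lambda>e. inner v e) ` sphere 0 1" for x
  proof -
    obtain e where e: "norm e = 1" "x = inner v e" using \<open>x \<in> _\<close> by auto
    then show ?thesis using norm_cauchy_schwarz[of v e] by simp
  qed
qed

text \<open>A homeomorphism of the open unit ball onto the whole space: gradients of test functions,
  transported to the unit ball, extend continuously by zero to the closed ball.\<close>

definition blow :: "'a::euclidean_space \<Rightarrow> 'a" where
  "blow y = (1 / (1 - norm y)) *\<^sub>R y"

text \<open>Linear in \<phi>, and at most 1 for all unit \<open>e\<close> exactly when |D\<phi>| is
  bounded by \<open>w\<close>. The boundary sphere stands for infinity, where the gradient of a test
  function vanishes.\<close>

definition ball_field :: "('a::euclidean_space \<Rightarrow> real) \<Rightarrow> ('a \<Rightarrow> real) \<Rightarrow> 'a \<Rightarrow> 'a \<Rightarrow> real" where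
  "ball_field w \<phi> y e = (if norm y < 1 then inner (grad \<phi> (blow y)) e / w (blow y) else 0)"

lemma blow_inverse: "norm ((1 / (1 + norm x)) *\<^sub>R x) < 1" "blow ((1 / (1 + norm x)) *\<^sub>R x) = x"
proof -
  have p: "1 + norm x > 0" using norm_ge_zero[of x] by linarith
  show "norm ((1 / (1 + norm x)) *\<^sub>R x) < 1" using p by simp
  have "1 - norm ((1 / (1 + norm x)) *\<^sub>R x) = 1 / (1 + norm x)" using p by (simp add: field_simps)
  then show "blow ((1 / (1 + norm x)) *\<^sub>R x) = x" unfolding blow_def using p by simp
qed

lemma continuous_on_blow: "continuous_on {y. norm y < 1} blow"
  unfolding blow_def[abs_def] by (intro continuous_intros) auto

text \<open>\<open>blow\<close> sends the sphere of radius \<open>R / (1 + R)\<close> to the one of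
  radius \<open>R\<close>, so beyond it the gradient is already 0 and the two branches of the
  definition agree on an open shell.\<close>

lemma continuous_on_ball_field:
  fixes w :: "'a::euclidean_space \<Rightarrow> real"
  assumes \<phi>: "test_function \<phi>" and w: "continuous_on UNIV w" "\<And>x. 0 < w x"
  shows "continuous_on UNIV (\<lambda>z. ball_field w \<phi> (fst z) (snd z))"
proof -
  obtain R where R: "R > 0" "\<And>x. R < norm x \<Longrightarrow> grad \<phi> x = 0" using test_function_grad_support[OF \<phi>] by blast
  define \<rho> where "\<rho> = R / (1 + R)"
  have \<rho>: "\<rho> < 1" unfolding \<rho>_def using R(1) by simp
  define A where "A = {z::'a\<times>'a. norm (fst z) < 1}"
  define B where "B = {z::'a\<times>'a. \<rho> < norm (fst z)}"
  have "open A" "open B" unfolding A_def B_def by (auto intro!: open_Collect_less continuous_intros)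
  moreover have "continuous_on A (\<lambda>z. ball_field w \<phi> (fst z) (snd z))"
  proof -
    have bc: "continuous_on A (\<lambda>z. blow (fst z))"
      by (rule continuous_on_compose2[OF continuous_on_blow]) (auto intro!: continuous_intros simp: A_def)
    have gc: "continuous_on UNIV (grad \<phi>)" using test_function_C1_gradient[OF \<phi>] unfolding C1_gradient_def by blast
    have "continuous_on A (\<lambda>z. inner (grad \<phi> (blow (fst z))) (snd z) / w (blow (fst z)))"
      using w(2)
      by (intro continuous_intros continuous_on_compose2[OF gc bc] continuous_on_compose2[OF w(1) bc]) (auto simp: less_le)
    then show ?thesis by (rule continuous_on_eq) (simp add: A_def ball_field_def)
  qed
  moreover have "continuous_on B (\<lambda>z. ball_field w \<phi> (fst z) (snd z))"
  proof -
    have "ball_field w \<phi> (fst z) (snd z) = 0" if "z \<in> B" for z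
    proof (cases "norm (fst z) < 1")
      case True
      have "R < norm (fst z) / (1 - norm (fst z))"
        using that True R(1) unfolding B_def \<rho>_def by (simp add: field_simps)
      then have "R < norm (blow (fst z))" unfolding blow_def using True by simp
      then show ?thesis using R(2) by (simp add: ball_field_def)
    qed (simp add: ball_field_def)
    moreover have "continuous_on B (\<lambda>z. 0::real)" by (rule continuous_on_const)
    ultimately show ?thesis by (metis (no_types, lifting) continuous_on_eq)
  qed
  ultimately have "continuous_on (A \<union> B) (\<lambda>z. ball_field w \<phi> (fst z) (snd z))" by (rule continuous_on_open_Un)
  moreover have "A \<union> B = UNIV" unfolding A_def B_def using \<rho> by (auto simp: not_less)
  ultimately show ?thesis by simp
qed

lemma grad_bounded:
  assumes "test_function \<phi>"
  obtains C where "\<And>x. norm (grad \<phi> x) \<le> C"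
proof -
  obtain R where R: "R > 0" "\<And>x. R < norm x \<Longrightarrow> grad \<phi> x = 0" using test_function_grad_support[OF assms] by blast
  have gc: "continuous_on UNIV (grad \<phi>)" using test_function_C1_gradient[OF assms] unfolding C1_gradient_def by blast
  have "bounded (grad \<phi> ` cball 0 R)"
    by (rule compact_imp_bounded[OF compact_continuous_image[OF continuous_on_subset[OF gc]]]) auto
  then obtain C where C: "\<forall>y\<in>grad \<phi> ` cball 0 R. norm y \<le> C" unfolding bounded_iff by blast
  have "norm (grad \<phi> x) \<le> max C 0" for x
  proof (cases "norm x \<le> R")
    case True
    then have "grad \<phi> x \<in> grad \<phi> ` cball 0 R" by simp
    with C have "norm (grad \<phi> x) \<le> C" by blast
    then show ?thesis by simp
  next
    case False
    then show ?thesis using R(2) by simp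
  qed
  then show thesis using that by blast
qed

text \<open>The last coordinate of \<open>'a \<times> 'a \<times> real\<close> tags two disjoint copies: tag 0 carries the pairing with \<open>M\<close> on \<open>K\<close>,
  tag 1 the constraint \<open>|D\<phi>| \<le> w\<close>; the middle coordinate is a direction on the unit sphere.\<close>

lemma separating_measure:
  fixes M :: "'a::euclidean_space measure" and f :: "'a \<Rightarrow> 'a" and w :: "'a \<Rightarrow> real"
  assumes M: "finite_measure M" "sets M = sets borel" and K: "compact K" and f: "continuous_on K f"
    and w: "continuous_on UNIV w" "c > 0" "\<And>x. c \<le> w x" and d: "d > 0"
    and neg: "\<And>\<phi>. test_function \<phi> \<Longrightarrow> (\<And>x. norm (grad \<phi> x) \<le> w x) \<Longrightarrow>
      d \<le> (\<integral>x. indicator K x * norm (f x - grad \<phi> x) \<partial>M)"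
  obtains \<pi> :: "('a \<times> 'a \<times> real) measure" and A :: real
  where "prob_space \<pi>" "sets \<pi> = sets borel" "A > 0"
    "AE z in \<pi>. z \<in> K \<times> sphere 0 1 \<times> {0} \<union> cball 0 1 \<times> sphere 0 1 \<times> {1}"
    "\<And>\<phi> s h. test_function \<phi> \<Longrightarrow> h \<in> borel_measurable borel \<Longrightarrow>
      (\<And>x e. x \<in> K \<Longrightarrow> norm e = 1 \<Longrightarrow> h (x, e, 0) = inner (s *\<^sub>R f x - grad \<phi> x) e) \<Longrightarrow>
      (\<And>y e. norm y \<le> 1 \<Longrightarrow> norm e = 1 \<Longrightarrow> h (y, e, 1) = ball_field w \<phi> y e) \<Longrightarrow> integral\<^sup>L \<pi> h = s / A"
    "integral\<^sup>L \<pi> (\<lambda>z. min 1 (max 0 (snd (snd z)))) \<le> 1 / A"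
    "\<And>N. N \<in> sets borel \<Longrightarrow> measure M N = 0 \<Longrightarrow> AE z in \<pi>. snd (snd z) = 0 \<longrightarrow> fst z \<notin> N"
proof -
  interpret M: finite_measure M by fact
  have wpos: "0 < w x" for x using w(2,3) less_le_trans by blast
  have spM: "space M = UNIV" using sets_eq_imp_space_eq[OF M(2)] by simp
  define S where "S = sphere (0::'a) 1"
  obtain i :: 'a where i: "i \<in> Basis" using nonempty_Basis by blast
  have iS: "i \<in> S" using i by (simp add: S_def)
  then have Sne: "S \<noteq> {}" by blast
  define Z where "Z = K \<times> S \<times> {0::real} \<union> cball 0 1 \<times> S \<times> {1}"
  have Zc: "compact Z" unfolding Z_def S_def by (intro compact_Un compact_Times K compact_cball compact_sphere) auto
  have Zne: "Z \<noteq> {}" unfolding Z_def using iS by (auto intro!: exI[of _ 0])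
  define Y where "Y = cball (0::'a) 1 \<times> S"
  have Yne: "Y \<noteq> {}" unfolding Y_def using iS by (auto intro!: exI[of _ 0])
  define ap where "ap = (apply_bcontfun :: (('a \<times> 'a \<times> real) \<Rightarrow>\<^sub>C real) \<Rightarrow> 'a \<times> 'a \<times> real \<Rightarrow> real)"
  have apb: "\<bar>ap \<Psi> z\<bar> \<le> norm \<Psi>" for \<Psi> z unfolding ap_def using norm_bounded[of \<Psi> z] by simp
  have apadd: "ap (\<Psi> + \<Psi>') z = ap \<Psi> z + ap \<Psi>' z" for \<Psi> \<Psi>' z by (simp add: ap_def)
  have apsc: "ap (r *\<^sub>R \<Psi>) z = r * ap \<Psi> z" for r \<Psi> z by (simp add: ap_def)
  have apneg: "ap (- \<Psi>) z = - ap \<Psi> z" for \<Psi> z by (simp add: ap_def)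
  have apc: "continuous_on X (ap \<Psi>)" for X \<Psi> unfolding ap_def by simp
  define m where "m \<Psi> x = (SUP e\<in>S. ap \<Psi> (x, e, 0))" for \<Psi> x
  define t where "t \<Psi> = (SUP y\<in>Y. ap \<Psi> (fst y, snd y, 1))" for \<Psi>
  have bddm: "bdd_above ((\<lambda>e. ap \<Psi> (x, e, 0)) ` S)" for \<Psi> x
    by (rule bdd_aboveI[of _ "norm \<Psi>"]) (use apb[of \<Psi>] in \<open>auto simp: abs_le_iff\<close>)
  have bddt: "bdd_above ((\<lambda>y. ap \<Psi> (fst y, snd y, 1)) ` Y)" for \<Psi>
    by (rule bdd_aboveI[of _ "norm \<Psi>"]) (use apb[of \<Psi>] in \<open>auto simp: abs_le_iff\<close>)
  have mu: "ap \<Psi> (x, e, 0) \<le> m \<Psi> x" if "e \<in> S" for \<Psi> x e unfolding m_def by (rule cSUP_upper[OF that bddm])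
  have ml: "m \<Psi> x \<le> b" if "\<And>e. e \<in> S \<Longrightarrow> ap \<Psi> (x, e, 0) \<le> b" for \<Psi> x b
    unfolding m_def by (rule cSUP_least[OF Sne that])
  have tu: "ap \<Psi> (y, e, 1) \<le> t \<Psi>" if "y \<in> cball 0 1" "e \<in> S" for \<Psi> y e
    unfolding t_def using cSUP_upper[OF _ bddt, of "(y, e)" \<Psi>] that by (simp add: Y_def)
  have tl: "t \<Psi> \<le> b" if "\<And>y e. y \<in> cball 0 1 \<Longrightarrow> e \<in> S \<Longrightarrow> ap \<Psi> (y, e, 1) \<le> b" for \<Psi> b
    unfolding t_def by (rule cSUP_least[OF Yne]) (use that in \<open>auto simp: Y_def\<close>)
  have mabs: "\<bar>m \<Psi> x\<bar> \<le> norm \<Psi>" for \<Psi> x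
    using ml[of \<Psi> x "norm \<Psi>"] mu[OF iS, of \<Psi> x] apb[of \<Psi>] by (smt (verit))
  have mmeas: "m \<Psi> \<in> borel_measurable borel" for \<Psi>
    unfolding borel_measurable_iff_greater
  proof
    fix a
    \<comment> \<open>A supremum of continuous functions is lower semicontinuous, hence Borel
      although \<open>S\<close> is uncountable.\<close>
    have "{x. a < m \<Psi> x} = (\<Union>e\<in>S. {x. a < ap \<Psi> (x, e, 0)})"
      unfolding m_def using less_cSUP_iff[OF Sne bddm] by auto
    moreover have "open {x. a < ap \<Psi> (x, e, 0)}" for e
      by (intro open_Collect_less continuous_on_const continuous_on_compose2[OF apc[of UNIV]] continuous_intros) auto
    ultimately have "open {x. a < m \<Psi> x}" by auto
    then show "{x \<in> space borel. a < m \<Psi> x} \<in> sets borel" by simp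
  qed
  have Kb: "K \<in> sets borel" using K by (simp add: compact_imp_closed borel_closed)
  have mint: "integrable M (\<lambda>x. indicator K x * m \<Psi> x)" for \<Psi>
  proof (rule M.integrable_const_bound[of _ "norm \<Psi>"])
    show "(\<lambda>x. indicator K x * m \<Psi> x) \<in> borel_measurable M"
    proof (intro borel_measurable_times borel_measurable_indicator)
      show "m \<Psi> \<in> borel_measurable M" using mmeas[of \<Psi>] measurable_cong_sets[OF M(2) refl] by blast
    qed (use Kb M(2) in simp)
    show "AE x in M. norm (indicator K x * m \<Psi> x) \<le> norm \<Psi>" using mabs by (auto simp: indicator_def)
  qed
  \<comment> \<open>On the element of \<open>G\<close> given by \<open>s\<close> and \<phi>, this is
    \<open>1 / d\<close> times the integral over \<open>K\<close> of |s f - D\<phi>|, plus the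
    supremum of |D\<phi>| / \<open>w\<close>. The assumed failure of approximation makes this at
    least \<open>s\<close>.\<close>
  define p where "p \<Psi> = (1 / d) * (\<integral>x. indicator K x * m \<Psi> x \<partial>M) + t \<Psi>" for \<Psi>
  have pmono: "p \<Psi> \<le> (1 / d) * (\<integral>x. indicator K x * b x \<partial>M) + b'"
    if "\<And>x e. x \<in> K \<Longrightarrow> e \<in> S \<Longrightarrow> ap \<Psi> (x, e, 0) \<le> b x" "\<And>y e. y \<in> cball 0 1 \<Longrightarrow> e \<in> S \<Longrightarrow> ap \<Psi> (y, e, 1) \<le> b'"
      "integrable M (\<lambda>x. indicator K x * b x)" for \<Psi> b b'
  proof -
    have "(\<integral>x. indicator K x * m \<Psi> x \<partial>M) \<le> (\<integral>x. indicator K x * b x \<partial>M)"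
      by (rule integral_mono[OF mint that(3)]) (use ml that(1) in \<open>auto simp: indicator_def\<close>)
    then have "(1 / d) * (\<integral>x. indicator K x * m \<Psi> x \<partial>M) \<le> (1 / d) * (\<integral>x. indicator K x * b x \<partial>M)"
      using d by (intro mult_left_mono) auto
    moreover have "t \<Psi> \<le> b'" using tl that(2) by blast
    ultimately show ?thesis unfolding p_def by linarith
  qed
  have psub: "p (u + v) \<le> p u + p v" for u v
  proof -
    have "p (u + v) \<le> (1 / d) * (\<integral>x. indicator K x * (m u x + m v x) \<partial>M) + (t u + t v)"
    proof (rule pmono)
      show "integrable M (\<lambda>x. indicator K x * (m u x + m v x))" using mint[of u] mint[of v] by (simp add: distrib_left)
    qed (auto simp: apadd intro!: add_mono mu tu)
    also have "(\<integral>x. indicator K x * (m u x + m v x) \<partial>M) = (\<integral>x. indicator K x * m u x \<partial>M) + (\<integral>x. indicator K x * m v x \<partial>M)"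
      using mint[of u] mint[of v] by (simp add: distrib_left)
    finally show ?thesis unfolding p_def by (simp add: distrib_left)
  qed
  have psc: "p (r *\<^sub>R v) \<le> r * p v" if r: "0 \<le> r" for r v
  proof -
    have "p (r *\<^sub>R v) \<le> (1 / d) * (\<integral>x. indicator K x * (r * m v x) \<partial>M) + r * t v"
    proof (rule pmono)
      show "integrable M (\<lambda>x. indicator K x * (r * m v x))" using integrable_mult_right[OF mint[of v], of r] by (simp add: mult.left_commute)
    qed (auto simp: apsc intro!: mult_left_mono mu tu r)
    also have "(\<integral>x. indicator K x * (r * m v x) \<partial>M) = r * (\<integral>x. indicator K x * m v x \<partial>M)"
      by (simp add: mult.left_commute)
    finally show ?thesis unfolding p_def by (simp add: distrib_left mult.left_commute)
  qed
  have p0: "p 0 = 0"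
  proof -
    have z: "ap 0 z = 0" for z unfolding ap_def by simp
    have "m 0 x = 0" for x unfolding m_def z using Sne by simp
    moreover have "t 0 = 0" unfolding t_def z using Yne by simp
    ultimately show ?thesis unfolding p_def by simp
  qed
  \<comment> \<open>The graph of the assignment of \<open>s\<close> to the pair formed by
    \<open>s f - D\<phi>\<close> on tag 0 and D\<phi> / \<open>w\<close> on tag 1. Its elements are
    constrained only on \<open>Z\<close>, so equality off \<open>Z\<close> never has to be
    arranged.\<close>
  define G where "G = {(\<Psi>, s). \<exists>\<phi>. test_function \<phi> \<and>
    (\<forall>x\<in>K. \<forall>e\<in>S. ap \<Psi> (x, e, 0) = inner (s *\<^sub>R f x - grad \<phi> x) e) \<and>
    (\<forall>y\<in>cball 0 1. \<forall>e\<in>S. ap \<Psi> (y, e, 1) = ball_field w \<phi> y e)}"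
  obtain L where L: "linear L" and Lp: "\<And>\<Psi>. L \<Psi> \<le> p \<Psi>" and LG: "\<And>\<Psi> s. (\<Psi>, s) \<in> G \<Longrightarrow> L \<Psi> = s"
  proof (rule Hahn_Banach_graph[of p G])
    show "p (r *\<^sub>R v) = r * p v" if "0 \<le> r" for r v
    proof (cases "r = 0")
      case False
      then have "p v \<le> (1/r) * p (r *\<^sub>R v)" using psc[of "1/r" "r *\<^sub>R v"] that by simp
      then show ?thesis using psc[OF that, of v] False that by (simp add: field_simps)
    qed (simp add: p0)
    show "subspace G"
    proof (rule subspaceI)
      have "ball_field w (\<lambda>x. 0) y e = 0" for y e by (simp add: ball_field_def grad_zero)
      then show "0 \<in> G" unfolding G_def zero_prod_def
        using test_function_zero by (auto simp: ap_def grad_zero intro!: exI[of _ "\<lambda>x. 0"])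
    next
      fix u v assume "u \<in> G" "v \<in> G"
      then obtain \<Psi> s \<phi> \<Psi>' s' \<phi>' where u: "u = (\<Psi>, s)" "test_function \<phi>"
        "\<forall>x\<in>K. \<forall>e\<in>S. ap \<Psi> (x, e, 0) = inner (s *\<^sub>R f x - grad \<phi> x) e" "\<forall>y\<in>cball 0 1. \<forall>e\<in>S. ap \<Psi> (y, e, 1) = ball_field w \<phi> y e"
        and v: "v = (\<Psi>', s')" "test_function \<phi>'"
        "\<forall>x\<in>K. \<forall>e\<in>S. ap \<Psi>' (x, e, 0) = inner (s' *\<^sub>R f x - grad \<phi>' x) e" "\<forall>y\<in>cball 0 1. \<forall>e\<in>S. ap \<Psi>' (y, e, 1) = ball_field w \<phi>' y e"
        unfolding G_def by blast
      have "test_function (\<lambda>x. 1 * \<phi> x + 1 * \<phi>' x)" by (rule test_function_lincomb[OF u(2) v(2)])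
      moreover have "\<forall>x\<in>K. \<forall>e\<in>S. ap (\<Psi> + \<Psi>') (x, e, 0) = inner ((s + s') *\<^sub>R f x - grad (\<lambda>x. 1 * \<phi> x + 1 * \<phi>' x) x) e"
        unfolding grad_lincomb[OF u(2) v(2)] using u(3) v(3) by (simp add: apadd inner_diff_left inner_add_left algebra_simps)
      moreover have "\<forall>y\<in>cball 0 1. \<forall>e\<in>S. ap (\<Psi> + \<Psi>') (y, e, 1) = ball_field w (\<lambda>x. 1 * \<phi> x + 1 * \<phi>' x) y e"
        unfolding ball_field_def grad_lincomb[OF u(2) v(2)] using u(4) v(4)
        by (simp add: apadd ball_field_def inner_add_left add_divide_distrib)
      ultimately show "u + v \<in> G" unfolding G_def u(1) v(1) by auto
    next
      fix r u assume "u \<in> G"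
      then obtain \<Psi> s \<phi> where u: "u = (\<Psi>, s)" "test_function \<phi>"
        "\<forall>x\<in>K. \<forall>e\<in>S. ap \<Psi> (x, e, 0) = inner (s *\<^sub>R f x - grad \<phi> x) e" "\<forall>y\<in>cball 0 1. \<forall>e\<in>S. ap \<Psi> (y, e, 1) = ball_field w \<phi> y e"
        unfolding G_def by blast
      have "test_function (\<lambda>x. r * \<phi> x + 0 * \<phi> x)" by (rule test_function_lincomb[OF u(2) u(2)])
      moreover have "\<forall>x\<in>K. \<forall>e\<in>S. ap (r *\<^sub>R \<Psi>) (x, e, 0) = inner ((r * s) *\<^sub>R f x - grad (\<lambda>x. r * \<phi> x + 0 * \<phi> x) x) e"
        unfolding grad_lincomb[OF u(2) u(2)] using u(3) by (simp add: apsc inner_diff_left right_diff_distrib mult.assoc)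
      moreover have "\<forall>y\<in>cball 0 1. \<forall>e\<in>S. ap (r *\<^sub>R \<Psi>) (y, e, 1) = ball_field w (\<lambda>x. r * \<phi> x + 0 * \<phi> x) y e"
        unfolding ball_field_def grad_lincomb[OF u(2) u(2)] using u(4) by (simp add: apsc ball_field_def)
      ultimately show "r *\<^sub>R u \<in> G" unfolding G_def u(1) by auto
    qed
    show "s \<le> p \<Psi>" if "(\<Psi>, s) \<in> G" for \<Psi> s
    proof -
      obtain \<phi> where \<phi>: "test_function \<phi>"
        and h0: "\<And>x e. x \<in> K \<Longrightarrow> e \<in> S \<Longrightarrow> ap \<Psi> (x, e, 0) = inner (s *\<^sub>R f x - grad \<phi> x) e"
        and h1: "\<And>y e. y \<in> cball 0 1 \<Longrightarrow> e \<in> S \<Longrightarrow> ap \<Psi> (y, e, 1) = ball_field w \<phi> y e"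
        using \<open>(\<Psi>, s) \<in> G\<close> unfolding G_def by blast
      have mK: "m \<Psi> x = norm (s *\<^sub>R f x - grad \<phi> x)" if "x \<in> K" for x
      proof -
        have "m \<Psi> x = (SUP e\<in>S. inner (s *\<^sub>R f x - grad \<phi> x) e)" unfolding m_def using h0[OF that] by (intro SUP_cong) auto
        then show ?thesis unfolding S_def Sup_inner_sphere .
      qed
      have int_eq: "(\<integral>x. indicator K x * m \<Psi> x \<partial>M) = (\<integral>x. indicator K x * norm (s *\<^sub>R f x - grad \<phi> x) \<partial>M)"
        by (rule Bochner_Integration.integral_cong) (auto simp: mK indicator_def)
      have int0: "0 \<le> (\<integral>x. indicator K x * m \<Psi> x \<partial>M)" unfolding int_eq by (rule integral_nonneg_AE) simp
      \<comment> \<open>The basis vector \<open>i\<close> has norm 1, and there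
        \<open>ball_field\<close> takes its boundary value 0.\<close>
      have t0: "0 \<le> t \<Psi>" using tu[of i i \<Psi>] h1[of i i] i iS by (simp add: ball_field_def)
      have tg: "norm (grad \<phi> x) \<le> t \<Psi> * w x" for x
      proof (cases "grad \<phi> x = 0")
        case True
        then show ?thesis using t0 wpos[of x] by simp
      next
        case False
        define y where "y = (1 / (1 + norm x)) *\<^sub>R x"
        define e where "e = grad \<phi> x /\<^sub>R norm (grad \<phi> x)"
        have e: "e \<in> S" using False by (simp add: e_def S_def)
        have y: "norm y < 1" "blow y = x" unfolding y_def by (rule blow_inverse)+
        have "ball_field w \<phi> y e = inner (grad \<phi> x) e / w x" using y by (simp add: ball_field_def)
        also have "inner (grad \<phi> x) e = norm (grad \<phi> x)" unfolding e_def using False by (simp add: dot_square_norm power2_eq_square)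
        finally have "norm (grad \<phi> x) / w x \<le> t \<Psi>" using tu[OF _ e, of y \<Psi>] h1[OF _ e, of y] y(1) by simp
        then show ?thesis using wpos[of x] by (simp add: field_simps)
      qed
      show "s \<le> p \<Psi>"
      \<comment> \<open>If \<open>s\<close> exceeds \<open>t \<Psi>\<close>, then \<phi> divided by
        \<open>s\<close> obeys the bound \<open>w\<close>, so the hypothesis \<open>neg\<close>
        makes the integral term alone at least \<open>s\<close>.\<close>
      proof (cases "s \<le> t \<Psi>")
        case True
        have "0 \<le> (1 / d) * (\<integral>x. indicator K x * m \<Psi> x \<partial>M)" using int0 d by simp
        then show ?thesis unfolding p_def using True by linarith
      next
        case False
        then have s: "s > 0" using t0 by linarith
        define \<phi>' where "\<phi>' x = (1 / s) * \<phi> x + 0 * \<phi> x" for x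
        have g': "grad \<phi>' x = (1 / s) *\<^sub>R grad \<phi> x" for x
          unfolding \<phi>'_def[abs_def] grad_lincomb[OF \<phi> \<phi>] by simp
        have "test_function \<phi>'" unfolding \<phi>'_def[abs_def] by (rule test_function_lincomb[OF \<phi> \<phi>])
        moreover have "norm (grad \<phi>' x) \<le> w x" for x
        proof -
          have "norm (grad \<phi> x) \<le> s * w x" using tg[of x] False wpos[of x] mult_right_mono[of "t \<Psi>" s "w x"] by linarith
          then show ?thesis unfolding g' using s by (simp add: field_simps)
        qed
        ultimately have "d \<le> (\<integral>x. indicator K x * norm (f x - grad \<phi>' x) \<partial>M)" by (rule neg)
        then have "s * d \<le> s * (\<integral>x. indicator K x * norm (f x - grad \<phi>' x) \<partial>M)" using s by simp
        also have "\<dots> = (\<integral>x. indicator K x * m \<Psi> x \<partial>M)" unfolding int_eq integral_mult_right_zero[symmetric]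
        proof (rule Bochner_Integration.integral_cong[OF refl])
          fix x
          have "s *\<^sub>R (f x - grad \<phi>' x) = s *\<^sub>R f x - grad \<phi> x" unfolding g' using s by (simp add: scaleR_diff_right)
          then have "norm (s *\<^sub>R f x - grad \<phi> x) = norm (s *\<^sub>R (f x - grad \<phi>' x))" by simp
          also have "\<dots> = s * norm (f x - grad \<phi>' x)" using s by simp
          finally show "s * (indicator K x * norm (f x - grad \<phi>' x)) = indicator K x * norm (s *\<^sub>R f x - grad \<phi> x)" by simp
        qed
        finally have "s \<le> (1 / d) * (\<integral>x. indicator K x * m \<Psi> x \<partial>M)" using d by (simp add: field_simps)
        then show ?thesis unfolding p_def using t0 by linarith
      qed
    qed
  qed (use psub in auto)
  have Lneg: "L (- \<Psi>) = - L \<Psi>" for \<Psi> using linear_neg[OF L] .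
  have Lpos: "0 \<le> L \<Psi>" if "\<And>z. z \<in> Z \<Longrightarrow> 0 \<le> ap \<Psi> z" for \<Psi>
  proof -
    have "p (- \<Psi>) \<le> (1 / d) * (\<integral>x. indicator K x * 0 \<partial>M) + 0"
      by (rule pmono) (use that in \<open>auto simp: apneg Z_def\<close>)
    then show ?thesis using Lp[of "- \<Psi>"] Lneg[of \<Psi>] by simp
  qed
  define one where "one = (const_bcontfun 1 :: ('a \<times> 'a \<times> real) \<Rightarrow>\<^sub>C real)"
  have ap1: "ap one z = 1" for z unfolding one_def ap_def by simp
  define A where "A = L one"
  have mK: "(\<integral>x. indicator K x * c \<partial>M) = c * measure M K" for c :: real using Kb M(2) spM by (simp add: mult.commute)
  have iK: "integrable M (\<lambda>x. indicator K x * c)" for c :: real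
    using Kb M(2) by (intro integrable_mult_left) (simp add: integrable_indicator_iff less_top[symmetric])
  \<comment> \<open>\<open>A\<close> is the total mass of the positive functional. It is at least 1
    because \<open>p\<close> of the constant -1 is at most -1, and dividing by it normalises to a
    probability.\<close>
  have A1: "A \<ge> 1"
  proof -
    have "p (- one) \<le> (1 / d) * (\<integral>x. indicator K x * (-1) \<partial>M) + (-1)"
      by (rule pmono) (use iK[of "-1"] in \<open>auto simp: apneg ap1\<close>)
    moreover have "(1 / d) * (\<integral>x. indicator K x * (-1) \<partial>M) \<le> 0" unfolding mK using d by simp
    ultimately show ?thesis using Lp[of "- one"] Lneg[of one] unfolding A_def by simp
  qed
  then have Apos: "A > 0" by simp
  define l where "l \<Psi> = L \<Psi> / A" for \<Psi>
  have lin: "linear l" unfolding l_def[abs_def]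
    by (rule linearI) (use linear_add[OF L] linear_scale[OF L] in \<open>auto simp: add_divide_distrib\<close>)
  obtain \<pi> :: "('a \<times> 'a \<times> real) measure" where \<pi>: "prob_space \<pi>" "sets \<pi> = sets borel" "AE z in \<pi>. z \<in> Z"
    "\<And>h. integral\<^sup>L \<pi> (apply_bcontfun h) = l h"
  proof (rule Riesz_compact[OF Zc Zne lin])
    show "0 \<le> l h" if "\<And>z. z \<in> Z \<Longrightarrow> 0 \<le> apply_bcontfun h z" for h
      unfolding l_def using Lpos[of h] that Apos by (simp add: ap_def)
    show "l (const_bcontfun 1) = 1" unfolding l_def using Apos by (simp add: A_def one_def[symmetric])
  qed blast
  interpret \<pi>: prob_space \<pi> by fact
  have sp\<pi>: "space \<pi> = UNIV" using sets_eq_imp_space_eq[OF \<pi>(2)] by simp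
  \<comment> \<open>The functional acts on bounded continuous functions on the whole space, whereas
    the integrands of interest are continuous only on \<open>Z\<close>. Tietze extends them, and
    \<pi> does not see the change off \<open>Z\<close>.\<close>
  have rep: "\<exists>\<Psi>. (\<forall>z\<in>Z. ap \<Psi> z = h z) \<and> integral\<^sup>L \<pi> h = L \<Psi> / A"
    if hc: "continuous_on Z h" and hm: "h \<in> borel_measurable borel" for h
  proof -
    have "bounded (h ` Z)" using compact_continuous_image[OF hc Zc] compact_imp_bounded by blast
    then obtain B where B: "B > 0" "\<And>z. z \<in> Z \<Longrightarrow> norm (h z) \<le> B" unfolding bounded_pos by blast
    obtain k where k: "continuous_on UNIV k" "\<And>z. z \<in> Z \<Longrightarrow> k z = h z" "\<And>z. norm (k z) \<le> B"
    proof (rule Tietze[OF hc, of UNIV B])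
      show "closedin (top_of_set UNIV) Z" using compact_imp_closed[OF Zc] by simp
    qed (use B in auto)
    define \<Psi> where "\<Psi> = Bcontfun k"
    have ap\<Psi>: "apply_bcontfun \<Psi> = k" unfolding \<Psi>_def
      by (rule Bcontfun_inverse) (rule bcontfun_normI[OF k(1) k(3)])
    have "integral\<^sup>L \<pi> h = integral\<^sup>L \<pi> (apply_bcontfun \<Psi>)"
    proof (rule integral_cong_AE)
      show "h \<in> borel_measurable \<pi>" using hm measurable_cong_sets[OF \<pi>(2) refl] by blast
      show "apply_bcontfun \<Psi> \<in> borel_measurable \<pi>"
        using borel_measurable_continuous_onI[OF k(1)] measurable_cong_sets[OF \<pi>(2) refl] unfolding ap\<Psi> by blast
      show "AE z in \<pi>. h z = apply_bcontfun \<Psi> z"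
        using \<pi>(3) by eventually_elim (simp add: ap\<Psi> k(2))
    qed
    then have "integral\<^sup>L \<pi> h = L \<Psi> / A" unfolding \<pi>(4) l_def .
    then show ?thesis using k(2) unfolding ap_def by (intro exI[of _ \<Psi>]) (simp add: ap\<Psi>)
  qed
  show thesis
  proof (rule that[OF \<pi>(1,2) Apos])
    show "AE z in \<pi>. z \<in> K \<times> sphere 0 1 \<times> {0} \<union> cball 0 1 \<times> sphere 0 1 \<times> {1}"
      using \<pi>(3) unfolding Z_def S_def .
  next
    fix \<phi> s and h :: "'a \<times> 'a \<times> real \<Rightarrow> real"
    assume \<phi>: "test_function \<phi>" and hm: "h \<in> borel_measurable borel"
      and h0: "\<And>x e. x \<in> K \<Longrightarrow> norm e = 1 \<Longrightarrow> h (x, e, 0) = inner (s *\<^sub>R f x - grad \<phi> x) e"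
      and h1: "\<And>y e. norm y \<le> 1 \<Longrightarrow> norm e = 1 \<Longrightarrow> h (y, e, 1) = ball_field w \<phi> y e"
    have gc: "continuous_on UNIV (grad \<phi>)" using test_function_C1_gradient[OF \<phi>] unfolding C1_gradient_def by blast
    have "continuous_on (K \<times> S \<times> {0}) h"
    proof (rule continuous_on_eq)
      show "continuous_on (K \<times> S \<times> {0}) (\<lambda>z. inner (s *\<^sub>R f (fst z) - grad \<phi> (fst z)) (fst (snd z)))"
        by (intro continuous_intros continuous_on_compose2[OF f] continuous_on_compose2[OF gc]) auto
    qed (use h0 in \<open>auto simp: S_def\<close>)
    moreover have "continuous_on (cball 0 1 \<times> S \<times> {1}) h"
    proof (rule continuous_on_eq)
      have "continuous_on (cball 0 1 \<times> S \<times> {1::real}) (\<lambda>z::'a\<times>'a\<times>real. (fst z, fst (snd z)))" by (intro continuous_intros)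
      from continuous_on_compose2[OF continuous_on_ball_field[OF \<phi> w(1) wpos] this]
      show "continuous_on (cball 0 1 \<times> S \<times> {1}) (\<lambda>z::'a\<times>'a\<times>real. ball_field w \<phi> (fst z) (fst (snd z)))" by simp
    qed (use h1 in \<open>auto simp: S_def\<close>)
    ultimately have "continuous_on Z h" unfolding Z_def S_def
      by (intro continuous_on_closed_Un closed_Times compact_imp_closed[OF K]) auto
    from rep[OF this hm] obtain \<Psi> where \<Psi>: "\<forall>z\<in>Z. ap \<Psi> z = h z" "integral\<^sup>L \<pi> h = L \<Psi> / A" by blast
    have "(\<Psi>, s) \<in> G" unfolding G_def using \<phi> \<Psi>(1) h0 h1 by (auto simp: Z_def S_def intro!: exI[of _ \<phi>])
    then show "integral\<^sup>L \<pi> h = s / A" using \<Psi>(2) LG by simp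
  next
    have c: "continuous_on UNIV (\<lambda>z::'a\<times>'a\<times>real. min 1 (max 0 (snd (snd z))))" by (intro continuous_intros)
    from rep[OF continuous_on_subset[OF c] borel_measurable_continuous_onI[OF c]] obtain \<Psi> where
      \<Psi>: "\<forall>z\<in>Z. ap \<Psi> z = min 1 (max 0 (snd (snd z)))" "integral\<^sup>L \<pi> (\<lambda>z. min 1 (max 0 (snd (snd z)))) = L \<Psi> / A" by auto
    \<comment> \<open>The tag is 0 on the first copy and 1 on the second, so the first term of
      \<open>p\<close> contributes nothing and the second at most 1: the mass of the constraint part
      is at most \<open>1 / A\<close>.\<close>
    have "p \<Psi> \<le> (1 / d) * (\<integral>x. indicator K x * 0 \<partial>M) + 1"
      by (rule pmono) (use \<Psi>(1) in \<open>auto simp: Z_def\<close>)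
    then have "L \<Psi> \<le> 1" using Lp[of \<Psi>] by simp
    then show "integral\<^sup>L \<pi> (\<lambda>z. min 1 (max 0 (snd (snd z)))) \<le> 1 / A" unfolding \<Psi>(2) using Apos by (simp add: divide_right_mono)
  next
    fix N :: "'a set" assume N: "N \<in> sets borel" "measure M N = 0"
    define T0 where "T0 = {z::'a\<times>'a\<times>real. snd (snd z) = 0}"
    have T0: "T0 \<in> sets \<pi>" unfolding \<pi>(2) T0_def by (intro borel_closed closed_Collect_eq continuous_intros)
    define \<nu> where "\<nu> = distr (density \<pi> (indicator T0)) borel fst"
    have fm: "fst \<in> measurable (density \<pi> (indicator T0)) borel"
    proof -
      have "fst \<in> borel_measurable (borel :: ('a\<times>'a\<times>real) measure)"
        by (rule borel_measurable_continuous_onI) (rule continuous_on_fst[OF continuous_on_id])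
      then show ?thesis using measurable_cong_sets[OF \<pi>(2) refl] by auto
    qed
    have \<nu>: "finite_measure \<nu>" "sets \<nu> = sets borel"
      unfolding \<nu>_def using finite_measure.finite_measure_distr[OF \<pi>.finite_measure_restricted[OF T0] fm] by simp_all
    interpret \<nu>: finite_measure \<nu> by fact
    have e\<nu>: "emeasure \<nu> B = emeasure \<pi> (T0 \<inter> fst -` B)" if B: "B \<in> sets borel" for B
    proof -
      have "fst -` B \<inter> space (density \<pi> (indicator T0)) \<in> sets (density \<pi> (indicator T0))" using measurable_sets[OF fm B] .
      then have "fst -` B \<in> sets \<pi>" using sp\<pi> by simp
      then show ?thesis unfolding \<nu>_def using emeasure_distr[OF fm B] emeasure_restricted[OF T0, of "fst -` B"] sp\<pi> by simp
    qed
    \<comment> \<open>For functions supported on tag 0 the functional is dominated by an integral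
      over \<open>K\<close> against \<open>M\<close> divided by \<open>d\<close>. Testing with
      cutoffs of small neighbourhoods of \<open>C\<close> shows that the tag 0 part charges no
      \<open>M\<close>-null compact set.\<close>
    have zero: "measure \<nu> C = 0" if C: "compact C" "C \<subseteq> N" for C
    proof -
      have Cb: "C \<in> sets borel" using C(1) by (simp add: compact_imp_closed borel_closed)
      have MC: "measure M C = 0"
        using M.finite_measure_mono[OF C(2)] N M(2) by (simp add: measure_le_0_iff)
      have "measure \<nu> C \<le> e / (d * A)" if e: "e > 0" for e
      proof -
        obtain U where U: "open U" "C \<subseteq> U" "measure M (U - C) < e" using outer_open_approx[OF M Cb e] by blast
        have "measure M U = measure M C + measure M (U - C)"
          using M.finite_measure_Union[of C "U - C"] U Cb M(2) by (simp add: Un_absorb1)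
        then have MU: "measure M U < e" using U(3) MC by simp
        obtain u :: "'a \<Rightarrow> real" where u: "continuous_on UNIV u" "\<And>x. u x \<in> closed_segment 0 1" "\<And>x. x \<in> -U \<Longrightarrow> u x = 0" "\<And>x. x \<in> C \<Longrightarrow> u x = 1"
          by (rule Urysohn[of "-U" C 0 1]) (use U C compact_imp_closed in auto)
        have u01: "0 \<le> u x" "u x \<le> 1" for x using u(2)[of x] by (auto simp: closed_segment_eq_real_ivl split: if_splits)
        \<comment> \<open>The second factor is 1 on tag 0 and 0 on tag 1, which restricts the cutoff
          continuously to the first copy.\<close>
        define h where "h z = u (fst z) * (1 - min 1 (max 0 (snd (snd z))))" for z :: "'a\<times>'a\<times>real"
        have hc: "continuous_on UNIV h" unfolding h_def
          by (intro continuous_intros continuous_on_compose2[OF u(1)]) auto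
        from rep[OF continuous_on_subset[OF hc] borel_measurable_continuous_onI[OF hc]] obtain \<Psi> where
          \<Psi>: "\<forall>z\<in>Z. ap \<Psi> z = h z" "integral\<^sup>L \<pi> h = L \<Psi> / A" by auto
        have um: "u \<in> borel_measurable M" using borel_measurable_continuous_onI[OF u(1)] measurable_cong_sets[OF M(2) refl] by blast
        have iu: "integrable M (\<lambda>x. indicator K x * u x)"
        proof (rule M.integrable_const_bound[of _ 1])
          show "(\<lambda>x. indicator K x * u x) \<in> borel_measurable M" using um Kb M(2) by (intro borel_measurable_times borel_measurable_indicator) auto
          show "AE x in M. norm (indicator K x * u x) \<le> 1" using u01 by (auto simp: indicator_def)
        qed
        have "p \<Psi> \<le> (1 / d) * (\<integral>x. indicator K x * u x \<partial>M) + 0"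
          by (rule pmono) (use \<Psi>(1) iu in \<open>auto simp: Z_def h_def\<close>)
        moreover have "(\<integral>x. indicator K x * u x \<partial>M) \<le> (\<integral>x. indicator U x \<partial>M)"
        proof (rule integral_mono[OF iu])
          show "integrable M (indicator U :: 'a \<Rightarrow> real)" using U(1) M(2) by (simp add: integrable_indicator_iff less_top[symmetric])
          show "indicator K x * u x \<le> indicator U x" for x using u(3)[of x] u01[of x] by (auto simp: indicator_def)
        qed
        moreover have "(\<integral>x. indicator U x \<partial>M) = measure M U" using spM by simp
        ultimately have "L \<Psi> \<le> (1 / d) * e"
          using Lp[of \<Psi>] MU d mult_left_mono[of "\<integral>x. indicator K x * u x \<partial>M" e "1 / d"] by simp
        then have hi: "integral\<^sup>L \<pi> h \<le> e / (d * A)" unfolding \<Psi>(2) using Apos d by (simp add: field_simps)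
        have TC: "T0 \<inter> fst -` C \<in> sets \<pi>" unfolding \<pi>(2) T0_def
          using C(1) by (intro borel_closed closed_Int closed_Collect_eq closed_vimage_fst compact_imp_closed continuous_intros)
        have "measure \<nu> C = measure \<pi> (T0 \<inter> fst -` C)" using e\<nu>[OF Cb] by (simp add: measure_def)
        also have "\<dots> = (\<integral>z. indicator (T0 \<inter> fst -` C) z \<partial>\<pi>)" using sp\<pi> by simp
        also have "\<dots> \<le> integral\<^sup>L \<pi> h"
        proof (rule integral_mono)
          show "integrable \<pi> (indicator (T0 \<inter> fst -` C) :: _ \<Rightarrow> real)"
            using TC by (simp add: integrable_indicator_iff less_top[symmetric])
          show "integrable \<pi> h"
          proof (rule \<pi>.integrable_const_bound[of _ 1])
            show "h \<in> borel_measurable \<pi>" using borel_measurable_continuous_onI[OF hc] measurable_cong_sets[OF \<pi>(2) refl] by blast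
            have "\<bar>h z\<bar> \<le> 1" for z
            proof -
              have "\<bar>u (fst z)\<bar> * \<bar>1 - min 1 (max 0 (snd (snd z)))\<bar> \<le> 1 * 1" using u01[of "fst z"] by (intro mult_mono) auto
              then show ?thesis by (simp add: h_def abs_mult)
            qed
            then show "AE z in \<pi>. norm (h z) \<le> 1" by simp
          qed
          show "indicator (T0 \<inter> fst -` C) z \<le> h z" for z
            using u(4)[of "fst z"] u01[of "fst z"] by (auto simp: indicator_def h_def T0_def)
        qed
        finally show ?thesis using hi by linarith
      qed
      then have "measure \<nu> C \<le> 0 + \<eta>" if "\<eta> > 0" for \<eta>
      proof -
        have "\<eta> * (d * A) > 0" using \<open>\<eta> > 0\<close> d Apos by simp
        from \<open>\<And>e. e > 0 \<Longrightarrow> measure \<nu> C \<le> e / (d * A)\<close>[OF this] show ?thesis using d Apos by simp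
      qed
      then have "measure \<nu> C \<le> 0" by (rule field_le_epsilon)
      then show ?thesis by (simp add: measure_le_0_iff)
    qed
    have "measure \<nu> N < \<eta>" if \<eta>: "\<eta> > 0" for \<eta>
    proof -
      obtain C where C: "compact C" "C \<subseteq> N" "measure \<nu> (N - C) < \<eta>" using inner_compact_approx[OF \<nu> N(1) \<eta>] by blast
      have "measure \<nu> (N - C) = measure \<nu> N - measure \<nu> C"
        by (rule \<nu>.finite_measure_Diff) (use C N(1) \<nu>(2) in \<open>auto simp: compact_imp_closed borel_closed\<close>)
      then show ?thesis using zero[OF C(1,2)] C(3) by simp
    qed
    then have "measure \<nu> N = 0" using measure_nonneg[of \<nu> N] by (metis less_le not_less_iff_gr_or_eq)
    then have "emeasure \<pi> (T0 \<inter> fst -` N) = 0" using e\<nu>[OF N(1)] by (simp add: \<nu>.emeasure_eq_measure)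
    moreover have "T0 \<inter> fst -` N \<in> sets \<pi>"
      using T0 measurable_sets[OF fm N(1)] sp\<pi> by auto
    ultimately have "T0 \<inter> fst -` N \<in> null_sets \<pi>" by (simp add: null_setsI)
    then show "AE z in \<pi>. snd (snd z) = 0 \<longrightarrow> fst z \<notin> N"
      by (rule AE_I') (auto simp: T0_def)
  qed
qed

text \<open>The parts of \<pi> with tags 0 and 1 play the roles of \<open>h\<close> times the
  measure and of \<open>T'\<close>, both scaled by \<open>1 / A\<close>. The gap \<theta> < 1
  produces the contradiction: pairing \<open>f\<close> with the first gives \<open>1 / A\<close>,
  pairing its Borel restriction \<open>u\<close> with the second gives at most
  \<open>\<theta> / A\<close>, and orthogonality makes the two equal.\<close>

lemma gradients_dense_under_bound:
  fixes M \<mu> :: "'a::euclidean_space measure" and f :: "'a \<Rightarrow> 'a" and w :: "'a \<Rightarrow> real"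
  assumes M: "finite_measure M" "sets M = sets borel" and \<Omega>: "open \<Omega>"
    and M\<mu>: "\<And>A. A \<in> sets borel \<Longrightarrow> A \<subseteq> \<Omega> \<Longrightarrow> measure \<mu> A = measure M A"
    and K: "compact K" "K \<subseteq> \<Omega>" and f: "continuous_on K f"
    and w: "continuous_on UNIV w" "c > 0" "\<And>x. c \<le> w x"
    and \<theta>: "0 \<le> \<theta>" "\<theta> < 1" "\<And>x. x \<in> K \<Longrightarrow> norm (f x) \<le> \<theta> * w x"
    and perp: "AE x in M. x \<in> K \<longrightarrow> (\<forall>v\<in>decomp_set \<mu> x. inner (f x) v = 0)" and d: "d > 0"
  shows "\<exists>\<phi>. test_function \<phi> \<and> (\<forall>x. norm (grad \<phi> x) \<le> w x) \<and>
    (\<integral>x. indicator K x * norm (f x - grad \<phi> x) \<partial>M) < d"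
proof (rule ccontr)
  assume "\<not> ?thesis"
  then have neg: "d \<le> (\<integral>x. indicator K x * norm (f x - grad \<phi> x) \<partial>M)"
    if "test_function \<phi>" "\<And>x. norm (grad \<phi> x) \<le> w x" for \<phi> using that by (meson not_less)
  obtain \<pi> :: "('a \<times> 'a \<times> real) measure" and A :: real
    where \<pi>: "prob_space \<pi>" "sets \<pi> = sets borel" and A: "A > 0"
    and \<pi>Z: "AE z in \<pi>. z \<in> K \<times> sphere 0 1 \<times> {0} \<union> cball 0 1 \<times> sphere 0 1 \<times> {1}"
    and F1: "\<And>\<phi> s h. test_function \<phi> \<Longrightarrow> h \<in> borel_measurable borel \<Longrightarrow>
      (\<And>x e. x \<in> K \<Longrightarrow> norm e = 1 \<Longrightarrow> h (x, e, 0) = inner (s *\<^sub>R f x - grad \<phi> x) e) \<Longrightarrow>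
      (\<And>y e. norm y \<le> 1 \<Longrightarrow> norm e = 1 \<Longrightarrow> h (y, e, 1) = ball_field w \<phi> y e) \<Longrightarrow> integral\<^sup>L \<pi> h = s / A"
    and F3: "integral\<^sup>L \<pi> (\<lambda>z. min 1 (max 0 (snd (snd z)))) \<le> 1 / A"
    and F4: "\<And>N. N \<in> sets borel \<Longrightarrow> measure M N = 0 \<Longrightarrow> AE z in \<pi>. snd (snd z) = 0 \<longrightarrow> fst z \<notin> N"
    by (rule separating_measure[OF M K(1) f w d neg]) blast+
  interpret M: finite_measure M by fact
  interpret \<pi>: prob_space \<pi> by fact
  have wpos: "0 < w x" for x using w(2,3) less_le_trans by blast
  have sp\<pi>: "space \<pi> = UNIV" using sets_eq_imp_space_eq[OF \<pi>(2)] by simp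
  have Kb: "K \<in> sets borel" using K(1) by (simp add: compact_imp_closed borel_closed)
  have fm[measurable]: "fst \<in> borel_measurable (borel :: ('a\<times>'a\<times>real) measure)"
    by (rule borel_measurable_continuous_onI) (rule continuous_on_fst[OF continuous_on_id])
  have em[measurable]: "(\<lambda>z. fst (snd z)) \<in> borel_measurable (borel :: ('a\<times>'a\<times>real) measure)"
    by (rule borel_measurable_continuous_onI) (intro continuous_intros)
  have tm[measurable]: "(\<lambda>z. snd (snd z)) \<in> borel_measurable (borel :: ('a\<times>'a\<times>real) measure)"
    by (rule borel_measurable_continuous_onI) (intro continuous_intros)
  have wm[measurable]: "w \<in> borel_measurable borel" using w(1) by (rule borel_measurable_continuous_onI)
  have bm[measurable]: "blow \<in> borel_measurable (borel :: 'a measure)" unfolding blow_def[abs_def] by measurable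
  \<comment> \<open>\<open>P\<close> returns to the Euclidean space and \<open>gv\<close> is the
    vector carried there: minus the direction on tag 0, the direction divided by \<open>w\<close> on
    tag 1. Points of the boundary sphere go to 0 with vector 0. The cutoff on the direction in
    \<open>gv\<close> keeps it bounded off the support of \<pi>.\<close>
  define P where "P z = (if snd (snd z) = 0 then fst z else if norm (fst z) < 1 then blow (fst z) else 0)" for z :: "'a\<times>'a\<times>real"
  define gv where "gv z = (if norm (fst (snd z)) \<le> 1 then
      (if snd (snd z) = 0 then - fst (snd z) else if norm (fst z) < 1 then (1 / w (blow (fst z))) *\<^sub>R fst (snd z) else 0) else 0)"
    for z :: "'a\<times>'a\<times>real"
  have Pm: "P \<in> borel_measurable borel" unfolding P_def[abs_def] by measurable
  have gm: "gv \<in> borel_measurable borel" unfolding gv_def[abs_def] by measurable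
  have gb: "norm (gv z) \<le> 1 + 1 / c" for z
  proof -
    have b1: "1 / w y * norm e \<le> 1 / c * 1" if "norm e \<le> 1" for y and e :: 'a
      using that w(2) w(3)[of y] wpos[of y] by (intro mult_mono divide_left_mono) auto
    have b2: "norm e \<le> 1 + 1 / c" "norm e / w y \<le> 1 + 1 / c" if "norm e \<le> 1" for y and e :: 'a
    proof -
      have ic: "0 < 1 / c" using w(2) by simp
      show "norm e \<le> 1 + 1 / c" using that ic by linarith
      have "norm e / w y = 1 / w y * norm e" by simp
      then show "norm e / w y \<le> 1 + 1 / c" using b1[OF that, of y] ic by linarith
    qed
    show ?thesis unfolding gv_def using b2 w(2) wpos by (auto simp: less_imp_le)
  qed
  have P\<pi>: "P \<in> measurable \<pi> borel" and g\<pi>: "gv \<in> borel_measurable \<pi>"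
    using Pm gm measurable_cong_sets[OF \<pi>(2) refl] by blast+
  \<comment> \<open>The part coming from the constraint may be singular to \<open>M\<close>. Adding
    the image of \<pi> to \<open>M\<close> gives one measure \<open>lam\<close> with respect to
    which both \<open>M\<close> and the divergence-free field have densities.\<close>
  define D where "D = distr \<pi> borel P"
  obtain lam where lams: "sets lam = sets M" and lame: "\<And>B. B \<in> sets M \<Longrightarrow> emeasure lam B = emeasure M B + emeasure D B"
    using measure_add[of D M] M(2) unfolding D_def by auto
  have lamb: "sets lam = sets borel" using lams M(2) by simp
  have spl: "space lam = UNIV" using sets_eq_imp_space_eq[OF lamb] by simp
  interpret D: prob_space D unfolding D_def by (rule \<pi>.prob_space_distr[OF P\<pi>])
  have lamf: "finite_measure lam"
    by standard (use lame[of UNIV] M(2) spl M.emeasure_finite[of UNIV] D.emeasure_finite[of UNIV] in simp)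
  interpret lam: finite_measure lam by fact
  have null: "emeasure M N = 0" "emeasure \<pi> (P -` N \<inter> space \<pi>) = 0" if "N \<in> null_sets lam" for N
  proof -
    have Nb: "N \<in> sets borel" using that lamb by auto
    have "emeasure M N + emeasure D N = 0" using that lame[of N] Nb M(2) by auto
    then show "emeasure M N = 0" "emeasure \<pi> (P -` N \<inter> space \<pi>) = 0"
      using emeasure_distr[OF P\<pi> Nb] unfolding D_def by auto
  qed
  obtain b where b: "b \<in> borel_measurable borel" "integrable lam b"
    and bu: "\<And>u C. u \<in> borel_measurable borel \<Longrightarrow> (\<And>x. norm (u x) \<le> C) \<Longrightarrow>
       (\<integral>z. inner (u (P z)) (gv z) \<partial>\<pi>) = (\<integral>x. inner (u x) (b x) \<partial>lam)"
    by (rule vector_disintegration[OF \<pi>.finite_measure_axioms lamf lamb P\<pi> g\<pi> gb null(2)]) blast+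
  have divb: "div_free lam b"
    unfolding div_free_def
  proof (intro allI impI)
    fix \<phi> :: "'a \<Rightarrow> real" assume \<phi>: "test_function \<phi>"
    obtain C where C: "\<And>x. norm (grad \<phi> x) \<le> C" using grad_bounded[OF \<phi>] by blast
    have gc: "continuous_on UNIV (grad \<phi>)" using test_function_C1_gradient[OF \<phi>] unfolding C1_gradient_def by blast
    have gr[measurable]: "grad \<phi> \<in> borel_measurable borel" using gc by (rule borel_measurable_continuous_onI)
    have hm: "(\<lambda>z. inner (grad \<phi> (P z)) (gv z)) \<in> borel_measurable borel" using Pm gm by measurable
    \<comment> \<open>The representation formula with \<open>s = 0\<close>: the pairing of a
      gradient with itself across the two copies cancels, which is the divergence
      constraint.\<close>
    have "(\<integral>z. inner (grad \<phi> (P z)) (gv z) \<partial>\<pi>) = 0 / A"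
    proof (rule F1[OF \<phi> hm])
      show "inner (grad \<phi> (P (x, e, 0))) (gv (x, e, 0)) = inner (0 *\<^sub>R f x - grad \<phi> x) e" if "norm e = 1" for x e
        using that by (simp add: P_def gv_def)
      show "inner (grad \<phi> (P (y, e, 1))) (gv (y, e, 1)) = ball_field w \<phi> y e" if "norm e = 1" for y e
        using that by (simp add: P_def gv_def ball_field_def)
    qed
    then show "(\<integral>y. inner (grad \<phi> y) (b y) \<partial>lam) = 0" using bu[OF gr C] by simp
  qed
  obtain k where k: "k \<in> borel_measurable borel" "\<And>x. 0 \<le> k x" "integrable lam k" "M = density lam (\<lambda>x. ennreal (k x))"
    by (rule finite_density_exists[OF lamf lamb M null(1)]) blast+
  have km[measurable]: "k \<in> borel_measurable lam" using k(1) measurable_cong_sets[OF lamb refl] by blast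
  have mk: "measure M B = (\<integral>x. indicator B x * k x \<partial>lam)" if B: "B \<in> sets borel" for B
  proof -
    have Bl: "B \<in> sets lam" using B lamb by simp
    have "emeasure M B = (\<integral>\<^sup>+x. ennreal (k x) * indicator B x \<partial>lam)"
      unfolding k(4) by (rule emeasure_density) (use Bl in auto)
    also have "\<dots> = (\<integral>\<^sup>+x. ennreal (indicator B x * k x) \<partial>lam)"
      by (intro nn_integral_cong) (auto simp: indicator_def)
    also have "\<dots> = ennreal (\<integral>x. indicator B x * k x \<partial>lam)"
      by (rule nn_integral_eq_integral) (use integrable_mult_indicator[OF Bl k(3)] k(2) in auto)
    finally show ?thesis using k(2) by (simp add: measure_def integral_nonneg_AE)
  qed
  have dec: "AE x in lam. x \<in> \<Omega> \<longrightarrow> 0 < k x \<longrightarrow> (1 / k x) *\<^sub>R b x \<in> decomp_set \<mu> x"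
    by (rule div_free_density_in_decomp_set[OF lamf lamb b(2) divb k(3) \<Omega>]) (use M\<mu> mk in auto)
  have perp': "AE x in lam. 0 < k x \<longrightarrow> x \<in> K \<longrightarrow> (\<forall>v\<in>decomp_set \<mu> x. inner (f x) v = 0)"
  proof -
    have "AE x in density lam (\<lambda>x. ennreal (k x)). x \<in> K \<longrightarrow> (\<forall>v\<in>decomp_set \<mu> x. inner (f x) v = 0)"
      using perp unfolding k(4)[symmetric] .
    then show ?thesis by (subst (asm) AE_density) auto
  qed
  \<comment> \<open>Membership of the density in the bundle is known only where \<open>k\<close> is
    positive; cutting there excludes the part of \<open>lam\<close> singular to
    \<open>M\<close>.\<close>
  define u where "u x = (if 0 < k x then indicator K x *\<^sub>R f x else 0)" for x
  have um: "u \<in> borel_measurable borel"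
  proof -
    have [measurable]: "(\<lambda>x. indicator K x *\<^sub>R f x) \<in> borel_measurable borel"
      by (rule borel_measurable_continuous_on_indicator[OF Kb f])
    have [measurable]: "k \<in> borel_measurable borel" by fact
    show ?thesis unfolding u_def[abs_def] by measurable
  qed
  have ortho: "AE x in lam. inner (u x) (b x) = 0"
    using dec perp'
  proof eventually_elim
    case (elim x)
    show ?case
    proof (cases "0 < k x \<and> x \<in> K")
      case True
      then have "inner (f x) ((1 / k x) *\<^sub>R b x) = 0" using elim K(2) by blast
      then show ?thesis using True by (simp add: u_def)
    qed (auto simp: u_def indicator_def)
  qed
  have "bounded (f ` K)" using compact_continuous_image[OF f K(1)] compact_imp_bounded by blast
  then obtain B where B: "B > 0" "\<And>y. y \<in> f ` K \<Longrightarrow> norm y \<le> B" unfolding bounded_pos by blast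
  have ub: "norm (u x) \<le> B" for x using B by (auto simp: u_def indicator_def less_imp_le)
  have uw: "norm (u x) \<le> \<theta> * w x" for x
    using \<theta>(1) \<theta>(3)[of x] wpos[of x] by (auto simp: u_def indicator_def less_imp_le)
  have int0: "(\<integral>z. inner (u (P z)) (gv z) \<partial>\<pi>) = 0"
    unfolding bu[OF um ub] by (rule integral_eq_zero_AE[OF ortho])
  \<comment> \<open>The pairing of \<open>f\<close> with the tag 0 part, evaluated by the formula
    with \<phi> = 0 and \<open>s = 1\<close>.\<close>
  define q where "q z = (if snd (snd z) = 0 \<and> norm (fst (snd z)) \<le> 1 then inner (indicator K (fst z) *\<^sub>R f (fst z)) (fst (snd z)) else 0)"
    for z :: "'a\<times>'a\<times>real"
  have qm: "q \<in> borel_measurable borel"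
  proof -
    have [measurable]: "(\<lambda>x. indicator K x *\<^sub>R f x) \<in> borel_measurable borel"
      by (rule borel_measurable_continuous_on_indicator[OF Kb f])
    show ?thesis unfolding q_def[abs_def] by measurable
  qed
  have intq: "integral\<^sup>L \<pi> q = 1 / A"
    by (rule F1[OF test_function_zero qm]) (auto simp: q_def grad_zero ball_field_def)
  \<comment> \<open>Cutting \<open>f\<close> down to \<open>k > 0\<close> changes nothing on tag 0,
    because that part of \<pi> does not charge \<open>M\<close>-null sets.\<close>
  have kz: "AE z in \<pi>. snd (snd z) = 0 \<longrightarrow> fst z \<notin> {x. k x = 0}"
  proof (rule F4)
    show s: "{x. k x = 0} \<in> sets borel" using borel_measurable_eq[OF k(1) borel_measurable_const[of 0]] by simp
    have "(\<lambda>x. indicator {x. k x = 0} x * k x) = (\<lambda>x. 0)" by (auto simp: indicator_def)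
    then show "measure M {x. k x = 0} = 0" using mk[OF s] by simp
  qed
  have b\<pi>: "h \<in> borel_measurable \<pi>" if "h \<in> borel_measurable borel" for h :: "'a\<times>'a\<times>real \<Rightarrow> real"
    using that measurable_cong_sets[OF \<pi>(2) refl] by blast
  \<comment> \<open>On tag 0 the integrand is \<open>- q z\<close>; on tag 1 it is at most \<theta>,
    since |u| is at most \<open>\<theta> * w\<close>.\<close>
  have "(\<integral>z. inner (u (P z)) (gv z) \<partial>\<pi>) \<le> (\<integral>z. \<theta> * min 1 (max 0 (snd (snd z))) - q z \<partial>\<pi>)"
  proof (rule integral_mono_AE)
    have "\<bar>inner (u (P z)) (gv z)\<bar> \<le> B * (1 + 1 / c)" for z
    proof -
      have "\<bar>inner (u (P z)) (gv z)\<bar> \<le> norm (u (P z)) * norm (gv z)" by (rule Cauchy_Schwarz_ineq2)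
      also have "\<dots> \<le> B * (1 + 1 / c)" using ub gb B(1) by (intro mult_mono) auto
      finally show ?thesis .
    qed
    moreover have "(\<lambda>z. inner (u (P z)) (gv z)) \<in> borel_measurable borel"
      using um Pm gm by measurable
    ultimately show "integrable \<pi> (\<lambda>z. inner (u (P z)) (gv z))"
      by (intro \<pi>.integrable_const_bound[of _ "B * (1 + 1 / c)"] b\<pi>) auto
    have "\<bar>q z\<bar> \<le> B" for z
    proof (cases "snd (snd z) = 0 \<and> norm (fst (snd z)) \<le> 1")
      case True
      have qz: "q z = inner (indicator K (fst z) *\<^sub>R f (fst z)) (fst (snd z))" using True by (simp add: q_def)
      have "\<bar>q z\<bar> \<le> norm (indicator K (fst z) *\<^sub>R f (fst z)) * norm (fst (snd z))"
        unfolding qz by (rule Cauchy_Schwarz_ineq2)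
      also have "\<dots> \<le> B * 1" using True B by (intro mult_mono) (auto simp: indicator_def less_imp_le)
      finally show ?thesis by simp
    qed (use B in \<open>auto simp: q_def\<close>)
    then have "integrable \<pi> q"
      using qm by (intro \<pi>.integrable_const_bound[of _ B] b\<pi>) auto
    moreover have tint: "integrable \<pi> (\<lambda>z. min 1 (max 0 (snd (snd z))))"
    proof (rule \<pi>.integrable_const_bound[of _ 1])
      have "(\<lambda>z::'a\<times>'a\<times>real. min 1 (max 0 (snd (snd z)))) \<in> borel_measurable borel" by measurable
      then show "(\<lambda>z. min 1 (max 0 (snd (snd z)))) \<in> borel_measurable \<pi>" using measurable_cong_sets[OF \<pi>(2) refl] by blast
    qed auto
    ultimately show "integrable \<pi> (\<lambda>z. \<theta> * min 1 (max 0 (snd (snd z))) - q z)" by auto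
    show "AE z in \<pi>. inner (u (P z)) (gv z) \<le> \<theta> * min 1 (max 0 (snd (snd z))) - q z"
      using \<pi>Z kz
    proof eventually_elim
      case (elim z)
      obtain x e t where z: "z = (x, e, t)" by (cases z) auto
      from elim(1) consider (0) "x \<in> K" "norm e = 1" "t = 0" | (1) "norm x \<le> 1" "norm e = 1" "t = 1" unfolding z by auto
      then show ?case
      proof cases
        case 0
        then have "0 < k x" using elim(2) k(2)[of x] unfolding z by (auto simp: less_le)
        then show ?thesis using 0 unfolding z by (simp add: u_def P_def gv_def q_def)
      next
        case 1
        show ?thesis
        proof (cases "norm x < 1")
          case True
          have "inner (u (blow x)) e \<le> norm (u (blow x)) * norm e" by (rule norm_cauchy_schwarz)
          also have "\<dots> \<le> \<theta> * w (blow x)" using uw 1 by simp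
          finally have "inner (u (blow x)) e / w (blow x) \<le> \<theta>" using wpos[of "blow x"] by (simp add: field_simps)
          then show ?thesis using 1 True unfolding z by (simp add: P_def gv_def q_def)
        next
          case False
          then show ?thesis using 1 \<theta>(1) unfolding z by (simp add: P_def gv_def q_def)
        qed
      qed
    qed
  qed
  then have "0 \<le> (\<integral>z. \<theta> * min 1 (max 0 (snd (snd z))) - q z \<partial>\<pi>)" unfolding int0 .
  also have "\<dots> = \<theta> * integral\<^sup>L \<pi> (\<lambda>z. min 1 (max 0 (snd (snd z)))) - 1 / A"
  proof -
    have "integrable \<pi> q"
    proof (rule ccontr)
      \<comment> \<open>The integral of a function that is not integrable is 0 by default, but this
        one equals \<open>1 / A\<close>.\<close>
      assume "\<not> integrable \<pi> q"
      then show False using not_integrable_integral_eq[of \<pi> q] intq A by simp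
    qed
    moreover have "integrable \<pi> (\<lambda>z. min 1 (max 0 (snd (snd z))))"
    proof (rule \<pi>.integrable_const_bound[of _ 1])
      have "(\<lambda>z::'a\<times>'a\<times>real. min 1 (max 0 (snd (snd z)))) \<in> borel_measurable borel" by measurable
      then show "(\<lambda>z. min 1 (max 0 (snd (snd z)))) \<in> borel_measurable \<pi>" using measurable_cong_sets[OF \<pi>(2) refl] by blast
    qed auto
    ultimately show ?thesis using intq by simp
  qed
  also have "\<dots> \<le> \<theta> * (1 / A) - 1 / A" using F3 \<theta>(1) by (simp add: mult_left_mono del: times_divide_eq_right)
  also have "\<dots> < 0" using A \<theta>(2) by (simp add: field_simps)
  finally show False by simp
qed

section \<open>Norm estimates and the theorem\<close>

text \<open>Positive total mass excludes the value \<open>-\<infinity>\<close>, which the essential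
  supremum takes on a null space.\<close>

lemma esssup_nonneg:
  assumes [measurable]: "h \<in> borel_measurable M" and "\<And>x. 0 \<le> h x" and "emeasure M (space M) \<noteq> 0"
  shows "0 \<le> esssup M (\<lambda>x. ereal (h x))"
proof (rule ccontr)
  assume "\<not> ?thesis"
  then have neg: "esssup M (\<lambda>x. ereal (h x)) < 0" by simp
  have "AE x in M. ereal (h x) \<le> esssup M (\<lambda>x. ereal (h x))" by (rule esssup_AE)
  then have "AE x in M. False"
  proof eventually_elim
    case (elim x)
    then have "ereal (h x) < 0" using neg by (rule le_less_trans)
    then show False using assms(2)[of x] by simp
  qed
  then have "emeasure M (space M) = 0" by (simp add: AE_iff_measurable[of "space M"])
  then show False using assms(3) by simp
qed

lemma Lp_norm_zero_le:
  assumes h: "h \<in> borel_measurable M" "\<And>x. 0 \<le> h x" and p: "1 \<le> p" and c: "0 \<le> c"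
  shows "Lp_norm M (\<lambda>x. 0) p \<le> ereal c * Lp_norm M h p"
proof (cases "p = \<infinity>")
  case True
  show ?thesis
  proof (cases "emeasure M (space M) = 0")
    case True': True
    \<comment> \<open>On a null space the left-hand side is \<open>-\<infinity>\<close> when
      \<open>p\<close> is infinite, so the bound holds whatever the right-hand side is.\<close>
    have "AE x in M. ereal 0 \<le> -\<infinity>"
      by (rule AE_I'[of "space M"]) (auto simp: True' null_setsI)
    then have "esssup M (\<lambda>x. ereal 0) \<le> -\<infinity>" by (intro esssup_I) auto
    then show ?thesis using True by (simp add: Lp_norm_def)
  next
    case False
    have "esssup M (\<lambda>x. ereal 0) \<le> 0" by (intro esssup_I) auto
    also have "0 \<le> ereal c * esssup M (\<lambda>x. ereal (h x))"
      using esssup_nonneg[OF h False] c by (intro ereal_0_le_mult) auto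
    finally show ?thesis using True by (simp add: Lp_norm_def)
  qed
next
  case False
  have "0 \<le> Lp_norm M h p" using False by (simp add: Lp_norm_def Let_def)
  then have "0 \<le> ereal c * Lp_norm M h p" using c by (intro ereal_0_le_mult) auto
  moreover have "Lp_norm M (\<lambda>x. 0) p = 0" using False by (simp add: Lp_norm_def Let_def zero_ereal_def)
  ultimately show ?thesis by simp
qed

text \<open>The set where \<open>b\<close> exceeds \<open>M0 / \<rho>\<close> has mass at least
  \<eta>, so the q-th power integral of \<open>b\<close> is at least
  \<open>(M0 / \<rho>) powr q * \<eta>\<close>. This absorbs both errors, the level \<open>D\<close>
  and the values up to \<open>\<rho> * M0\<close> on \<open>E\<close>, and smallness prescribed once
  in terms of \<eta> serves every exponent. One factor \<rho> comes from the pointwise bound, one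
  from \<open>M0 / \<rho>\<close> against \<open>M0\<close>, one from the two errors.\<close>

lemma Lp_norm_le_of_domination:
  assumes N: "finite_measure N" and a: "a \<in> borel_measurable N" "\<And>x. 0 \<le> a x"
    and b: "b \<in> borel_measurable N" "\<And>x. 0 \<le> b x" and E: "E \<in> sets N"
    and \<rho>: "\<rho> > 1" and M0: "M0 > 0" and \<eta>: "\<eta> > 0" and D: "D > 0" "D \<le> M0"
    and dom: "\<And>x. x \<in> space N \<Longrightarrow> a x \<le> \<rho> * b x \<or> a x \<le> D \<or> x \<in> E \<and> a x \<le> \<rho> * M0"
    and Em: "measure N E \<le> (\<rho> - 1) / 2 * \<eta>" and Dm: "D * measure N (space N) \<le> (\<rho> - 1) / 2 * \<eta> * M0"
    and big: "\<eta> \<le> measure N {x \<in> space N. M0 / \<rho> < b x}" and p: "1 \<le> (p::ereal)"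
  shows "Lp_norm N a p \<le> ereal (\<rho> ^ 3) * Lp_norm N b p"
proof -
  interpret finite_measure N by fact
  have \<rho>0: "\<rho> > 0" using \<rho> by simp
  define Bg where "Bg = {x \<in> space N. M0 / \<rho> < b x}"
  have Bgs: "Bg \<in> sets N" unfolding Bg_def using b(1) by measurable
  show ?thesis
  proof (cases "p = \<infinity>")
    case True
    define S where "S = esssup N (\<lambda>x. ereal (b x))"
    have bS: "AE x in N. ereal (b x) \<le> S" unfolding S_def by (rule esssup_AE)
    \<comment> \<open>The counterpart for infinite \<open>p\<close> of the lower bound by mass:
      \<open>b\<close> exceeds \<open>M0 / \<rho>\<close> on a set of positive measure.\<close>
    have SM: "ereal (M0 / \<rho>) \<le> S"
    proof (rule ccontr)
      assume "\<not> ?thesis"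
      then have "S < ereal (M0 / \<rho>)" by simp
      then have "AE x in N. x \<notin> Bg"
        using bS by (auto elim!: eventually_mono simp: Bg_def dest!: le_less_trans)
      then have "measure N Bg = 0" using Bgs by (simp add: measure_eq_0_null_sets AE_iff_null_sets)
      then show False using big \<eta> unfolding Bg_def by simp
    qed
    have "AE x in N. ereal (a x) \<le> ereal (\<rho>^3) * S"
      using bS AE_space
    proof eventually_elim
      case (elim x)
      show ?case
      proof (cases "S = \<infinity>")
        case True
        then show ?thesis using \<rho>0 by simp
      next
        case False
        then obtain s where s: "S = ereal s" using SM by (cases S) auto
        have sM: "M0 \<le> \<rho> * s" "b x \<le> s" using SM elim(1) \<rho>0 unfolding s by (simp_all add: field_simps)
        have s0: "s > 0" using sM(1) M0 \<rho>0 by (smt (verit) mult_nonneg_nonpos)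
        have r3: "\<rho> * s \<le> \<rho>^3 * s" "\<rho> * (\<rho> * s) \<le> \<rho>^3 * s" "M0 \<le> \<rho> * M0"
        proof -
          have "\<rho> \<le> \<rho>^3" using self_le_power[of \<rho> 3] \<rho> by simp
          moreover have "\<rho>^2 \<le> \<rho>^3" using \<rho> by (intro power_increasing) auto
          ultimately show "\<rho> * s \<le> \<rho>^3 * s" "\<rho> * (\<rho> * s) \<le> \<rho>^3 * s"
            using s0 mult_right_mono[of "\<rho>^2" "\<rho>^3" s] by (auto simp: power2_eq_square mult.assoc)
          show "M0 \<le> \<rho> * M0" using \<rho> M0 by simp
        qed
        have "\<rho> * b x \<le> \<rho> * s" "\<rho> * M0 \<le> \<rho> * (\<rho> * s)" using sM \<rho>0 by (auto intro!: mult_left_mono)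
        then have "a x \<le> \<rho>^3 * s" using dom[OF elim(2)] r3 D(2) by linarith
        then show ?thesis by (simp add: s)
      qed
    qed
    then have "esssup N (\<lambda>x. ereal (a x)) \<le> ereal (\<rho>^3) * S" by (intro esssup_I) (use a(1) in auto)
    then show ?thesis using True by (simp add: Lp_norm_def S_def)
  next
    case False
    then obtain q where q: "p = ereal q" "1 \<le> q" using p by (cases p) auto
    define Ia where "Ia = (\<integral>\<^sup>+x. ennreal (a x powr q) \<partial>N)"
    define Ib where "Ib = (\<integral>\<^sup>+x. ennreal (b x powr q) \<partial>N)"
    have La: "Lp_norm N a p = (if Ia = \<infinity> then \<infinity> else ereal (enn2real Ia powr (1 / q)))"
      and Lb: "Lp_norm N b p = (if Ib = \<infinity> then \<infinity> else ereal (enn2real Ib powr (1 / q)))"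
      unfolding Lp_norm_def Ia_def Ib_def q(1) by (simp_all add: Let_def)
    show ?thesis
    proof (cases "Ib = \<infinity>")
      case True
      then show ?thesis unfolding Lb using \<rho>0 by simp
    next
      case False
      define J where "J = enn2real Ib"
      have J: "Ib = ennreal J" "0 \<le> J" unfolding J_def using False by (simp_all add: less_top)
      define n where "n = measure N (space N)"
      have Jlow: "(M0 / \<rho>) powr q * \<eta> \<le> J"
      proof -
        have "ennreal ((M0 / \<rho>) powr q * measure N Bg) = (\<integral>\<^sup>+x. ennreal ((M0 / \<rho>) powr q) * indicator Bg x \<partial>N)"
          using Bgs by (simp add: nn_integral_cmult_indicator emeasure_eq_measure ennreal_mult)
        also have "\<dots> \<le> Ib" unfolding Ib_def
        proof (rule nn_integral_mono)
          fix x
          have "(M0 / \<rho>) powr q \<le> b x powr q" if "x \<in> Bg"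
            using that M0 \<rho>0 q(2) by (intro powr_mono2) (auto simp: Bg_def)
          then show "ennreal ((M0 / \<rho>) powr q) * indicator Bg x \<le> ennreal (b x powr q)"
            by (auto simp: indicator_def intro!: ennreal_leI)
        qed
        finally have "(M0 / \<rho>) powr q * measure N Bg \<le> J" unfolding J(1) using J(2) by simp
        moreover have "(M0 / \<rho>) powr q * \<eta> \<le> (M0 / \<rho>) powr q * measure N Bg"
          using big unfolding Bg_def by (intro mult_left_mono) auto
        ultimately show ?thesis by linarith
      qed
      have Jlow': "M0 powr q * \<eta> \<le> \<rho> powr q * J"
      proof -
        have "M0 powr q = \<rho> powr q * (M0 / \<rho>) powr q" using M0 \<rho>0 by (simp add: powr_divide)
        then have "M0 powr q * \<eta> = \<rho> powr q * ((M0 / \<rho>) powr q * \<eta>)" by simp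
        also have "\<dots> \<le> \<rho> powr q * J" using Jlow by (intro mult_left_mono) auto
        finally show ?thesis .
      qed
      have "Ia \<le> (\<integral>\<^sup>+x. ennreal (\<rho> powr q) * ennreal (b x powr q) + ennreal (D powr q) + ennreal ((\<rho> * M0) powr q) * indicator E x \<partial>N)"
        unfolding Ia_def
      proof (rule nn_integral_mono)
        fix x assume "x \<in> space N"
        from dom[OF this] consider "a x \<le> \<rho> * b x" | "a x \<le> D" | "x \<in> E" "a x \<le> \<rho> * M0" by blast
        then show "ennreal (a x powr q) \<le> ennreal (\<rho> powr q) * ennreal (b x powr q) + ennreal (D powr q) + ennreal ((\<rho> * M0) powr q) * indicator E x"
        proof cases
          case 1
          have "a x powr q \<le> (\<rho> * b x) powr q" using 1 a(2) q(2) by (intro powr_mono2) auto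
          also have "\<dots> = \<rho> powr q * b x powr q" using b(2)[of x] \<rho>0 by (simp add: powr_mult)
          finally have "ennreal (a x powr q) \<le> ennreal (\<rho> powr q) * ennreal (b x powr q)"
            by (simp add: ennreal_mult[symmetric] ennreal_leI)
          then show ?thesis by (simp add: add_increasing2 add.assoc)
        next
          case 2
          have "a x powr q \<le> D powr q" using 2 a(2) q(2) by (intro powr_mono2) auto
          then have "ennreal (a x powr q) \<le> ennreal (D powr q)" by (rule ennreal_leI)
          then show ?thesis by (simp add: add_increasing add_increasing2)
        next
          case 3
          have "a x powr q \<le> (\<rho> * M0) powr q" using 3 a(2) q(2) by (intro powr_mono2) auto
          then have "ennreal (a x powr q) \<le> ennreal ((\<rho> * M0) powr q)" by (rule ennreal_leI)
          then show ?thesis using 3 by (simp add: add_increasing)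
        qed
      qed
      also have "\<dots> = ennreal (\<rho> powr q) * Ib + ennreal (D powr q) * emeasure N (space N) + ennreal ((\<rho> * M0) powr q) * emeasure N E"
        unfolding Ib_def using b(1) E by (simp add: nn_integral_add nn_integral_cmult)
      also have "\<dots> = ennreal (\<rho> powr q * J + D powr q * n + (\<rho> * M0) powr q * measure N E)"
        unfolding J(1) n_def emeasure_eq_measure using J(2) by (simp add: ennreal_mult ennreal_plus)
      also have "\<dots> \<le> ennreal (\<rho> powr (3 * q) * J)"
      proof (rule ennreal_leI)
        have p1: "\<rho> powr q \<ge> 1" using \<rho> q(2) by (simp add: ge_one_powr_ge_zero)
        have t1: "(\<rho> * M0) powr q * measure N E \<le> (\<rho> - 1) / 2 * (\<rho> powr (2 * q) * J)"
        proof -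
          have "(\<rho> * M0) powr q * measure N E \<le> (\<rho> * M0) powr q * ((\<rho> - 1) / 2 * \<eta>)" using Em by (intro mult_left_mono) auto
          also have "\<dots> = (\<rho> - 1) / 2 * (\<rho> powr q * (M0 powr q * \<eta>))" using \<rho>0 M0 by (simp add: powr_mult)
          also have "\<dots> \<le> (\<rho> - 1) / 2 * (\<rho> powr q * (\<rho> powr q * J))" using Jlow' \<rho> by (intro mult_left_mono) auto
          also have "\<rho> powr q * (\<rho> powr q * J) = \<rho> powr (2 * q) * J" by (simp add: powr_add[symmetric] mult.assoc[symmetric])
          finally show ?thesis .
        qed
        have t2: "D powr q * n \<le> (\<rho> - 1) / 2 * (\<rho> powr (2 * q) * J)"
        proof -
          \<comment> \<open>Since \<open>D / M0\<close> is at most 1 and \<open>q\<close> at least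
            1, smallness of \<open>D\<close> to the first power suffices for all \<open>q\<close>
            simultaneously.\<close>
          have "(D / M0) powr q \<le> D / M0" using D M0 q(2) by (intro powr_le_one_le) auto
          moreover have "D powr q = M0 powr q * (D / M0) powr q" using D M0 by (simp add: powr_divide)
          ultimately have "D powr q \<le> M0 powr q * (D / M0)" by (simp add: mult_left_mono del: times_divide_eq_right)
          then have "D powr q * n \<le> M0 powr q * (D / M0) * n" unfolding n_def by (rule mult_right_mono) simp
          also have "\<dots> = M0 powr q * (D * n / M0)" by simp
          also have "\<dots> \<le> M0 powr q * ((\<rho> - 1) / 2 * \<eta>)"
            using Dm M0 unfolding n_def by (intro mult_left_mono) (auto simp: field_simps)
          also have "\<dots> = (\<rho> - 1) / 2 * (M0 powr q * \<eta>)" by simp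
          also have "\<dots> \<le> (\<rho> - 1) / 2 * (\<rho> powr q * J)" using Jlow' \<rho> by (intro mult_left_mono) auto
          also have "\<dots> \<le> (\<rho> - 1) / 2 * (\<rho> powr (2 * q) * J)"
            using \<rho> q(2) J(2) by (intro mult_left_mono mult_right_mono powr_mono) auto
          finally show ?thesis .
        qed
        have t3: "\<rho> powr q * J \<le> \<rho> powr (2 * q) * J" using \<rho> q(2) J(2) by (intro mult_right_mono powr_mono) auto
        have "\<rho> powr q * J + D powr q * n + (\<rho> * M0) powr q * measure N E \<le> \<rho> * (\<rho> powr (2 * q) * J)"
        proof -
          have "\<rho> powr q * J + D powr q * n + (\<rho> * M0) powr q * measure N E
            \<le> \<rho> powr (2 * q) * J + (\<rho> - 1) / 2 * (\<rho> powr (2 * q) * J) + (\<rho> - 1) / 2 * (\<rho> powr (2 * q) * J)"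
            using t1 t2 t3 by linarith
          also have "\<dots> = \<rho> * (\<rho> powr (2 * q) * J)" by (simp add: field_simps)
          finally show ?thesis .
        qed
        also have "\<dots> = \<rho> powr (1 + 2 * q) * J" using \<rho>0 by (simp add: powr_add)
        \<comment> \<open>The single factor \<rho> left by the errors is at most
          \<open>\<rho> powr q\<close>, so after the q-th root it costs no more than \<rho>.\<close>
        also have "\<dots> \<le> \<rho> powr (3 * q) * J" using \<rho> q(2) J(2) by (intro mult_right_mono powr_mono) auto
        finally show "\<rho> powr q * J + D powr q * n + (\<rho> * M0) powr q * measure N E \<le> \<rho> powr (3 * q) * J" .
      qed
      finally have Iab: "Ia \<le> ennreal (\<rho> powr (3 * q) * J)" .
      then have fin: "Ia \<noteq> \<infinity>" by (auto simp: top_unique)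
      have "enn2real Ia \<le> \<rho> powr (3 * q) * J" using Iab J(2) by (metis enn2real_leI mult_nonneg_nonneg powr_ge_zero)
      then have "enn2real Ia powr (1 / q) \<le> (\<rho> powr (3 * q) * J) powr (1 / q)" using q(2) by (intro powr_mono2) auto
      also have "\<dots> = \<rho> ^ 3 * J powr (1 / q)"
      proof -
        have "(\<rho> powr (3 * q)) powr (1 / q) = \<rho> powr 3" using q(2) by (simp add: powr_powr)
        also have "\<dots> = \<rho> ^ 3" using \<rho>0 by (simp add: powr_numeral)
        finally show ?thesis using J(2) by (simp add: powr_mult)
      qed
      finally show ?thesis unfolding La Lb using fin False by (simp add: J_def)
    qed
  qed
qed

lemma norm_blinfun_inner_left: "norm (blinfun_inner_left y) = norm (y :: 'a::euclidean_space)"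
proof (rule antisym)
  show "norm (blinfun_inner_left y) \<le> norm y"
    by (rule norm_blinfun_bound) (auto simp: Cauchy_Schwarz_ineq2 mult.commute[of "norm y"])
  have "norm (blinfun_apply (blinfun_inner_left y) y) \<le> norm (blinfun_inner_left y) * norm y" by (rule norm_blinfun)
  then have "norm y * norm y \<le> norm (blinfun_inner_left y) * norm y" by (simp add: dot_square_norm power2_eq_square)
  then show "norm y \<le> norm (blinfun_inner_left y)"
    by (cases "y = 0") auto
qed

text \<open>\<open>c\<close> is taken within a factor \<rho> above the infimum of the levels
  exceeded with measure below \<eta>, so \<open>c / \<rho>\<close> falls below the infimum. That
  \<eta> is less than the measure of \<open>0 < F x\<close> keeps the infimum positive.\<close>

lemma quantile_level:
  fixes F :: "'a \<Rightarrow> real"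
  assumes M: "finite_measure M" and F[measurable]: "F \<in> borel_measurable M"
    and \<eta>: "\<eta> > 0" "\<eta> < measure M {x \<in> space M. 0 < F x}" and \<rho>: "\<rho> > 1"
  obtains c where "c > 0" "measure M {x \<in> space M. c < F x} < \<eta>" "\<eta> \<le> measure M {x \<in> space M. c / \<rho> < F x}"
proof -
  interpret finite_measure M by fact
  define T where "T c = measure M {x \<in> space M. c < F x}" for c
  have mono: "T c' \<le> T c" if "c \<le> c'" for c c'
    unfolding T_def by (rule finite_measure_mono) (use that in auto)
  have "(\<lambda>n. T (real n)) \<longlonglongrightarrow> measure M (\<Inter>n. {x \<in> space M. real n < F x})"
    unfolding T_def by (rule finite_Lim_measure_decseq) (auto simp: decseq_def)
  moreover have "(\<Inter>n. {x \<in> space M. real n < F x}) = {}"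
  proof (rule equals0I)
    fix x assume "x \<in> (\<Inter>n. {x \<in> space M. real n < F x})"
    then have "real n < F x" for n by auto
    moreover obtain n where "F x < real n" using reals_Archimedean2 by blast
    ultimately show False by (meson less_asym)
  qed
  ultimately have "(\<lambda>n. T (real n)) \<longlonglongrightarrow> 0" by simp
  then have "\<forall>\<^sub>F n in sequentially. T (real n) < \<eta>" using \<eta>(1) by (rule order_tendstoD)
  then obtain n where "T (real n) < \<eta>" by (auto simp: eventually_sequentially)
  then have up: "T (real n + 1) < \<eta>" using mono[of "real n" "real n + 1"] by simp
  have "(\<lambda>n. T (1 / real (Suc n))) \<longlonglongrightarrow> measure M (\<Union>n. {x \<in> space M. 1 / real (Suc n) < F x})"
    unfolding T_def
  proof (rule finite_Lim_measure_incseq)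
    show "incseq (\<lambda>n. {x \<in> space M. 1 / real (Suc n) < F x})"
    proof (rule incseq_SucI, rule subsetI)
      fix n x assume x: "x \<in> {x \<in> space M. 1 / real (Suc n) < F x}"
      have "1 / real (Suc (Suc n)) \<le> 1 / real (Suc n)" by (simp add: field_simps)
      then show "x \<in> {x \<in> space M. 1 / real (Suc (Suc n)) < F x}" using x by auto
    qed
  qed auto
  moreover have "(\<Union>n. {x \<in> space M. 1 / real (Suc n) < F x}) = {x \<in> space M. 0 < F x}"
  proof (intro equalityI subsetI)
    fix x assume "x \<in> (\<Union>n. {x \<in> space M. 1 / real (Suc n) < F x})"
    then obtain n where n: "x \<in> space M" "1 / real (Suc n) < F x" by auto
    have "0 < 1 / real (Suc n)" by simp
    then have "0 < F x" using n(2) by (rule less_trans)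
    then show "x \<in> {x \<in> space M. 0 < F x}" using n(1) by simp
  next
    fix x assume x: "x \<in> {x \<in> space M. 0 < F x}"
    then obtain n where "1 / real (Suc n) < F x" using nat_approx_posE[of "F x"] by auto
    then show "x \<in> (\<Union>n. {x \<in> space M. 1 / real (Suc n) < F x})" using x by auto
  qed
  ultimately have "(\<lambda>n. T (1 / real (Suc n))) \<longlonglongrightarrow> measure M {x \<in> space M. 0 < F x}" by simp
  then have "\<forall>\<^sub>F n in sequentially. \<eta> < T (1 / real (Suc n))" using \<eta>(2) by (rule order_tendstoD)
  then obtain k where k: "\<eta> < T (1 / real (Suc k))" by (auto simp: eventually_sequentially)
  define Cs where "Cs = {c. 0 < c \<and> T c < \<eta>}"
  have ne: "Cs \<noteq> {}" using up unfolding Cs_def by (auto intro!: exI[of _ "real n + 1"])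
  have lb: "1 / real (Suc k) \<le> c" if "c \<in> Cs" for c
    using that k mono[of c "1 / real (Suc k)"] unfolding Cs_def by force
  define c0 where "c0 = Inf Cs"
  have c0: "1 / real (Suc k) \<le> c0" unfolding c0_def using ne lb by (rule cInf_greatest)
  moreover have "0 < 1 / real (Suc k)" by simp
  ultimately have c0pos: "c0 > 0" by linarith
  then have "c0 < c0 * \<rho>" using \<rho> by simp
  then obtain c where c: "c \<in> Cs" "c < c0 * \<rho>" unfolding c0_def using cInf_lessD[OF ne] by blast
  have "c / \<rho> < c0" using c(2) \<rho> by (simp add: field_simps)
  have "\<eta> \<le> T (c / \<rho>)"
  proof (rule ccontr)
    assume "\<not> ?thesis"
    moreover have "c / \<rho> > 0" using c(1) \<rho> unfolding Cs_def by simp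
    ultimately have "c / \<rho> \<in> Cs" unfolding Cs_def by simp
    then have "c0 \<le> c / \<rho>" unfolding c0_def using lb by (intro cInf_lower bdd_belowI)
    then show False using \<open>c / \<rho> < c0\<close> by simp
  qed
  then show thesis using that[of c] c(1) unfolding Cs_def T_def by simp
qed
theorem theorem3p1:
  fixes \<mu> :: "'a::euclidean_space measure" and \<Omega> :: "'a set" and f :: "'a \<Rightarrow> 'a"
    and \<epsilon> :: real
  assumes sets_mu: "sets \<mu> = sets borel"
    and radon: "\<And>C. compact C \<Longrightarrow> emeasure \<mu> C < \<infinity>"
    and open_Omega: "open \<Omega>"
    and finite_Omega: "emeasure \<mu> \<Omega> < \<infinity>"
    and f_borel: "f \<in> borel_measurable (restrict_space borel \<Omega>)"
    and f_perp: "AE x in \<mu>. x \<in> \<Omega> \<longrightarrow> (\<forall>v\<in>decomp_set \<mu> x. inner (f x) v = 0)"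
    and eps: "\<epsilon> > 0"
  shows "\<exists>K g (Dg :: 'a \<Rightarrow> 'a \<Rightarrow>\<^sub>L real).
           compact K \<and> K \<subseteq> \<Omega> \<and> emeasure \<mu> (\<Omega> - K) < ennreal \<epsilon> \<and>
           (\<forall>x\<in>\<Omega>. (g has_derivative blinfun_apply (Dg x)) (at x)) \<and> continuous_on \<Omega> Dg \<and>
           (\<forall>x\<in>K. blinfun_apply (Dg x) = (\<lambda>v. inner (f x) v)) \<and>
           (\<forall>p::ereal. 1 \<le> p \<longrightarrow>
              Lp_norm (restrict_space \<mu> \<Omega>) (\<lambda>x. norm (Dg x)) p
                \<le> ereal (1 + \<epsilon>) * Lp_norm (restrict_space \<mu> \<Omega>) (\<lambda>x. norm (f x)) p)"
proof -
  \<comment> \<open>The norms live on the restricted space \<open>N\<close>, while regularity,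
    differentiation and duality are applied to the finite Borel measure \<open>M\<close> on the
    whole space. The two agree on Borel subsets of \<Omega>.\<close>
  define N where "N = restrict_space \<mu> \<Omega>"
  define M where "M = density \<mu> (indicator \<Omega>)"
  have \<Omega>b: "\<Omega> \<in> sets \<mu>" using open_Omega sets_mu by simp
  have Ms: "sets M = sets borel" unfolding M_def using sets_mu by simp
  have spM: "space M = UNIV" using sets_eq_imp_space_eq[OF Ms] by simp
  have eM: "emeasure M A = emeasure \<mu> (\<Omega> \<inter> A)" if "A \<in> sets borel" for A
    unfolding M_def by (rule emeasure_restricted[OF \<Omega>b]) (use that sets_mu in simp)
  have Mf: "finite_measure M"
    by standard (use eM[of UNIV] spM finite_Omega in simp)
  interpret M: finite_measure M by fact
  have mM: "measure \<mu> A = measure M A" if "A \<in> sets borel" "A \<subseteq> \<Omega>" for A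
    using eM[OF that(1)] that(2) by (simp add: measure_def Int_absorb1)
  have spN: "space N = \<Omega>" unfolding N_def using sets_eq_imp_space_eq[OF sets_mu] by (simp add: space_restrict_space)
  have sN: "A \<in> sets N \<longleftrightarrow> A \<in> sets borel \<and> A \<subseteq> \<Omega>" for A
    unfolding N_def using sets_restrict_space_iff[of \<Omega> \<mu>] \<Omega>b sets_mu sets_eq_imp_space_eq[OF sets_mu] by auto
  have eN: "emeasure N A = emeasure M A" if "A \<in> sets borel" "A \<subseteq> \<Omega>" for A
    unfolding N_def using eM[OF that(1)] that(2) \<Omega>b sets_eq_imp_space_eq[OF sets_mu]
    by (subst emeasure_restrict_space) (auto simp: Int_absorb1)
  have mN: "measure N A = measure M A" if "A \<in> sets borel" "A \<subseteq> \<Omega>" for A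
    using eN[OF that] by (simp add: measure_def)
  have Nf: "finite_measure N"
    by standard (use eN[of \<Omega>] open_Omega spN M.emeasure_finite in simp)
  have Nset: "sets N = sets (restrict_space borel \<Omega>)"
    unfolding N_def by (rule sets_restrict_space_cong[OF sets_mu])
  have fN: "f \<in> borel_measurable N" using f_borel measurable_cong_sets[OF Nset refl] by blast
  define F where "F x = indicator \<Omega> x *\<^sub>R f x" for x
  have Fm: "F \<in> borel_measurable borel"
    unfolding F_def using f_borel open_Omega by (simp add: borel_measurable_restrict_space_iff)
  have FM: "F \<in> borel_measurable M" using Fm measurable_cong_sets[OF Ms refl] by blast
  have Ff: "F x = f x" if "x \<in> \<Omega>" for x using that by (simp add: F_def)
  have nFm: "(\<lambda>x. norm (F x)) \<in> borel_measurable borel" using Fm by measurable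
  have level: "{x. c < norm (F x)} \<in> sets borel" for c
    using borel_measurable_less[OF borel_measurable_const nFm, of c] by simp
  have level0: "{x. F x \<noteq> 0} \<in> sets borel" using level[of 0] by simp
  show ?thesis
  proof (cases "measure M {x. 0 < norm (F x)} = 0")
    \<comment> \<open>The field vanishes almost everywhere, so there is no positive quantile; the
      zero function works on a compact part of its zero set.\<close>
    case True
    define Z0 where "Z0 = \<Omega> - {x. 0 < norm (F x)}"
    have Z0b: "Z0 \<in> sets borel" unfolding Z0_def using open_Omega level0 by auto
    obtain K where K: "compact K" "K \<subseteq> Z0" "measure M (Z0 - K) < \<epsilon>"
      using inner_compact_approx[OF Mf Ms Z0b eps] by blast
    have Kb: "K \<in> sets borel" using K(1) by (simp add: compact_imp_closed borel_closed)
    have "measure M (\<Omega> - K) \<le> measure M ((Z0 - K) \<union> {x. 0 < norm (F x)})"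
      by (rule M.finite_measure_mono) (use Z0b Kb level0 Ms in \<open>auto simp: Z0_def\<close>)
    also have "\<dots> \<le> measure M (Z0 - K) + measure M {x. 0 < norm (F x)}"
      by (rule measure_Un_le) (use Z0b Kb level0 Ms in auto)
    finally have "measure M (\<Omega> - K) < \<epsilon>" using K(3) True by simp
    then have "emeasure M (\<Omega> - K) < ennreal \<epsilon>" using eps by (simp add: M.emeasure_eq_measure ennreal_lessI)
    moreover have "\<Omega> - K \<in> sets borel" using open_Omega Kb by auto
    ultimately have small: "emeasure \<mu> (\<Omega> - K) < ennreal \<epsilon>" using eM[of "\<Omega> - K"] by (simp add: Int_absorb1)
    have "f x = 0" if "x \<in> K" for x using that K(2) Ff[of x] unfolding Z0_def by auto
    then have "\<forall>x\<in>K. blinfun_apply 0 = (\<lambda>v. inner (f x) v)" by auto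
    moreover have "\<forall>x\<in>\<Omega>. ((\<lambda>x. 0) has_derivative blinfun_apply (0 :: 'a \<Rightarrow>\<^sub>L real)) (at x)"
      by (simp add: zero_blinfun.rep_eq)
    moreover have "\<forall>p::ereal. 1 \<le> p \<longrightarrow> Lp_norm (restrict_space \<mu> \<Omega>) (\<lambda>x. norm (0 :: 'a \<Rightarrow>\<^sub>L real)) p
                \<le> ereal (1 + \<epsilon>) * Lp_norm (restrict_space \<mu> \<Omega>) (\<lambda>x. norm (f x)) p"
      unfolding N_def[symmetric] using Lp_norm_zero_le[of "\<lambda>x. norm (f x)" N _ "1 + \<epsilon>"] fN eps by simp
    moreover have "K \<subseteq> \<Omega>" using K(2) unfolding Z0_def by auto
    ultimately show ?thesis using K(1) small
      by (intro exI[of _ K] exI[of _ "\<lambda>x. 0"]) (auto intro!: exI[of _ "\<lambda>x. 0"])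
  next
    case False
    define m0 where "m0 = measure M {x. 0 < norm (F x)}"
    have m0: "m0 > 0" using False unfolding m0_def by (simp add: zero_less_measure_iff)
    \<comment> \<open>The norm estimate loses three factors \<rho>.\<close>
    define \<rho> where "\<rho> = root 3 (1 + \<epsilon>)"
    have \<rho>: "\<rho> > 1" unfolding \<rho>_def using eps by simp
    have \<rho>3: "\<rho> ^ 3 = 1 + \<epsilon>" unfolding \<rho>_def using eps by (intro real_root_pow_pos2) auto
    \<comment> \<open>Truncation is one of four losses of measure, each at most
      \<open>\<epsilon> / 4\<close>; half of \<open>m0\<close> leaves room for the quantile.\<close>
    define \<eta> where "\<eta> = min (\<epsilon> / 4) (m0 / 2)"
    have \<eta>: "\<eta> > 0" "\<eta> \<le> \<epsilon> / 4" "\<eta> < m0" unfolding \<eta>_def using eps m0 by auto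
    obtain M0 where M0: "M0 > 0" "measure M {x. M0 < norm (F x)} < \<eta>" "\<eta> \<le> measure M {x. M0 / \<rho> < norm (F x)}"
    proof (rule quantile_level[OF Mf _ \<eta>(1) _ \<rho>])
      show "(\<lambda>x. norm (F x)) \<in> borel_measurable M" using FM by measurable
      show "\<eta> < measure M {x \<in> space M. 0 < norm (F x)}" using \<eta>(3) spM by (simp add: m0_def)
    qed (use spM in auto)
    define A0 where "A0 = \<Omega> - {x. M0 < norm (F x)}"
    have A0b: "A0 \<in> sets borel" unfolding A0_def using open_Omega level by auto
    have e4: "\<epsilon> / 4 > 0" using eps by simp
    obtain K0 where K0: "compact K0" "K0 \<subseteq> A0" "measure M (A0 - K0) < \<epsilon> / 4" "continuous_on K0 F"
      using Lusin_compact[OF Mf Ms Fm A0b e4] by blast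
    have K0\<Omega>: "K0 \<subseteq> \<Omega>" using K0(2) unfolding A0_def by auto
    have K0M: "norm (F x) \<le> M0" if "x \<in> K0" for x using K0(2) that unfolding A0_def by auto
    have K0b: "K0 \<in> sets borel" using K0(1) by (simp add: compact_imp_closed borel_closed)
    \<comment> \<open>The measure that the norm estimate allows for the set where the gradient may
      be as large as \<open>\<rho> * M0\<close>.\<close>
    define \<kappa> where "\<kappa> = (\<rho> - 1) / 2 * \<eta>"
    have \<kappa>: "\<kappa> > 0" unfolding \<kappa>_def using \<rho> \<eta> by simp
    obtain U where U: "open U" "K0 \<subseteq> U" "measure M (U - K0) < \<kappa>" using outer_open_approx[OF Mf Ms K0b \<kappa>] by blast
    define n where "n = measure M UNIV"
    \<comment> \<open>The level allowed for the gradient where \<open>f\<close> gives no control;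
      times the total mass it stays within the budget \<open>\<kappa> * M0\<close>.\<close>
    define D' where "D' = min M0 (\<kappa> * M0 / (n + 1))"
    have n0: "n \<ge> 0" unfolding n_def by simp
    have D': "D' > 0" "D' \<le> M0" unfolding D'_def using M0(1) \<kappa> n0 by auto
    have D'n: "D' * n \<le> \<kappa> * M0"
    proof -
      have "D' * n \<le> \<kappa> * M0 / (n + 1) * n" using n0 unfolding D'_def by (intro mult_right_mono) auto
      also have "\<dots> \<le> \<kappa> * M0 / (n + 1) * (n + 1)" using n0 \<kappa> M0(1) by (intro mult_left_mono) auto
      also have "\<dots> = \<kappa> * M0" using n0 by simp
      finally show ?thesis .
    qed
    \<comment> \<open>Solves \<open>D / (\<rho> - 1) + D = D'\<close>. On \<open>K0\<close> the
      gradient is at most |f| + \<open>D\<close>: where |f| is at least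
      \<open>D / (\<rho> - 1)\<close>, this is at most \<rho> times |f|, and elsewhere it is below
      \<open>D'\<close>.\<close>
    define D where "D = D' * (\<rho> - 1) / \<rho>"
    have D: "D > 0" unfolding D_def using D' \<rho> by simp
    have DD': "D / (\<rho> - 1) + D = D'" unfolding D_def using \<rho> by (simp add: field_simps)
    have Dle: "D \<le> D'" using DD' D \<rho> divide_pos_pos[of D "\<rho> - 1"] by linarith
    have DM0: "M0 + D \<le> \<rho> * M0"
    proof -
      have "D \<le> M0 * (\<rho> - 1) / \<rho>" unfolding D_def using D' \<rho> by (intro divide_right_mono mult_right_mono) auto
      also have "\<dots> \<le> M0 * (\<rho> - 1) / 1" using \<rho> M0(1) by (intro divide_left_mono) auto
      finally show ?thesis by (simp add: algebra_simps)
    qed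
    \<comment> \<open>Half of \<open>D\<close> is the margin in the weight, the other half is left
      to the correction.\<close>
    define \<delta> where "\<delta> = D / 2"
    have \<delta>: "\<delta> > 0" unfolding \<delta>_def using D by simp
    \<comment> \<open>The weight interpolates between |f| on \<open>K0\<close> and 0 off
      \<open>U\<close>, never exceeding \<open>M0\<close>. The gradient is thereby controlled
      outside \<open>K0\<close> as well.\<close>
    obtain w1 :: "'a \<Rightarrow> real" where w1: "continuous_on UNIV w1" "\<And>x. x \<in> K0 \<union> -U \<Longrightarrow> w1 x = (if x \<in> K0 then norm (F x) else 0)"
      "\<And>x. norm (w1 x) \<le> M0"
    proof (rule Tietze[of "K0 \<union> -U" "\<lambda>x. if x \<in> K0 then norm (F x) else 0" UNIV M0])
      show "continuous_on (K0 \<union> -U) (\<lambda>x. if x \<in> K0 then norm (F x) else 0)"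
      proof (rule continuous_on_closed_Un)
        show "continuous_on K0 (\<lambda>x. if x \<in> K0 then norm (F x) else 0)"
          by (rule continuous_on_eq[OF continuous_on_norm[OF K0(4)]]) simp
        show "continuous_on (-U) (\<lambda>x. if x \<in> K0 then norm (F x) else 0)"
          by (rule continuous_on_eq[OF continuous_on_const[of _ 0]]) (use U(2) in auto)
      qed (use K0(1) U(1) compact_imp_closed in auto)
      show "closedin (top_of_set UNIV) (K0 \<union> -U)"
        using closed_Un[OF compact_imp_closed[OF K0(1)] closed_Compl[OF U(1)]] by simp
    qed (use M0(1) K0M in \<open>auto simp: less_imp_le\<close>)
    define w where "w x = \<bar>w1 x\<bar> + \<delta>" for x
    have wK0: "w x = norm (F x) + \<delta>" if "x \<in> K0" for x using w1(2)[of x] that by (simp add: w_def)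
    have wc: "continuous_on UNIV w" unfolding w_def by (intro continuous_intros w1(1))
    have w\<delta>: "\<delta> \<le> w x" for x unfolding w_def by simp
    \<comment> \<open>On \<open>K0\<close> the ratio of |f| to |f| + \<delta> is largest at |f| =
      \<open>M0\<close>, which gives a strict gap uniform on \<open>K0\<close>.\<close>
    define \<theta> where "\<theta> = M0 / (M0 + \<delta>)"
    have \<theta>: "0 \<le> \<theta>" "\<theta> < 1" unfolding \<theta>_def using M0(1) \<delta> by auto
    have \<theta>w: "norm (F x) \<le> \<theta> * w x" if "x \<in> K0" for x
    proof -
      have "norm (F x) * \<delta> \<le> M0 * \<delta>" using K0M[OF that] \<delta> by (intro mult_right_mono) auto
      then have "norm (F x) * (M0 + \<delta>) \<le> M0 * (norm (F x) + \<delta>)" by (simp add: algebra_simps)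
      then show ?thesis unfolding wK0[OF that] \<theta>_def using M0(1) \<delta> by (simp add: field_simps)
    qed
    \<comment> \<open>Fixed before \<phi> is chosen, so that the approximation can be required to
      leave a remainder below \<open>\<delta>1\<close> on most of \<open>K0\<close>.\<close>
    obtain \<delta>1 where \<delta>1: "\<delta>1 > 0" and corr: "\<And>(K::'a set) r. compact K \<Longrightarrow> continuous_on K r \<Longrightarrow> (\<And>x. x \<in> K \<Longrightarrow> norm (r x) \<le> \<delta>1) \<Longrightarrow>
      \<exists>g G K'. C1_gradient g G \<and> (\<forall>x. norm (G x) \<le> \<delta>) \<and> compact K' \<and> K' \<subseteq> K \<and>
        measure M (K - K') < \<epsilon> / 4 \<and> (\<forall>x\<in>K'. G x = r x)"
      by (rule small_field_is_gradient[OF Mf Ms e4 \<delta>]) blast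
    have perp: "AE x in M. x \<in> K0 \<longrightarrow> (\<forall>v\<in>decomp_set \<mu> x. inner (F x) v = 0)"
    proof -
      have "AE x in \<mu>. 0 < (indicator \<Omega> x :: ennreal) \<longrightarrow> x \<in> K0 \<longrightarrow> (\<forall>v\<in>decomp_set \<mu> x. inner (F x) v = 0)"
        using f_perp by eventually_elim (auto simp: indicator_def F_def)
      then show ?thesis unfolding M_def using \<Omega>b by (subst AE_density) auto
    qed
    have d: "\<delta>1 * (\<epsilon> / 4) > 0" using \<delta>1 eps by simp
    obtain \<phi> where \<phi>: "test_function \<phi>" "\<And>x. norm (grad \<phi> x) \<le> w x"
      "(\<integral>x. indicator K0 x * norm (F x - grad \<phi> x) \<partial>M) < \<delta>1 * (\<epsilon> / 4)"
      using gradients_dense_under_bound[OF Mf Ms open_Omega mM K0(1) K0\<Omega> K0(4) wc \<delta> w\<delta> \<theta> \<theta>w perp d] by blast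
    have \<phi>C: "C1_gradient \<phi> (grad \<phi>)" using \<phi>(1) by (rule test_function_C1_gradient)
    then have gc: "continuous_on UNIV (grad \<phi>)" unfolding C1_gradient_def by blast
    have rc: "continuous_on K0 (\<lambda>x. F x - grad \<phi> x)"
      by (intro continuous_intros K0(4) continuous_on_subset[OF gc]) auto
    define K1 where "K1 = K0 \<inter> (\<lambda>x. norm (F x - grad \<phi> x)) -` {..\<delta>1}"
    have "closed K1" unfolding K1_def
      by (rule continuous_closed_preimage) (use rc K0(1) in \<open>auto intro!: continuous_intros simp: compact_imp_closed\<close>)
    then have K1c: "compact K1" using K0(1) compact_Int_closed[of K0 K1] unfolding K1_def by (simp add: Int_absorb1)
    have K1b: "K1 \<in> sets borel" using K1c by (simp add: compact_imp_closed borel_closed)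
    \<comment> \<open>Chebyshev: off \<open>K1\<close> the remainder exceeds
      \<open>\<delta>1\<close>, while its integral over \<open>K0\<close> is below
      \<open>\<delta>1 * (\<epsilon> / 4)\<close>.\<close>
    have K1m: "measure M (K0 - K1) < \<epsilon> / 4"
    proof -
      have Db: "K0 - K1 \<in> sets M" using K0b K1b Ms by auto
      have "\<delta>1 * measure M (K0 - K1) = (\<integral>x. \<delta>1 * indicator (K0 - K1) x \<partial>M)" using spM by simp
      also have "\<dots> \<le> (\<integral>x. indicator K0 x * norm (F x - grad \<phi> x) \<partial>M)"
      proof (rule integral_mono)
        show "integrable M (\<lambda>x. \<delta>1 * indicator (K0 - K1) x)"
          using Db by (intro integrable_mult_right) (simp add: integrable_indicator_iff less_top[symmetric])
        obtain C where C: "\<And>x. norm (grad \<phi> x) \<le> C" using grad_bounded[OF \<phi>(1)] by blast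
        show "integrable M (\<lambda>x. indicator K0 x * norm (F x - grad \<phi> x))"
        proof (rule M.integrable_const_bound[of _ "M0 + C"])
          have "grad \<phi> \<in> borel_measurable M" using borel_measurable_continuous_onI[OF gc] measurable_cong_sets[OF Ms refl] by blast
          then show "(\<lambda>x. indicator K0 x * norm (F x - grad \<phi> x)) \<in> borel_measurable M"
            using FM K0b Ms by (intro borel_measurable_times borel_measurable_indicator borel_measurable_norm borel_measurable_diff) auto
          have C0: "0 \<le> C" using C[of 0] norm_ge_zero order_trans by blast
          have "norm (indicator K0 x * norm (F x - grad \<phi> x)) \<le> M0 + C" for x
          proof (cases "x \<in> K0")
            case True
            have "norm (F x - grad \<phi> x) \<le> norm (F x) + norm (grad \<phi> x)" by (rule norm_triangle_ineq4)
            then show ?thesis using True K0M[of x] C[of x] by simp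
          qed (use M0(1) C0 in simp)
          then show "AE x in M. norm (indicator K0 x * norm (F x - grad \<phi> x)) \<le> M0 + C" by simp
        qed
        show "\<delta>1 * indicator (K0 - K1) x \<le> indicator K0 x * norm (F x - grad \<phi> x)" for x
          by (auto simp: indicator_def K1_def)
      qed
      also have "\<dots> < \<delta>1 * (\<epsilon> / 4)" by fact
      finally show ?thesis using \<delta>1 by simp
    qed
    have "norm (F x - grad \<phi> x) \<le> \<delta>1" if "x \<in> K1" for x using that unfolding K1_def by simp
    from corr[OF K1c continuous_on_subset[OF rc] this] obtain g2 G2 K where
      g2: "C1_gradient g2 G2" "\<And>x. norm (G2 x) \<le> \<delta>" and K: "compact K" "K \<subseteq> K1" "measure M (K1 - K) < \<epsilon> / 4"
      "\<And>x. x \<in> K \<Longrightarrow> G2 x = F x - grad \<phi> x" unfolding K1_def by blast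
    have Kb: "K \<in> sets borel" using K(1) by (simp add: compact_imp_closed borel_closed)
    have K10: "K1 \<subseteq> K0" unfolding K1_def by auto
    have K\<Omega>: "K \<subseteq> \<Omega>" using K(2) K10 K0\<Omega> by auto
    define g where "g x = \<phi> x + g2 x" for x
    define G where "G x = grad \<phi> x + G2 x" for x
    have gG: "C1_gradient g G" unfolding g_def[abs_def] G_def[abs_def] by (rule C1_gradient_add[OF \<phi>C g2(1)])
    define Dg where "Dg x = blinfun_inner_left (G x)" for x
    have Dgv: "blinfun_apply (Dg x) = (\<lambda>v. inner (G x) v)" for x unfolding Dg_def by (auto simp: inner_commute)
    have Gc: "continuous_on UNIV G" using gG unfolding C1_gradient_def by blast
    have "measure M (\<Omega> - K) < \<epsilon>"
    proof -
      \<comment> \<open>The four losses: truncation at \<open>M0\<close>, continuity of the field,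
        poor approximation by D\<phi>, and correction.\<close>
      have "measure M (\<Omega> - K) \<le> measure M ({x. M0 < norm (F x)} \<union> ((A0 - K0) \<union> ((K0 - K1) \<union> (K1 - K))))"
        by (rule M.finite_measure_mono) (use level A0b K0b K1b Kb Ms in \<open>auto simp: A0_def\<close>)
      also have "\<dots> \<le> measure M {x. M0 < norm (F x)} + measure M ((A0 - K0) \<union> ((K0 - K1) \<union> (K1 - K)))"
        by (rule measure_Un_le) (use level A0b K0b K1b Kb Ms in auto)
      also have "measure M ((A0 - K0) \<union> ((K0 - K1) \<union> (K1 - K))) \<le> measure M (A0 - K0) + measure M ((K0 - K1) \<union> (K1 - K))"
        by (rule measure_Un_le) (use A0b K0b K1b Kb Ms in auto)
      also have "measure M ((K0 - K1) \<union> (K1 - K)) \<le> measure M (K0 - K1) + measure M (K1 - K)"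
        by (rule measure_Un_le) (use K0b K1b Kb Ms in auto)
      finally show ?thesis using M0(2) \<eta>(2) K0(3) K1m K(3) by linarith
    qed
    then have "emeasure M (\<Omega> - K) < ennreal \<epsilon>" using eps by (simp add: M.emeasure_eq_measure ennreal_lessI)
    moreover have "\<Omega> - K \<in> sets borel" using open_Omega Kb by auto
    ultimately have small: "emeasure \<mu> (\<Omega> - K) < ennreal \<epsilon>" using eM[of "\<Omega> - K"] by (simp add: Int_absorb1)
    have der: "\<forall>x\<in>\<Omega>. (g has_derivative blinfun_apply (Dg x)) (at x)"
      unfolding Dgv using gG unfolding C1_gradient_def by blast
    have Dgc: "continuous_on \<Omega> Dg" unfolding Dg_def[abs_def]
      using bounded_linear.continuous_on[OF bounded_linear_blinfun_inner_left continuous_on_subset[OF Gc]] by blast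
    have DgK: "\<forall>x\<in>K. blinfun_apply (Dg x) = (\<lambda>v. inner (f x) v)"
    proof
      fix x assume x: "x \<in> K"
      then have "G x = f x" unfolding G_def using K(4)[OF x] Ff[of x] K\<Omega> by auto
      then show "blinfun_apply (Dg x) = (\<lambda>v. inner (f x) v)" unfolding Dgv by simp
    qed
    have nDg: "norm (Dg x) = norm (G x)" for x unfolding Dg_def by (rule norm_blinfun_inner_left)
    have Gb: "norm (G x) \<le> \<bar>w1 x\<bar> + D" for x
    proof -
      have "norm (G x) \<le> norm (grad \<phi> x) + norm (G2 x)" unfolding G_def by (rule norm_triangle_ineq)
      then show ?thesis using \<phi>(2)[of x] g2(2)[of x] unfolding w_def \<delta>_def by linarith
    qed
    define E where "E = (U - K0) \<inter> \<Omega>"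
    have Eb: "E \<in> sets borel" unfolding E_def using U(1) K0b open_Omega by auto
    have Lp: "Lp_norm N (\<lambda>x. norm (G x)) p \<le> ereal (\<rho> ^ 3) * Lp_norm N (\<lambda>x. norm (f x)) p" if p: "1 \<le> p" for p :: ereal
    proof (rule Lp_norm_le_of_domination[OF Nf _ _ _ _ _ \<rho> M0(1) \<eta>(1) D' _ _ _ _ p])
      have "G \<in> borel_measurable (restrict_space borel \<Omega>)"
        using borel_measurable_continuous_onI[OF Gc] by (rule measurable_restrict_space1)
      then have "G \<in> borel_measurable N" using measurable_cong_sets[OF Nset refl] by blast
      then show "(\<lambda>x. norm (G x)) \<in> borel_measurable N" by measurable
      show "(\<lambda>x. norm (f x)) \<in> borel_measurable N" using fN by measurable
      show "E \<in> sets N" unfolding sN using Eb by (auto simp: E_def)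
      have "measure M E \<le> measure M (U - K0)" by (rule M.finite_measure_mono) (use U(1) K0b Ms in \<open>auto simp: E_def\<close>)
      then show "measure N E \<le> (\<rho> - 1) / 2 * \<eta>" using U(3) mN[OF Eb] unfolding \<kappa>_def E_def by simp
      have "measure M \<Omega> \<le> n" unfolding n_def by (rule M.finite_measure_mono) (use Ms in auto)
      then have "D' * measure M \<Omega> \<le> D' * n" using D'(1) by simp
      then show "D' * measure N (space N) \<le> (\<rho> - 1) / 2 * \<eta> * M0" using D'n mN[of \<Omega>] open_Omega unfolding spN \<kappa>_def by simp
      have eq: "{x \<in> space N. M0 / \<rho> < norm (f x)} = {x. M0 / \<rho> < norm (F x)}"
      proof -
        have nn: "\<not> M0 / \<rho> < 0" using M0(1) \<rho> by (simp add: not_less)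
        show ?thesis unfolding spN by (auto simp: F_def indicator_def nn split: if_splits)
      qed
      then have "{x. M0 / \<rho> < norm (F x)} \<subseteq> \<Omega>" using spN by auto
      then show "\<eta> \<le> measure N {x \<in> space N. M0 / \<rho> < norm (f x)}"
        unfolding eq using mN[OF level] M0(3) by simp
      fix x assume "x \<in> space N"
      then have x: "x \<in> \<Omega>" using spN by simp
      \<comment> \<open>On \<open>K0\<close> the weight follows |f|, on the rest of \<open>U\<close>
        only the bound \<open>M0\<close> is known but the measure is small, and off \<open>U\<close>
        only the margin \<open>D\<close> is left.\<close>
      consider "x \<in> K0" | "x \<in> U - K0" | "x \<notin> U" by blast
      then show "norm (G x) \<le> \<rho> * norm (f x) \<or> norm (G x) \<le> D' \<or> x \<in> E \<and> norm (G x) \<le> \<rho> * M0"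
      proof cases
        case 1
        then have b: "norm (G x) \<le> norm (f x) + D" using Gb[of x] w1(2)[of x] Ff[OF x] by simp
        show ?thesis
        proof (cases "D / (\<rho> - 1) \<le> norm (f x)")
          case True
          then have "D \<le> norm (f x) * (\<rho> - 1)" using \<rho> by (simp add: field_simps)
          then have "norm (G x) \<le> \<rho> * norm (f x)" using b by (simp add: algebra_simps)
          then show ?thesis by blast
        next
          case False
          then show ?thesis using b DD' by linarith
        qed
      next
        case 2
        then have "norm (G x) \<le> \<rho> * M0" using Gb[of x] w1(3)[of x] DM0 by simp
        then show ?thesis using 2 x unfolding E_def by blast
      next
        case 3
        then have "w1 x = 0" using w1(2)[of x] U(2) by auto
        then show ?thesis using Gb[of x] Dle by simp
      qed
    qed auto
    have "\<forall>p::ereal. 1 \<le> p \<longrightarrow> Lp_norm (restrict_space \<mu> \<Omega>) (\<lambda>x. norm (Dg x)) p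
                \<le> ereal (1 + \<epsilon>) * Lp_norm (restrict_space \<mu> \<Omega>) (\<lambda>x. norm (f x)) p"
      using Lp unfolding nDg N_def \<rho>3 by blast
    then show ?thesis using K(1) K\<Omega> small der Dgc DgK by blast
  qed
qed

end
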